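(* Let $N\geq 4$, and let $\mathbb{G}$ be either $S_N^+$ or an exotic quantum permutation group $S_N\subsetneq\mathbb{G}\subsetneq S_N^+$, with magic fundamental representation $u=(u_{ij})\in M_N(C(\mathbb{G}))$ and Haar state $h$. Put $q(N)=N(N-1)(N^2-3N+1)$. Then \begin{align*} h(u_{11}u_{22}u_{11}u_{22})&=\frac{2N-5}{q(N)},\\ h(u_{11}u_{22}u_{11}u_{23})&=\frac{N-3}{q(N)},\\ h(u_{11}u_{22}u_{11}u_{33})&=\frac{N-2}{q(N)},\\ h(u_{11}u_{22}u_{13}u_{24})&=-\frac{1}{q(N)},\\ h(u_{11}u_{22}u_{13}u_{32})&=-\frac{N-3}{(N-2)q(N)},\\ h(u_{11}u_{22}u_{13}u_{34})&=\frac{1}{(N-2)q(N)},\\ h(u_{11}u_{22}u_{33}u_{44})&=\frac{N}{(N-2)q(N)}. \end{align*}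
   Context: A magic unitary in a unital $\mathrm{C}^*$-algebra $\mathcal{A}$ is a matrix $v=(v_{ij})_{i,j=1}^N\in M_N(\mathcal{A})$ whose entries are projections with $\sum_{k}v_{ik}=1_{\mathcal{A}}=\sum_k v_{kj}$ for all $i,j$. $C(S_N^+)$ is the universal unital $\mathrm{C}^*$-algebra generated by the entries of an $N\times N$ magic unitary, and $S_N^+$ is the quantum permutation group. A quantum permutation group $\mathbb{G}\subseteq S_N^+$ is given by a unital $\mathrm{C}^*$-algebra $C(\mathbb{G})$ generated by the entries of an $N\times N$ magic unitary $u=(u_{ij})$ (the magic fundamental representation) and admitting a $*$-homomorphism $\Delta:C(\mathbb{G})\to C(\mathbb{G})\otimes_{\min}C(\mathbb{G})$ with $\Delta(u_{ij})=\sum_k u_{ik}\otimes u_{kj}$. $C(\mathbb{G})$ is taken in its universal version, i.e. it is the universal $\mathrm{C}^*$-completion of the $*$-algebra generated by the $u_{ij}$. The classical permutation group $S_N$ is viewed this way through $C(S_N)$ and the magic unitary $(\mathds{1}_{j\to i})_{i,j}$, $\mathds{1}_{j\to i}(\sigma)=\delta_{i,\sigma(j)}$. For two such objects, $\mathbb{H}\subseteq\mathbb{G}$ means that there is a (surjective) $*$-homomorphism $C(\mathbb{G})\to C(\mathbb{H})$ sending the generators of $C(\mathbb{G})$ to the corresponding generators of $C(\mathbb{H})$; it is strict ($\subsetneq$) if this map is not an isomorphism. $\mathbb{G}$ is called exotic if $S_N\subsetneq\mathbb{G}\subsetneq S_N^+$. The Haar state $h$ of $\mathbb{G}$ is the unique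 state on $C(\mathbb{G})$ with $(h\otimes\mathrm{id})\Delta(f)=h(f)1=(\mathrm{id}\otimes h)\Delta(f)$ for all $f\in C(\mathbb{G})$. *)

theory Defs
  imports Complex_Main "HOL-Algebra.Algebra" "HOL-Algebra.Algebraic_Closure_Type"
    "HOL-Library.Nonpos_Ints"
begin

section \<open>Unital C*-algebras\<close>

record 'a cstar = "(complex, 'a) module" +
  star :: "'a \<Rightarrow> 'a"
  cnorm :: "'a \<Rightarrow> real"

locale cstar_algebra =
  ring A + module "ring_of_type_algebra :: complex ring" A
  for A :: "('a, 'm) cstar_scheme" (structure) +
  assumes smult_mult_left:
      "\<lbrakk>x \<in> carrier A; y \<in> carrier A\<rbrakk> \<Longrightarrow> (c \<odot> x) \<otimes> y = c \<odot> (x \<otimes> y)"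
    and smult_mult_right:
      "\<lbrakk>x \<in> carrier A; y \<in> carrier A\<rbrakk> \<Longrightarrow> x \<otimes> (c \<odot> y) = c \<odot> (x \<otimes> y)"
    and star_closed: "x \<in> carrier A \<Longrightarrow> star A x \<in> carrier A"
    and star_star: "x \<in> carrier A \<Longrightarrow> star A (star A x) = x"
    and star_add:
      "\<lbrakk>x \<in> carrier A; y \<in> carrier A\<rbrakk> \<Longrightarrow> star A (x \<oplus> y) = star A x \<oplus> star A y"
    and star_smult: "x \<in> carrier A \<Longrightarrow> star A (c \<odot> x) = cnj c \<odot> star A x"
    and star_mult:
      "\<lbrakk>x \<in> carrier A; y \<in> carrier A\<rbrakk> \<Longrightarrow> star A (x \<otimes> y) = star A y \<otimes> star A x"
    and cnorm_nonneg: "x \<in> carrier A \<Longrightarrow> 0 \<le> cnorm A x"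
    and cnorm_eq_0_iff: "x \<in> carrier A \<Longrightarrow> cnorm A x = 0 \<longleftrightarrow> x = \<zero>"
    and cnorm_triangle:
      "\<lbrakk>x \<in> carrier A; y \<in> carrier A\<rbrakk> \<Longrightarrow> cnorm A (x \<oplus> y) \<le> cnorm A x + cnorm A y"
    and cnorm_smult: "x \<in> carrier A \<Longrightarrow> cnorm A (c \<odot> x) = cmod c * cnorm A x"
    and cnorm_mult:
      "\<lbrakk>x \<in> carrier A; y \<in> carrier A\<rbrakk> \<Longrightarrow> cnorm A (x \<otimes> y) \<le> cnorm A x * cnorm A y"
    and cstar_identity: "x \<in> carrier A \<Longrightarrow> cnorm A (star A x \<otimes> x) = (cnorm A x)\<^sup>2"
    and complete:
      "\<lbrakk>\<And>n. f n \<in> carrier A;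
        \<forall>e>0. \<exists>M. \<forall>m\<ge>M. \<forall>n\<ge>M. cnorm A (f m \<ominus> f n) < e\<rbrakk>
       \<Longrightarrow> \<exists>l\<in>carrier A. (\<lambda>n::nat. cnorm A (f n \<ominus> l)) \<longlonglongrightarrow> 0"

text \<open>Unital *-homomorphisms.  Only the algebraic operations enter, so this also applies to
  a *-subalgebra \<open>D\<close> of \<open>A\<close>, written \<open>A\<lparr>carrier := D\<rparr>\<close>.\<close>

definition star_hom ::
    "('a, 'm) cstar_scheme \<Rightarrow> ('b, 'n) cstar_scheme \<Rightarrow> ('a \<Rightarrow> 'b) set" where
  "star_hom A B = {\<phi> \<in> ring_hom A B. \<forall>x\<in>carrier A.
     (\<forall>c. \<phi> (c \<odot>\<^bsub>A\<^esub> x) = c \<odot>\<^bsub>B\<^esub> \<phi> x) \<and> \<phi> (star A x) = star B (\<phi> x)}"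

inductive_set star_subalgebra_gen :: "('a, 'm) cstar_scheme \<Rightarrow> 'a set \<Rightarrow> 'a set"
  for A (structure) and D where
  gen: "x \<in> D \<Longrightarrow> x \<in> star_subalgebra_gen A D"
| zero: "\<zero> \<in> star_subalgebra_gen A D"
| one: "\<one> \<in> star_subalgebra_gen A D"
| add: "\<lbrakk>x \<in> star_subalgebra_gen A D; y \<in> star_subalgebra_gen A D\<rbrakk>
    \<Longrightarrow> x \<oplus> y \<in> star_subalgebra_gen A D"
| mult: "\<lbrakk>x \<in> star_subalgebra_gen A D; y \<in> star_subalgebra_gen A D\<rbrakk>
    \<Longrightarrow> x \<otimes> y \<in> star_subalgebra_gen A D"
| smult: "x \<in> star_subalgebra_gen A D \<Longrightarrow> c \<odot> x \<in> star_subalgebra_gen A D"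
| star: "x \<in> star_subalgebra_gen A D \<Longrightarrow> star A x \<in> star_subalgebra_gen A D"

definition norm_dense :: "('a, 'm) cstar_scheme \<Rightarrow> 'a set \<Rightarrow> bool" where
  "norm_dense A D \<longleftrightarrow> D \<subseteq> carrier A \<and>
     (\<forall>x\<in>carrier A. \<forall>e>0. \<exists>y\<in>D. cnorm A (x \<ominus>\<^bsub>A\<^esub> y) < e)"

definition linear_functional :: "('a, 'm) cstar_scheme \<Rightarrow> ('a \<Rightarrow> complex) \<Rightarrow> bool" where
  "linear_functional A h \<longleftrightarrow>
     (\<forall>x\<in>carrier A. \<forall>y\<in>carrier A. h (x \<oplus>\<^bsub>A\<^esub> y) = h x + h y) \<and>
     (\<forall>x\<in>carrier A. \<forall>c. h (c \<odot>\<^bsub>A\<^esub> x) = c * h x)"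

definition state :: "('a, 'm) cstar_scheme \<Rightarrow> ('a \<Rightarrow> complex) \<Rightarrow> bool" where
  "state A h \<longleftrightarrow> linear_functional A h \<and>
     (\<forall>x\<in>carrier A. h (star A x \<otimes>\<^bsub>A\<^esub> x) \<in> \<real>\<^sub>\<ge>\<^sub>0) \<and> h \<one>\<^bsub>A\<^esub> = 1"

definition bounded_linear_map ::
    "('a, 'm) cstar_scheme \<Rightarrow> ('b, 'n) cstar_scheme \<Rightarrow> ('a \<Rightarrow> 'b) \<Rightarrow> bool" where
  "bounded_linear_map A B S \<longleftrightarrow> S \<in> carrier A \<rightarrow> carrier B \<and>
     (\<forall>x\<in>carrier A. \<forall>y\<in>carrier A. S (x \<oplus>\<^bsub>A\<^esub> y) = S x \<oplus>\<^bsub>B\<^esub> S y) \<and>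
     (\<forall>x\<in>carrier A. \<forall>c. S (c \<odot>\<^bsub>A\<^esub> x) = c \<odot>\<^bsub>B\<^esub> S x) \<and>
     (\<exists>K. \<forall>x\<in>carrier A. cnorm B (S x) \<le> K * cnorm A x)"


section \<open>The minimal tensor product\<close>

definition is_cstar_norm_on ::
    "('a, 'm) cstar_scheme \<Rightarrow> 'a set \<Rightarrow> ('a \<Rightarrow> real) \<Rightarrow> bool" where
  "is_cstar_norm_on A D p \<longleftrightarrow>
     (\<forall>x\<in>D. 0 \<le> p x \<and> (p x = 0 \<longleftrightarrow> x = \<zero>\<^bsub>A\<^esub>) \<and>
        (\<forall>c. p (c \<odot>\<^bsub>A\<^esub> x) = cmod c * p x) \<and> p (star A x \<otimes>\<^bsub>A\<^esub> x) = (p x)\<^sup>2) \<and>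
     (\<forall>x\<in>D. \<forall>y\<in>D. p (x \<oplus>\<^bsub>A\<^esub> y) \<le> p x + p y \<and> p (x \<otimes>\<^bsub>A\<^esub> y) \<le> p x * p y)"

definition lin_indep_family :: "('a, 'm) cstar_scheme \<Rightarrow> nat \<Rightarrow> (nat \<Rightarrow> 'a) \<Rightarrow> bool" where
  "lin_indep_family A n a \<longleftrightarrow>
     (\<forall>c :: nat \<Rightarrow> complex. (\<Oplus>\<^bsub>A\<^esub>k\<in>{..<n}. c k \<odot>\<^bsub>A\<^esub> a k) = \<zero>\<^bsub>A\<^esub> \<longrightarrow> (\<forall>k<n. c k = 0))"

definition tensor_span ::
    "('a, 'm) cstar_scheme \<Rightarrow> ('b, 'n) cstar_scheme \<Rightarrow> ('t, 'k) cstar_scheme \<Rightarrow>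
     ('a \<Rightarrow> 'b \<Rightarrow> 't) \<Rightarrow> 't set" where
  "tensor_span A B T \<tau> = {\<Oplus>\<^bsub>T\<^esub>k\<in>{..<n}. \<tau> (a k) (b k) | (n::nat) a b.
     a \<in> {..<n} \<rightarrow> carrier A \<and> b \<in> {..<n} \<rightarrow> carrier B}"

text \<open>\<open>T\<close>, with \<open>\<tau> a b\<close> in the role of the elementary tensor of \<open>a\<close> and \<open>b\<close>, is the minimal
  tensor product of \<open>A\<close> and \<open>B\<close>: the algebraic tensor product embeds in \<open>T\<close> as a dense
  *-subalgebra (by \<open>faithful\<close>, the linear map that \<open>\<tau>\<close> induces on it is injective), and the
  norm of \<open>T\<close> restricts to the least C*-norm on it.  This determines \<open>T\<close> up to isomorphism.\<close>

locale min_tensor_product =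
  fixes A :: "('a, 'm) cstar_scheme" and B :: "('b, 'n) cstar_scheme"
    and T :: "('t, 'k) cstar_scheme" and \<tau> :: "'a \<Rightarrow> 'b \<Rightarrow> 't"
  assumes cstar_A: "cstar_algebra A" and cstar_B: "cstar_algebra B" and cstar_T: "cstar_algebra T"
    and tensor_closed: "\<lbrakk>a \<in> carrier A; b \<in> carrier B\<rbrakk> \<Longrightarrow> \<tau> a b \<in> carrier T"
    and tensor_add_left:
      "\<lbrakk>a \<in> carrier A; a' \<in> carrier A; b \<in> carrier B\<rbrakk> \<Longrightarrow> \<tau> (a \<oplus>\<^bsub>A\<^esub> a') b = \<tau> a b \<oplus>\<^bsub>T\<^esub> \<tau> a' b"
    and tensor_add_right:
      "\<lbrakk>a \<in> carrier A; b \<in> carrier B; b' \<in> carrier B\<rbrakk> \<Longrightarrow> \<tau> a (b \<oplus>\<^bsub>B\<^esub> b') = \<tau> a b \<oplus>\<^bsub>T\<^esub> \<tau> a b'"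
    and tensor_smult_left:
      "\<lbrakk>a \<in> carrier A; b \<in> carrier B\<rbrakk> \<Longrightarrow> \<tau> (c \<odot>\<^bsub>A\<^esub> a) b = c \<odot>\<^bsub>T\<^esub> \<tau> a b"
    and tensor_smult_right:
      "\<lbrakk>a \<in> carrier A; b \<in> carrier B\<rbrakk> \<Longrightarrow> \<tau> a (c \<odot>\<^bsub>B\<^esub> b) = c \<odot>\<^bsub>T\<^esub> \<tau> a b"
    and tensor_mult:
      "\<lbrakk>a \<in> carrier A; a' \<in> carrier A; b \<in> carrier B; b' \<in> carrier B\<rbrakk>
       \<Longrightarrow> \<tau> a b \<otimes>\<^bsub>T\<^esub> \<tau> a' b' = \<tau> (a \<otimes>\<^bsub>A\<^esub> a') (b \<otimes>\<^bsub>B\<^esub> b')"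
    and tensor_one: "\<tau> \<one>\<^bsub>A\<^esub> \<one>\<^bsub>B\<^esub> = \<one>\<^bsub>T\<^esub>"
    and tensor_star:
      "\<lbrakk>a \<in> carrier A; b \<in> carrier B\<rbrakk> \<Longrightarrow> star T (\<tau> a b) = \<tau> (star A a) (star B b)"
    and faithful:
      "\<lbrakk>f \<in> {..<n} \<rightarrow> carrier A; g \<in> {..<n} \<rightarrow> carrier B; lin_indep_family A n f;
        (\<Oplus>\<^bsub>T\<^esub>k\<in>{..<n}. \<tau> (f k) (g k)) = \<zero>\<^bsub>T\<^esub>\<rbrakk> \<Longrightarrow> \<forall>k<n. g k = \<zero>\<^bsub>B\<^esub>"
    and span_dense: "norm_dense T (tensor_span A B T \<tau>)"
    and norm_least:
      "\<lbrakk>is_cstar_norm_on T (tensor_span A B T \<tau>) p; x \<in> tensor_span A B T \<tau>\<rbrakk> \<Longrightarrow> cnorm T x \<le> p x"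


section \<open>Quantum permutation groups\<close>

text \<open>Matrices in \<open>M\<^sub>N(A)\<close> are functions of two indices, of which only the values at
  indices in \<open>{1..N}\<close> matter.\<close>

definition magic_unitary ::
    "nat \<Rightarrow> ('a, 'm) cstar_scheme \<Rightarrow> (nat \<Rightarrow> nat \<Rightarrow> 'a) \<Rightarrow> bool" where
  "magic_unitary N A v \<longleftrightarrow>
     (\<forall>i\<in>{1..N}. \<forall>j\<in>{1..N}.
        v i j \<in> carrier A \<and> star A (v i j) = v i j \<and> v i j \<otimes>\<^bsub>A\<^esub> v i j = v i j) \<and>
     (\<forall>i\<in>{1..N}. (\<Oplus>\<^bsub>A\<^esub>k\<in>{1..N}. v i k) = \<one>\<^bsub>A\<^esub>) \<and>
     (\<forall>j\<in>{1..N}. (\<Oplus>\<^bsub>A\<^esub>k\<in>{1..N}. v k j) = \<one>\<^bsub>A\<^esub>)"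

definition coeff_algebra ::
    "nat \<Rightarrow> ('a, 'm) cstar_scheme \<Rightarrow> (nat \<Rightarrow> nat \<Rightarrow> 'a) \<Rightarrow> 'a set" where
  "coeff_algebra N A u = star_subalgebra_gen A {u i j | i j. i \<in> {1..N} \<and> j \<in> {1..N}}"

definition generated_by_magic_unitary ::
    "nat \<Rightarrow> ('a, 'm) cstar_scheme \<Rightarrow> (nat \<Rightarrow> nat \<Rightarrow> 'a) \<Rightarrow> bool" where
  "generated_by_magic_unitary N A u \<longleftrightarrow>
     cstar_algebra A \<and> magic_unitary N A u \<and> norm_dense A (coeff_algebra N A u)"

text \<open>The universal properties below quantify over C*-algebras, which HOL only allows on a fixed
  type.  Their targets may be replaced by the C*-subalgebra generated by the images of the finitely
  many generators; it is separable, so has at most the cardinality of the continuum and can be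
  carried by a subset of the following type (of infinite complex matrices, such as those of the
  operators on a separable Hilbert space).\<close>

type_synonym separable_cstar = "(nat \<Rightarrow> nat \<Rightarrow> complex) cstar"

text \<open>\<open>A\<close> is the universal C*-completion of its *-subalgebra generated by the \<open>u i j\<close>.\<close>

definition universal_version ::
    "nat \<Rightarrow> ('a, 'm) cstar_scheme \<Rightarrow> (nat \<Rightarrow> nat \<Rightarrow> 'a) \<Rightarrow> bool" where
  "universal_version N A u \<longleftrightarrow>
     (\<forall>(B :: separable_cstar) \<phi>.
        cstar_algebra B \<and> \<phi> \<in> star_hom (A\<lparr>carrier := coeff_algebra N A u\<rparr>) B \<longrightarrow>
        (\<exists>\<psi>\<in>star_hom A B. \<forall>x\<in>coeff_algebra N A u. \<psi> x = \<phi> x))"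

text \<open>The C*-algebra of the quantum group is \<open>A\<close>, its magic fundamental representation is \<open>u\<close>, and
  \<open>\<Delta>\<close> takes values in the minimal tensor product \<open>T\<close> of \<open>A\<close> with itself.\<close>

definition quantum_permutation_group ::
    "nat \<Rightarrow> ('a, 'm) cstar_scheme \<Rightarrow> (nat \<Rightarrow> nat \<Rightarrow> 'a) \<Rightarrow>
     ('t, 'k) cstar_scheme \<Rightarrow> ('a \<Rightarrow> 'a \<Rightarrow> 't) \<Rightarrow> ('a \<Rightarrow> 't) \<Rightarrow> bool" where
  "quantum_permutation_group N A u T \<tau> \<Delta> \<longleftrightarrow>
     generated_by_magic_unitary N A u \<and> universal_version N A u \<and>
     min_tensor_product A A T \<tau> \<and> \<Delta> \<in> star_hom A T \<and>
     (\<forall>i\<in>{1..N}. \<forall>j\<in>{1..N}. \<Delta> (u i j) = (\<Oplus>\<^bsub>T\<^esub>k\<in>{1..N}. \<tau> (u i k) (u k j)))"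

text \<open>\<open>(S, w)\<close> is \<open>C(S\<^sub>N\<^sup>+)\<close> with its generating magic unitary.\<close>

definition quantum_symmetric_group ::
    "nat \<Rightarrow> ('a, 'm) cstar_scheme \<Rightarrow> (nat \<Rightarrow> nat \<Rightarrow> 'a) \<Rightarrow> bool" where
  "quantum_symmetric_group N S w \<longleftrightarrow>
     generated_by_magic_unitary N S w \<and>
     (\<forall>(B :: separable_cstar) v. cstar_algebra B \<and> magic_unitary N B v \<longrightarrow>
        (\<exists>\<phi>\<in>star_hom S B. \<forall>i\<in>{1..N}. \<forall>j\<in>{1..N}. \<phi> (w i j) = v i j))"

text \<open>\<open>C(S\<^sub>N)\<close>: functions on the permutations of \<open>{1..N}\<close>, extended by zero to all functions
  on the naturals.\<close>

definition classical_algebra :: "nat \<Rightarrow> ((nat \<Rightarrow> nat) \<Rightarrow> complex) cstar" where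
  "classical_algebra N =
    \<lparr>carrier = {f. \<forall>\<sigma>. \<not> \<sigma> permutes {1..N} \<longrightarrow> f \<sigma> = 0},
     monoid.mult = (\<lambda>f g \<sigma>. f \<sigma> * g \<sigma>),
     one = (\<lambda>\<sigma>. if \<sigma> permutes {1..N} then 1 else 0),
     ring.zero = (\<lambda>\<sigma>. 0),
     add = (\<lambda>f g \<sigma>. f \<sigma> + g \<sigma>),
     module.smult = (\<lambda>c f \<sigma>. c * f \<sigma>),
     star = (\<lambda>f \<sigma>. cnj (f \<sigma>)),
     cnorm = (\<lambda>f. Max ((\<lambda>\<sigma>. cmod (f \<sigma>)) ` {\<sigma>. \<sigma> permutes {1..N}}))\<rparr>"

definition classical_fund :: "nat \<Rightarrow> nat \<Rightarrow> nat \<Rightarrow> (nat \<Rightarrow> nat) \<Rightarrow> complex" where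
  "classical_fund N i j = (\<lambda>\<sigma>. if \<sigma> permutes {1..N} \<and> i = \<sigma> j then 1 else 0)"

text \<open>The relations between quantum permutation groups with algebras \<open>B\<close>, \<open>A\<close> and
  generators \<open>v\<close>, \<open>u\<close>.  A *-homomorphism \<open>\<phi>\<close> as below is determined by its values on
  generators, so quantifying existentially over it is harmless in \<open>strict_qsubgroup\<close>.\<close>

definition generator_homs ::
    "nat \<Rightarrow> ('a, 'm) cstar_scheme \<Rightarrow> (nat \<Rightarrow> nat \<Rightarrow> 'a) \<Rightarrow>
     ('b, 'n) cstar_scheme \<Rightarrow> (nat \<Rightarrow> nat \<Rightarrow> 'b) \<Rightarrow> ('a \<Rightarrow> 'b) set" where
  "generator_homs N A u B v = {\<phi> \<in> star_hom A B.
     \<phi> ` carrier A = carrier B \<and> (\<forall>i\<in>{1..N}. \<forall>j\<in>{1..N}. \<phi> (u i j) = v i j)}"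

definition equal_qgroup ::
    "nat \<Rightarrow> ('b, 'n) cstar_scheme \<Rightarrow> (nat \<Rightarrow> nat \<Rightarrow> 'b) \<Rightarrow>
     ('a, 'm) cstar_scheme \<Rightarrow> (nat \<Rightarrow> nat \<Rightarrow> 'a) \<Rightarrow> bool" where
  "equal_qgroup N B v A u \<longleftrightarrow>
     (\<exists>\<phi>\<in>generator_homs N A u B v. bij_betw \<phi> (carrier A) (carrier B))"

definition strict_qsubgroup ::
    "nat \<Rightarrow> ('b, 'n) cstar_scheme \<Rightarrow> (nat \<Rightarrow> nat \<Rightarrow> 'b) \<Rightarrow>
     ('a, 'm) cstar_scheme \<Rightarrow> (nat \<Rightarrow> nat \<Rightarrow> 'a) \<Rightarrow> bool" where
  "strict_qsubgroup N B v A u \<longleftrightarrow>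
     (\<exists>\<phi>\<in>generator_homs N A u B v. \<not> bij_betw \<phi> (carrier A) (carrier B))"

definition exotic ::
    "nat \<Rightarrow> ('s, 'k) cstar_scheme \<Rightarrow> (nat \<Rightarrow> nat \<Rightarrow> 's) \<Rightarrow>
     ('a, 'm) cstar_scheme \<Rightarrow> (nat \<Rightarrow> nat \<Rightarrow> 'a) \<Rightarrow> bool" where
  "exotic N S w A u \<longleftrightarrow>
     strict_qsubgroup N (classical_algebra N) (classical_fund N) A u \<and>
     strict_qsubgroup N A u S w"


section \<open>The Haar state\<close>

text \<open>\<open>S\<close> is the bounded linear extension \<open>h \<otimes> id\<close> from elementary tensors to \<open>T\<close>; the map
  \<open>id \<otimes> h\<close> is obtained by exchanging the arguments of \<open>\<tau>\<close>.\<close>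

definition is_slice_map ::
    "('a, 'm) cstar_scheme \<Rightarrow> ('t, 'k) cstar_scheme \<Rightarrow> ('a \<Rightarrow> 'a \<Rightarrow> 't) \<Rightarrow> ('a \<Rightarrow> complex) \<Rightarrow>
     ('t \<Rightarrow> 'a) \<Rightarrow> bool" where
  "is_slice_map A T \<tau> h S \<longleftrightarrow> bounded_linear_map T A S \<and>
     (\<forall>a\<in>carrier A. \<forall>b\<in>carrier A. S (\<tau> a b) = h a \<odot>\<^bsub>A\<^esub> b)"

definition haar_state ::
    "('a, 'm) cstar_scheme \<Rightarrow> ('t, 'k) cstar_scheme \<Rightarrow> ('a \<Rightarrow> 'a \<Rightarrow> 't) \<Rightarrow> ('a \<Rightarrow> 't) \<Rightarrow>
     ('a \<Rightarrow> complex) \<Rightarrow> bool" where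
  "haar_state A T \<tau> \<Delta> h \<longleftrightarrow> state A h \<and>
     (\<exists>S. is_slice_map A T \<tau> h S \<and>
        (\<forall>f\<in>carrier A. S (\<Delta> f) = h f \<odot>\<^bsub>A\<^esub> \<one>\<^bsub>A\<^esub>)) \<and>
     (\<exists>S. is_slice_map A T (\<lambda>a b. \<tau> b a) h S \<and>
        (\<forall>f\<in>carrier A. S (\<Delta> f) = h f \<odot>\<^bsub>A\<^esub> \<one>\<^bsub>A\<^esub>))"

definition q_poly :: "nat \<Rightarrow> complex" where
  "q_poly N = of_nat N * (of_nat N - 1) * ((of_nat N)\<^sup>2 - 3 * of_nat N + 1)"

end

theory Submission
  imports Defs "HOL-Analysis.Euclidean_Space" "HOL-Analysis.Operator_Norm"
begin

text \<open>For a column index \<open>j\<close>, the function \<open>k \<mapsto> h(u\<^bsub>k j\<^esub>)\<close> on multi-indices of length four is a fixed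
  vector of the fourth tensor power of \<open>u\<close>; evaluating at permutations shows that it depends only on
  which entries of \<open>k\<close> agree.  Such a function is a combination of the fifteen partitions of a
  four-point set.  Fourteen of them are noncrossing, hence fixed anyway; if the coefficient of the
  crossing one did not vanish, that partition would be fixed too, which forces the \<open>u\<^bsub>i j\<^esub>\<close> to commute.
  But then \<open>C(G)\<close> would be \<open>C(S\<^sub>N)\<close>.  The vanishing of the crossing coefficient is one linear equation
  between the moments; together with the three obtained by summing over one row index it determines
  all of them.\<close>

section \<open>Projections with sum one are orthogonal\<close>

text \<open>A C*-algebra is given here by axioms on product, star and norm alone; neither positivity
  nor a representation on a Hilbert space is at hand. Even the orthogonality of the entries in a
  row, immediate for operators, is therefore drawn from norm estimates: the unit of a corner is
  extreme among its self-adjoint elements of norm at most one. The crossing equation is where it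
  matters that G is not classical. Instead of writing down fifteen partitions, a fixed vector is
  compressed by one generator on each side; orthogonality then leaves only four kinds of values,
  combined with signs into the crossing coefficient. Noncommuting generators come from the
  strictness of the inclusion of S_N in the exotic case, and from two noncommuting projections in
  M_2 for S_N^+. The factor N(N-1) of q(N) is the reciprocal of h(u_11 u_22). The factor N^2-3N+1 is
  the coefficient of the remaining unknown once the other three are eliminated from the four
  equations.\<close>

lemma ring_of_type_algebra_simps [simp]:
  "carrier (ring_of_type_algebra :: 'c::ring_1 ring) = UNIV"
  "\<zero>\<^bsub>(ring_of_type_algebra :: 'c ring)\<^esub> = 0"
  "\<one>\<^bsub>(ring_of_type_algebra :: 'c ring)\<^esub> = 1"
  "a \<oplus>\<^bsub>(ring_of_type_algebra :: 'c ring)\<^esub> b = a + b"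
  "a \<otimes>\<^bsub>(ring_of_type_algebra :: 'c ring)\<^esub> b = a * b"
  by (simp_all add: ring_of_type_algebra_def)

context cstar_algebra
begin

text \<open>Under their short names, the ring facts inherited by the locale are those of the ring of scalars.\<close>

lemma is_ring_A: "ring A" ..

lemma semiring_A: "semiring A" ..

lemmas A_plus_ac = abelian_monoid.a_ac[OF abelian_group.axioms(1)[OF ring.is_abelian_group[OF is_ring_A]]]
lemmas A_minus = ring.ring_simprules(14)[OF is_ring_A]
lemmas A_minus_equality = abelian_group.minus_equality[OF ring.is_abelian_group[OF is_ring_A]]
lemmas A_a_closed = ring.ring_simprules(1)[OF is_ring_A]
lemmas A_finsum_closed = abelian_monoid.finsum_closed[OF abelian_group.axioms(1)[OF ring.is_abelian_group[OF is_ring_A]]]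
lemmas A_finsum_insert = abelian_monoid.finsum_insert[OF abelian_group.axioms(1)[OF ring.is_abelian_group[OF is_ring_A]]]
lemmas A_finsum_cong = abelian_monoid.finsum_cong'[OF abelian_group.axioms(1)[OF ring.is_abelian_group[OF is_ring_A]]]
lemmas A_finsum_addf = abelian_monoid.finsum_addf[OF abelian_group.axioms(1)[OF ring.is_abelian_group[OF is_ring_A]]]
lemmas A_assoc = monoid.m_assoc[OF ring.is_monoid[OF is_ring_A]]
lemmas A_m_closed = monoid.m_closed[OF ring.is_monoid[OF is_ring_A]]
lemmas A_l_distr = ring.ring_simprules(13)[OF is_ring_A]
lemmas A_r_distr = ring.ring_simprules(23)[OF is_ring_A]
lemmas A_finsum_ldistr = semiring.finsum_ldistr[OF semiring_A]
lemmas A_finsum_rdistr = semiring.finsum_rdistr[OF semiring_A]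

lemma smult_add_left: "x \<in> carrier A \<Longrightarrow> (a + b) \<odot> x = a \<odot> x \<oplus> b \<odot> x"
  using smult_l_distr[of a b x] by simp

lemma smult_add_right: "x \<in> carrier A \<Longrightarrow> y \<in> carrier A \<Longrightarrow> a \<odot> (x \<oplus> y) = a \<odot> x \<oplus> a \<odot> y"
  using smult_r_distr[of a x y] by simp

lemma smult_smult: "x \<in> carrier A \<Longrightarrow> a \<odot> (b \<odot> x) = (a * b) \<odot> x"
  using smult_assoc1[of a b x] by simp

lemma one_smult: "x \<in> carrier A \<Longrightarrow> 1 \<odot> x = x"
  using smult_one[of x] by simp

lemma zero_smult: "x \<in> carrier A \<Longrightarrow> 0 \<odot> x = \<zero>"
  using smult_l_null[of x] by simp

lemma smult_zero: "a \<odot> \<zero> = \<zero>"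
  using smult_r_null[of a] by simp

lemma smult_in [simp]: "x \<in> carrier A \<Longrightarrow> a \<odot> x \<in> carrier A"
  by simp

lemma minus_eq_smult:
  assumes "x \<in> carrier A"
  shows "\<ominus> x = (-1) \<odot> x"
proof -
  have "(-1) \<odot> x \<oplus> x = \<zero>"
    using smult_add_left[of x "-1" 1] assms by (simp add: one_smult zero_smult)
  then show ?thesis
    using assms by (intro A_minus_equality smult_in) auto
qed

lemma add_eq_left_imp_zero:
  assumes "x \<in> carrier A" "y \<in> carrier A" "x \<oplus> y = x"
  shows "y = \<zero>"
  using ring.ring_simprules(18)[OF is_ring_A, of x y] ring.ring_simprules(9)[OF is_ring_A, of x] assms
  by simp

lemma diff_eq_smult: "x \<in> carrier A \<Longrightarrow> y \<in> carrier A \<Longrightarrow> x \<ominus> y = x \<oplus> (-1) \<odot> y"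
  using A_minus[of x y] minus_eq_smult[of y] by simp

lemmas smult_algebra =
  smult_add_right smult_smult one_smult zero_smult smult_zero smult_mult_left smult_mult_right

lemma cnorm_zero: "cnorm A \<zero> = 0"
  by (simp add: cnorm_eq_0_iff)

lemma cnorm_add_le:
  "\<lbrakk>x \<in> carrier A; y \<in> carrier A; cnorm A x \<le> a; cnorm A y \<le> b\<rbrakk> \<Longrightarrow> cnorm A (x \<oplus> y) \<le> a + b"
  using cnorm_triangle[of x y] by simp

lemma cnorm_projection_le_1:
  assumes "p \<in> carrier A" "star A p = p" "p \<otimes> p = p"
  shows "cnorm A p \<le> 1"
proof -
  have "cnorm A p * cnorm A p = cnorm A p"
    using cstar_identity[of p] assms by (simp add: power2_eq_square)
  then show ?thesis by auto
qed

lemma star_one: "star A \<one> = \<one>"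
proof -
  have "star A \<one> = star A (star A \<one> \<otimes> \<one>)"
    using star_mult[of "star A \<one>" "\<one>"] star_star[of \<one>] star_closed[of \<one>] by simp
  then show ?thesis using star_star[of \<one>] star_closed[of \<one>] by simp
qed

lemma star_zero: "star A \<zero> = \<zero>"
  using star_smult[of \<zero> 0] star_closed[of \<zero>] by (simp add: smult_zero zero_smult)

text \<open>The radius grows because \<open>p + (3/2)v x\<close> is a convex combination of the cubes \<open>(p + \<omega>\<^sup>k v x)\<^sup>3\<close> for a
  primitive sixth root of unity \<open>\<omega>\<close>; the weights are the Fejer kernel \<open>1 + cos\<close> at the sixth roots.\<close>

lemma unital_disc_extend:
  assumes p: "p \<in> carrier A" "p \<otimes> p = p" and x: "x \<in> carrier A" "p \<otimes> x = x" "x \<otimes> p = x"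
    and disc: "\<And>z. cmod z \<le> r \<Longrightarrow> cnorm A (p \<oplus> z \<odot> x) \<le> 1"
    and z: "cmod z \<le> 3 / 2 * r"
  shows "cnorm A (p \<oplus> z \<odot> x) \<le> 1"
proof -
  define C where "C a b c d = a \<odot> p \<oplus> b \<odot> x \<oplus> c \<odot> (x \<otimes> x) \<oplus> d \<odot> (x \<otimes> (x \<otimes> x))" for a b c d
  have C_in: "C a b c d \<in> carrier A" for a b c d
    using p x by (simp add: C_def)
  have C_add: "C a b c d \<oplus> C a' b' c' d' = C (a + a') (b + b') (c + c') (d + d')"
    for a b c d a' b' c' d'
    using p x by (simp add: C_def smult_add_left A_plus_ac)
  have C_smult: "t \<odot> C a b c d = C (t * a) (t * b) (t * c) (t * d)" for t a b c d
    using p x by (simp add: C_def smult_algebra)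
  have pxx: "p \<otimes> (x \<otimes> x) = x \<otimes> x"
    using p x by (simp flip: A_assoc)
  have sq: "(p \<oplus> v \<odot> x) \<otimes> (p \<oplus> v \<odot> x) = C 1 (2 * v) (v\<^sup>2) 0" for v
    using p x smult_add_left[of x v v]
    by (simp add: C_def A_l_distr A_r_distr smult_algebra power2_eq_square A_plus_ac pxx)
  have cube: "(p \<oplus> v \<odot> x) \<otimes> ((p \<oplus> v \<odot> x) \<otimes> (p \<oplus> v \<odot> x)) = C 1 (3 * v) (3 * v\<^sup>2) (v ^ 3)" for v
  proof -
    have "(p \<oplus> v \<odot> x) \<otimes> C 1 (2 * v) (v\<^sup>2) 0 = C 1 (2 * v) (v\<^sup>2) 0 \<oplus> C 0 v (2 * v\<^sup>2) (v ^ 3)"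
      using p x by (simp add: C_def A_l_distr A_r_distr smult_algebra pxx power2_eq_square power3_eq_cube
        mult_ac A_plus_ac)
    then show ?thesis by (simp add: sq C_add)
  qed
  have C_norm: "cnorm A (C 1 (3 * v) (3 * v\<^sup>2) (v ^ 3)) \<le> 1" if "cmod v \<le> r" for v
  proof -
    let ?y = "p \<oplus> v \<odot> x"
    have y: "?y \<in> carrier A" using p x by simp
    have "cnorm A (?y \<otimes> (?y \<otimes> ?y)) \<le> cnorm A ?y * (cnorm A ?y * cnorm A ?y)"
      using y by (intro order.trans[OF cnorm_mult] mult_left_mono cnorm_mult cnorm_nonneg) auto
    also have "\<dots> \<le> 1 * (1 * 1)"
      using disc[OF that] y by (intro mult_mono) (auto simp: cnorm_nonneg)
    finally show ?thesis by (simp add: cube)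
  qed
  \<comment> \<open>Under the weights below, the linear coefficients \<open>3 * (w * v)\<close>
    average to \<open>3/2 * v\<close>. The factor 2/3 makes this equal to \<open>z\<close> and keeps
    \<open>v\<close> inside the known disc.\<close>
  define v where "v = 2 / 3 * z"
  define \<omega> where "\<omega> = Complex (1 / 2) (sqrt 3 / 2)"
  have \<omega>2: "\<omega>\<^sup>2 = \<omega> - 1"
    by (simp add: \<omega>_def power2_eq_square complex_eq_iff)
  have \<omega>3: "\<omega> ^ 3 = - 1"
  proof -
    have "\<omega> ^ 3 = \<omega> * (\<omega> - 1)"
      using \<omega>2 by (simp add: power3_eq_cube power2_eq_square)
    also have "\<dots> = \<omega>\<^sup>2 - \<omega>"
      by (simp add: power2_eq_square algebra_simps)
    finally show ?thesis using \<omega>2 by simp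
  qed
  have mods: "cmod \<omega> = 1" "cmod (1 - \<omega>) = 1"
    by (simp_all add: \<omega>_def cmod_def power2_eq_square)
  have v: "cmod v \<le> r"
    using z by (simp add: v_def norm_mult)
  define D where "D t w = t \<odot> C 1 (3 * w) (3 * w\<^sup>2) (w ^ 3)" for t w
  have D_in: "D t w \<in> carrier A" for t w
    using C_in by (simp add: D_def)
  have D_norm: "cnorm A (D (complex_of_real t) (w * v)) \<le> t" if "cmod w = 1" "t \<ge> 0" for t w
  proof -
    have "cnorm A (C 1 (3 * (w * v)) (3 * (w * v)\<^sup>2) ((w * v) ^ 3)) \<le> 1"
      using that v by (intro C_norm) (simp add: norm_mult)
    then show ?thesis
      using that C_in by (simp add: D_def cnorm_smult mult_left_le)
  qed
  have "p \<oplus> z \<odot> x = C 1 z 0 0"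
    using p x by (simp add: C_def smult_algebra)
  \<comment> \<open>As \<open>\<omega>\<^sup>2 = \<omega> - 1\<close>, the sixth roots of unity are
    1, \<open>\<omega>\<close>, \<open>\<omega> - 1\<close>, -1, \<open>- \<omega>\<close> and
    \<open>1 - \<omega>\<close>. The kernel vanishes at -1, which leaves five terms. Its second and
    third moments are zero, so the quadratic and cubic coefficients cancel.\<close>
  also have "\<dots> = D (complex_of_real (1/3)) (1 * v) \<oplus> D (complex_of_real (1/4)) (\<omega> * v)
      \<oplus> D (complex_of_real (1/4)) ((1 - \<omega>) * v)
      \<oplus> D (complex_of_real (1/12)) ((\<omega> - 1) * v) \<oplus> D (complex_of_real (1/12)) (- \<omega> * v)"
  proof -
    have sq: "(1 - \<omega>)\<^sup>2 = - \<omega>" "(\<omega> - 1)\<^sup>2 = - \<omega>"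
      using \<omega>2 by (simp_all add: power2_eq_square algebra_simps)
    have cu: "(1 - \<omega>) ^ 3 = - 1" "(\<omega> - 1) ^ 3 = 1"
    proof -
      have "(\<omega> - 1) ^ 3 = (\<omega>\<^sup>2) ^ 3" by (simp only: \<omega>2)
      also have "\<dots> = (\<omega> ^ 3)\<^sup>2" by (simp only: mult.commute flip: power_mult)
      also have "\<dots> = 1" by (simp add: \<omega>3)
      finally show 1: "(\<omega> - 1) ^ 3 = 1" .
      have "(1 - \<omega>) ^ 3 = (- (\<omega> - 1)) ^ 3" by simp
      also have "\<dots> = - 1" by (subst power_minus_odd) (simp_all add: 1)
      finally show "(1 - \<omega>) ^ 3 = - 1" .
    qed
    have co: "(- \<omega>)\<^sup>2 = \<omega> - 1" "(- \<omega>) ^ 3 = 1"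
      using \<omega>2 \<omega>3 by simp_all
    have c1: "z = 1/3 * (3 * (1 * v)) + 1/4 * (3 * (\<omega> * v)) + 1/4 * (3 * ((1 - \<omega>) * v))
        + 1/12 * (3 * ((\<omega> - 1) * v)) + 1/12 * (3 * (- \<omega> * v))"
      proof -
      have "3/2 * v = 1/3 * (3 * (1 * v)) + 1/4 * (3 * (\<omega> * v)) + 1/4 * (3 * ((1 - \<omega>) * v))
          + 1/12 * (3 * ((\<omega> - 1) * v)) + 1/12 * (3 * (- \<omega> * v))"
        by (simp add: left_diff_distrib right_diff_distrib)
      then show ?thesis by (simp only: v_def) simp
    qed
    have c2: "0 = 1/3 * (3 * (1 * v)\<^sup>2) + 1/4 * (3 * (\<omega> * v)\<^sup>2) + 1/4 * (3 * ((1 - \<omega>) * v)\<^sup>2)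
        + 1/12 * (3 * ((\<omega> - 1) * v)\<^sup>2) + 1/12 * (3 * (- \<omega> * v)\<^sup>2)"
      unfolding power_mult_distrib sq co \<omega>2 by (simp add: left_diff_distrib right_diff_distrib)
    have c3: "0 = 1/3 * (1 * v) ^ 3 + 1/4 * (\<omega> * v) ^ 3 + 1/4 * ((1 - \<omega>) * v) ^ 3
        + 1/12 * ((\<omega> - 1) * v) ^ 3 + 1/12 * (- \<omega> * v) ^ 3"
      unfolding power_mult_distrib cu co \<omega>3 by simp
    have c0: "(1 :: complex) = 1/3 * 1 + 1/4 * 1 + 1/4 * 1 + 1/12 * 1 + 1/12 * 1"
      by simp
    have re: "complex_of_real (1/3) = 1/3" "complex_of_real (1/4) = 1/4" "complex_of_real (1/12) = 1/12"
      by simp_all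
    show ?thesis unfolding D_def C_smult C_add re c0[symmetric] c1[symmetric] c2[symmetric] c3[symmetric]
      by (rule refl)
  qed
  also have "cnorm A \<dots> \<le> 1/3 + 1/4 + 1/4 + 1/12 + 1/12"
    using mods
    by (intro cnorm_add_le D_norm A_a_closed D_in)
      (simp_all add: norm_minus_commute)
  finally show ?thesis by simp
qed

text \<open>An elementary Liouville argument: repeated enlargement by 3/2 turns the disc into the
  whole plane, and an affine function of \<open>z\<close> bounded on the plane has slope
  zero.\<close>

lemma unital_disc_imp_zero:
  assumes p: "p \<in> carrier A" "p \<otimes> p = p" and x: "x \<in> carrier A" "p \<otimes> x = x" "x \<otimes> p = x"
    and r: "r > 0" and disc: "\<And>z. cmod z \<le> r \<Longrightarrow> cnorm A (p \<oplus> z \<odot> x) \<le> 1"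
  shows "x = \<zero>"
proof -
  have *: "cnorm A (p \<oplus> z \<odot> x) \<le> 1" if "cmod z \<le> (3/2) ^ n * r" for z n
    using that
  proof (induction n arbitrary: z)
    case 0
    then show ?case using disc by simp
  next
    case (Suc n)
    show ?case
      using unital_disc_extend[OF p x, of "(3/2) ^ n * r" z] Suc by simp
  qed
  have bound: "(3/2) ^ n * (r * cnorm A x) \<le> 1 + cnorm A p" for n
  proof -
    define t where "t = complex_of_real ((3/2) ^ n * r)"
    have tx: "t \<odot> x = (p \<oplus> t \<odot> x) \<oplus> (-1) \<odot> p"
    proof -
      have "p \<oplus> (-1) \<odot> p = \<zero>"
        using p smult_add_left[of p 1 "-1"] by (simp add: one_smult zero_smult)
      then show ?thesis
        using p x A_plus_ac(3)[of p "t \<odot> x" "(-1) \<odot> p"] by (simp add: A_plus_ac(1))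
    qed
    have "cmod t * cnorm A x = cnorm A (t \<odot> x)"
      using x by (simp add: cnorm_smult)
    also have "\<dots> = cnorm A ((p \<oplus> t \<odot> x) \<oplus> (-1) \<odot> p)"
      using tx by simp
    also have "\<dots> \<le> cnorm A (p \<oplus> t \<odot> x) + cnorm A ((-1) \<odot> p)"
      using p x by (intro cnorm_triangle) auto
    also have "\<dots> \<le> 1 + cnorm A p"
      using *[of t n] p r by (auto simp: t_def cnorm_smult norm_mult norm_power)
    finally show ?thesis using r by (simp add: t_def norm_mult norm_power mult_ac)
  qed
  have "cnorm A x = 0"
  proof (rule ccontr)
    assume "cnorm A x \<noteq> 0"
    then have pos: "r * cnorm A x > 0"
      using cnorm_nonneg[of x] x r by simp
    obtain n where "(1 + cnorm A p) / (r * cnorm A x) < (3/2) ^ n"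
      using real_arch_pow[of "3/2"] by auto
    with pos bound[of n] show False by (simp add: field_simps)
  qed
  then show ?thesis using x cnorm_eq_0_iff by simp
qed

text \<open>By the C*-identity, \<open>|p + i x|\<^sup>2 = |p + x\<^sup>2|\<close>, and \<open>p + x\<^sup>2\<close> is the mean of \<open>(p + x)\<^sup>2\<close> and \<open>(p - x)\<^sup>2\<close>.
  This controls \<open>p + z x\<close> for \<open>z\<close> in the convex hull of the fourth roots of unity, which contains a disc.\<close>

lemma unit_extreme_point:
  assumes p: "p \<in> carrier A" "p \<otimes> p = p" "star A p = p"
    and x: "x \<in> carrier A" "p \<otimes> x = x" "x \<otimes> p = x" "star A x = x"
    and plus: "cnorm A (p \<oplus> x) \<le> 1" and minus: "cnorm A (p \<oplus> (-1) \<odot> x) \<le> 1"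
  shows "x = \<zero>"
proof -
  let ?N = "\<lambda>z. cnorm A (p \<oplus> z \<odot> x)"
  have in_A: "p \<oplus> z \<odot> x \<in> carrier A" for z using p x by simp
  have "p \<oplus> x \<otimes> x = (1/2) \<odot> ((p \<oplus> x) \<otimes> (p \<oplus> x)) \<oplus> (1/2) \<odot> ((p \<oplus> (-1) \<odot> x) \<otimes> (p \<oplus> (-1) \<odot> x))"
  proof -
    have sq: "(p \<oplus> v \<odot> x) \<otimes> (p \<oplus> v \<odot> x) = p \<oplus> (2 * v) \<odot> x \<oplus> (v * v) \<odot> (x \<otimes> x)" for v
      using p x smult_add_left[of x v v]
      by (simp add: A_l_distr A_r_distr smult_algebra A_plus_ac)
    have "p \<oplus> x \<otimes> x = (1/2 + 1/2) \<odot> p \<oplus> (1/2 * 2 + 1/2 * (-2)) \<odot> x \<oplus> (1/2 + 1/2) \<odot> (x \<otimes> x)"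
      using p x by (simp add: one_smult zero_smult)
    also have "\<dots> = (1/2) \<odot> (p \<oplus> 2 \<odot> x \<oplus> x \<otimes> x) \<oplus> (1/2) \<odot> (p \<oplus> (-2) \<odot> x \<oplus> x \<otimes> x)"
      unfolding smult_add_left[OF p(1)] smult_add_left[OF x(1)] smult_add_left[OF A_m_closed[OF x(1) x(1)]]
      using p x by (simp add: smult_add_right smult_smult A_plus_ac)
    also have "\<dots> = (1/2) \<odot> ((p \<oplus> x) \<otimes> (p \<oplus> x)) \<oplus> (1/2) \<odot> ((p \<oplus> (-1) \<odot> x) \<otimes> (p \<oplus> (-1) \<odot> x))"
      using sq[of 1] sq[of "-1"] p x by (simp add: one_smult)
    finally show ?thesis .
  qed
  also have "cnorm A \<dots> \<le> 1/2 * (1 * 1) + 1/2 * (1 * 1)"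
  proof -
    have "cnorm A ((1/2) \<odot> (y \<otimes> y)) \<le> 1/2 * (1 * 1)" if "y \<in> carrier A" "cnorm A y \<le> 1" for y
      using that order.trans[OF cnorm_mult[of y y] mult_mono[of "cnorm A y" 1 "cnorm A y" 1]]
      by (simp add: cnorm_smult cnorm_nonneg)
    then show ?thesis
      using p x plus minus by (intro cnorm_add_le) auto
  qed
  finally have sq: "cnorm A (p \<oplus> x \<otimes> x) \<le> 1" by simp
  have imag: "?N (of_real s * \<i>) \<le> 1" if "s = 1 \<or> s = -1" for s
  proof -
    define c where "c = complex_of_real s * \<i>"
    have c: "cnj c = - c" "c * c = -1"
      using that by (auto simp: c_def)
    have "star A (p \<oplus> c \<odot> x) \<otimes> (p \<oplus> c \<odot> x) = p \<oplus> x \<otimes> x"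
    proof -
      have "star A (p \<oplus> c \<odot> x) = p \<oplus> (- c) \<odot> x"
        using p x c by (simp add: star_add star_smult)
      also have "\<dots> \<otimes> (p \<oplus> c \<odot> x) = p \<oplus> (c \<odot> x \<oplus> (- c) \<odot> x) \<oplus> x \<otimes> x"
        using p x c A_plus_ac(3)[of "c \<odot> x" "(- c) \<odot> x" "x \<otimes> x"]
        by (simp add: A_l_distr A_r_distr smult_algebra A_plus_ac(1))
      also have "\<dots> = p \<oplus> x \<otimes> x"
        using p x smult_add_left[of x c "- c"] by (simp add: zero_smult)
      finally show ?thesis .
    qed
    then have "(?N c)\<^sup>2 \<le> 1"
      using cstar_identity[OF in_A] sq by metis
    then show ?thesis by (simp add: abs_square_le_1 cnorm_nonneg in_A c_def)
  qed
  have real: "?N (of_real s) \<le> 1" if "s = 1 \<or> s = -1" for s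
    using that plus minus x by (auto simp: one_smult)
  have "?N z \<le> 1" if "cmod z \<le> 1 / 2" for z
  proof -
    define a b where "a = Re z" and "b = Im z"
    have ab: "\<bar>a\<bar> + \<bar>b\<bar> \<le> 1"
      using abs_Re_le_cmod[of z] abs_Im_le_cmod[of z] that by (simp add: a_def b_def)
    \<comment> \<open>Signs with value 1 at zero, unlike \<open>sgn\<close>, so that
      \<open>real\<close> and \<open>imag\<close> always apply.\<close>
    define s t where "s = (if a \<ge> 0 then 1 else -1 :: real)" and "t = (if b \<ge> 0 then 1 else -1 :: real)"
    have st: "\<bar>a\<bar> * s = a" "\<bar>b\<bar> * t = b" "s = 1 \<or> s = -1" "t = 1 \<or> t = -1"
      by (auto simp: s_def t_def)
    have z: "z = of_real (\<bar>a\<bar> * s) + of_real (\<bar>b\<bar> * t) * \<i>"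
      by (simp only: st) (simp add: a_def b_def complex_eq_iff)
    \<comment> \<open>A convex combination of the points over two fourth roots of unity and the
      origin; the weight left over goes to \<open>p\<close> itself.\<close>
    have "p \<oplus> z \<odot> x = of_real \<bar>a\<bar> \<odot> (p \<oplus> of_real s \<odot> x) \<oplus> of_real \<bar>b\<bar> \<odot> (p \<oplus> (of_real t * \<i>) \<odot> x)
        \<oplus> of_real (1 - \<bar>a\<bar> - \<bar>b\<bar>) \<odot> p"
    proof -
      have "p = of_real \<bar>a\<bar> \<odot> p \<oplus> of_real \<bar>b\<bar> \<odot> p \<oplus> of_real (1 - \<bar>a\<bar> - \<bar>b\<bar>) \<odot> p"
        using p by (simp add: one_smult flip: smult_add_left)
      moreover have "z \<odot> x = of_real (\<bar>a\<bar> * s) \<odot> x \<oplus> (of_real (\<bar>b\<bar> * t) * \<i>) \<odot> x"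
        using x by (subst z) (simp add: smult_add_left)
      ultimately have "p \<oplus> z \<odot> x = (of_real \<bar>a\<bar> \<odot> p \<oplus> of_real \<bar>b\<bar> \<odot> p \<oplus> of_real (1 - \<bar>a\<bar> - \<bar>b\<bar>) \<odot> p)
          \<oplus> (of_real (\<bar>a\<bar> * s) \<odot> x \<oplus> (of_real (\<bar>b\<bar> * t) * \<i>) \<odot> x)"
        by simp
      then show ?thesis
        using p x by (simp add: smult_algebra A_plus_ac mult_ac)
    qed
    also have "cnorm A \<dots> \<le> \<bar>a\<bar> * 1 + \<bar>b\<bar> * 1 + \<bar>1 - \<bar>a\<bar> - \<bar>b\<bar>\<bar> * 1"
    proof -
      have le: "cnorm A (of_real c \<odot> y) \<le> \<bar>c\<bar> * 1" if "y \<in> carrier A" "cnorm A y \<le> 1" for c y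
        using that by (simp add: cnorm_smult mult_left_le)
      have "cnorm A p \<le> 1" using p by (intro cnorm_projection_le_1)
      then have "cnorm A (complex_of_real (1 - \<bar>a\<bar> - \<bar>b\<bar>) \<odot> p) \<le> \<bar>1 - \<bar>a\<bar> - \<bar>b\<bar>\<bar> * 1"
        using p by (intro le)
      moreover have "cnorm A (complex_of_real \<bar>a\<bar> \<odot> (p \<oplus> of_real s \<odot> x)) \<le> \<bar>a\<bar> * 1"
        using le[of "p \<oplus> of_real s \<odot> x" "\<bar>a\<bar>"] in_A real st(3) by simp
      moreover have "cnorm A (complex_of_real \<bar>b\<bar> \<odot> (p \<oplus> (of_real t * \<i>) \<odot> x)) \<le> \<bar>b\<bar> * 1"
        using le[of "p \<oplus> (of_real t * \<i>) \<odot> x" "\<bar>b\<bar>"] in_A imag st(4) by simp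
      ultimately show ?thesis
        using p x in_A by (intro cnorm_add_le A_a_closed smult_in) auto
    qed
    also have "\<dots> = 1" using ab by simp
    finally show ?thesis .
  qed
  then show ?thesis
    by (intro unital_disc_imp_zero[of p x "1/2"]) (use p x in auto)
qed

text \<open>The compressions \<open>p P\<^sub>k p\<close> to \<open>p = P\<^sub>j\<close> with \<open>k \<noteq> j\<close> add up to zero, and each satisfies
  \<open>|p - p P\<^sub>k p| \<le> 1\<close>; so a small multiple \<open>x\<close> of one of them satisfies \<open>|p \<plusminus> x| \<le> 1\<close>.\<close>

lemma projections_sum_one_orthogonal:
  assumes K: "finite K" and P: "\<And>k. k \<in> K \<Longrightarrow> P k \<in> carrier A"
    and P_star: "\<And>k. k \<in> K \<Longrightarrow> star A (P k) = P k"
    and P_idem: "\<And>k. k \<in> K \<Longrightarrow> P k \<otimes> P k = P k"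
    and sum: "(\<Oplus>k\<in>K. P k) = \<one>"
    and jm: "j \<in> K" "m \<in> K" "j \<noteq> m"
  shows "P m \<otimes> P j = \<zero>"
proof -
  define p where "p = P j"
  define b where "b k = p \<otimes> P k \<otimes> p" for k
  have p: "p \<in> carrier A" "star A p = p" "p \<otimes> p = p"
    using P P_star P_idem jm by (auto simp: p_def)
  have p1: "cnorm A p \<le> 1" using cnorm_projection_le_1 p by simp
  have b_in: "b k \<in> carrier A" if "k \<in> K" for k
    using that p P by (simp add: b_def)
  have pb: "p \<otimes> b k = b k" "b k \<otimes> p = b k" "star A (b k) = b k" if "k \<in> K" for k
    using that p P P_star
    by (simp_all add: b_def star_mult A_assoc) (simp flip: A_assoc add: p)
  have comp: "cnorm A (p \<oplus> (-1) \<odot> b k) \<le> 1" if k: "k \<in> K" for k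
  proof -
    let ?c = "\<one> \<oplus> (-1) \<odot> P k"
    have c: "?c \<in> carrier A" "star A ?c = ?c" 
      using k P P_star by (simp_all add: star_add star_smult star_one)
    have "?c \<otimes> ?c = \<one> \<oplus> (-1) \<odot> P k \<oplus> ((-1) \<odot> P k \<oplus> 1 \<odot> P k)"
      using k P P_idem by (simp add: A_l_distr A_r_distr smult_algebra A_plus_ac)
    also have "\<dots> = ?c"
      using k P by (simp add: zero_smult flip: smult_add_left)
    finally have "cnorm A ?c \<le> 1"
      using c by (intro cnorm_projection_le_1)
    have "p \<oplus> (-1) \<odot> b k = p \<otimes> ?c \<otimes> p"
      using k p P by (simp add: A_l_distr A_r_distr smult_algebra b_def)
    also have "cnorm A \<dots> \<le> cnorm A p * cnorm A ?c * cnorm A p"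
      using p c
      by (intro order.trans[OF cnorm_mult] mult_right_mono cnorm_mult cnorm_nonneg) auto
    also have "\<dots> \<le> 1 * 1 * 1"
      using p c p1 \<open>cnorm A ?c \<le> 1\<close> by (intro mult_mono) (auto simp: cnorm_nonneg)
    finally show ?thesis by simp
  qed
  define L where "L = K - {j, m}"
  define n where "n = real (card L)"
  have L: "finite L" "L \<subseteq> K" "K = insert j (insert m L)" "m \<notin> L" "j \<notin> insert m L"
    using K jm by (auto simp: L_def)
  have partial: "M \<subseteq> K \<Longrightarrow> cnorm A (of_nat (card M) \<odot> p \<oplus> (-1) \<odot> (\<Oplus>k\<in>M. b k)) \<le> real (card M)"
    if "finite M" for M
    using that
  proof (induction M rule: finite_induct)
    case empty
    then show ?case using p by (simp add: zero_smult smult_zero cnorm_zero)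
  next
    case (insert k M)
    have bM: "b \<in> M \<rightarrow> carrier A" using insert b_in by auto
    have s: "(\<Oplus>k\<in>M. b k) \<in> carrier A" using bM by (rule A_finsum_closed)
    have k: "b k \<in> carrier A" "k \<in> K" using insert b_in by auto
    have "of_nat (card (insert k M)) \<odot> p \<oplus> (-1) \<odot> (\<Oplus>k\<in>insert k M. b k)
      = (of_nat (card M) \<odot> p \<oplus> (-1) \<odot> (\<Oplus>k\<in>M. b k)) \<oplus> (p \<oplus> (-1) \<odot> b k)"
      using insert.hyps bM k s p
      by (simp add: A_finsum_insert smult_add_right smult_add_left one_smult A_plus_ac)
    also have "cnorm A \<dots> \<le> real (card M) + 1"
      using insert k s p comp[of k]
      by (intro cnorm_add_le) auto
    finally show ?case using insert by simp
  qed
  have zero: "b m \<oplus> (\<Oplus>k\<in>L. b k) = \<zero>"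
  proof -
    have bK: "b \<in> K \<rightarrow> carrier A" using b_in by auto
    have s: "(\<Oplus>k\<in>L. b k) \<in> carrier A" using bK L by (intro A_finsum_closed) auto
    have "(\<Oplus>k\<in>K. b k) = p \<otimes> (\<Oplus>k\<in>K. P k) \<otimes> p"
      using K p P by (simp add: b_def A_finsum_rdistr A_finsum_ldistr Pi_def)
    also have "\<dots> = p" using p sum by simp
    also have "(\<Oplus>k\<in>K. b k) = b j \<oplus> (b m \<oplus> (\<Oplus>k\<in>L. b k))"
      using L bK b_in jm by (subst L(3)) (subst A_finsum_insert; auto)+
    also have "b j = p" using p by (simp add: b_def p_def[symmetric])
    finally show ?thesis using p s b_in jm
      by (intro add_eq_left_imp_zero[of p]) auto
  qed
  \<comment> \<open>Since \<open>b m\<close> is minus the sum of the other \<open>n\<close>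
    compressions, \<open>p \<oplus> x\<close> is 1/(n+1) times a sum of \<open>p\<close> and the
    \<open>n\<close> elements \<open>p \<ominus> b k\<close>, each of norm at most one. On the other
    side, \<open>p \<ominus> x\<close> is a convex combination of \<open>p\<close> and
    \<open>p \<ominus> b m\<close>.\<close>
  define x where "x = of_real (1 / (n + 1)) \<odot> b m"
  have n: "n \<ge> 0" by (simp add: n_def)
  have x: "x \<in> carrier A" "p \<otimes> x = x" "x \<otimes> p = x" "star A x = x"
    using p b_in pb jm by (simp_all add: x_def smult_algebra star_smult)
  have "cnorm A (p \<oplus> x) \<le> 1"
  proof -
    have s: "(\<Oplus>k\<in>L. b k) \<in> carrier A" using b_in L by (intro A_finsum_closed) auto
    have bm: "b m = (-1) \<odot> (\<Oplus>k\<in>L. b k)"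
      using zero s b_in jm A_minus_equality[of "b m"] by (simp add: minus_eq_smult)
    have "p \<oplus> x = of_real (1 / (n + 1)) \<odot> (p \<oplus> (of_real n \<odot> p \<oplus> b m))"
    proof -
      define c where "c = complex_of_real (1 / (n + 1))"
      have "c + c * of_real n = of_real (1 / (n + 1) + 1 / (n + 1) * n)"
        by (simp add: c_def)
      also have "\<dots> = 1" using n by (simp add: field_simps)
      finally have "c \<odot> p \<oplus> (c * of_real n) \<odot> p = p"
        using p by (simp add: one_smult flip: smult_add_left)
      then have "p \<oplus> c \<odot> b m = c \<odot> p \<oplus> (c * of_real n) \<odot> p \<oplus> c \<odot> b m"
        by simp
      also have "\<dots> = c \<odot> (p \<oplus> (of_real n \<odot> p \<oplus> b m))"
        using p b_in jm by (simp add: smult_algebra A_plus_ac(1))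
      finally show ?thesis by (simp only: x_def c_def)
    qed
    also have "cnorm A \<dots> = 1 / (n + 1) * cnorm A (p \<oplus> (of_real n \<odot> p \<oplus> b m))"
      using p b_in jm n by (subst cnorm_smult) (auto simp: norm_divide simp flip: of_real_add)
    also have "\<dots> \<le> 1 / (n + 1) * (1 + n)"
    proof -
      have "cnorm A (of_real n \<odot> p \<oplus> b m) \<le> n"
        using partial[OF L(1,2)] by (simp add: bm n_def)
      then have "cnorm A (p \<oplus> (of_real n \<odot> p \<oplus> b m)) \<le> 1 + n"
        using p p1 b_in jm by (intro cnorm_add_le) auto
      then show ?thesis using n by (intro mult_left_mono) auto
    qed
    also have "\<dots> = 1" using n by (simp add: field_simps)
    finally show ?thesis .
  qed
  moreover have "cnorm A (p \<oplus> (-1) \<odot> x) \<le> 1"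
  proof -
    have "p \<oplus> (-1) \<odot> x = of_real (n / (n + 1)) \<odot> p \<oplus> of_real (1 / (n + 1)) \<odot> (p \<oplus> (-1) \<odot> b m)"
    proof -
      define c d where "c = complex_of_real (1 / (n + 1))" and "d = complex_of_real (n / (n + 1))"
      have "d + c = of_real (n / (n + 1) + 1 / (n + 1))"
        by (simp add: c_def d_def)
      also have "\<dots> = 1" using n by (simp add: field_simps)
      finally have "d \<odot> p \<oplus> c \<odot> p = p"
        using p by (simp add: one_smult flip: smult_add_left)
      then have "p \<oplus> (-1) \<odot> (c \<odot> b m) = d \<odot> p \<oplus> c \<odot> p \<oplus> (-1) \<odot> (c \<odot> b m)"
        by simp
      also have "\<dots> = d \<odot> p \<oplus> c \<odot> (p \<oplus> (-1) \<odot> b m)"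
        using p b_in jm by (simp add: smult_algebra A_plus_ac(1))
      finally show ?thesis by (simp only: x_def c_def d_def)
    qed
    also have "cnorm A \<dots> \<le> n / (n + 1) * 1 + 1 / (n + 1) * 1"
    proof -
      have le: "cnorm A (of_real c \<odot> y) \<le> c * 1" if "y \<in> carrier A" "cnorm A y \<le> 1" "c \<ge> 0" for c y
        using that by (simp add: cnorm_smult mult_left_le)
      show ?thesis
        using p p1 b_in jm n comp[of m] by (intro cnorm_add_le le smult_in A_a_closed) simp_all
    qed
    also have "\<dots> = 1" using n by (simp add: field_simps)
    finally show ?thesis .
  qed
  ultimately have "x = \<zero>"
    using p x by (intro unit_extreme_point[of p x])
  have "complex_of_real (n + 1) * of_real (1 / (n + 1)) = of_real ((n + 1) * (1 / (n + 1)))"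
    by (rule of_real_mult[symmetric])
  also have "\<dots> = 1" using n by simp
  finally have "b m = of_real (n + 1) \<odot> x"
    using b_in jm by (simp only: x_def smult_smult one_smult)
  then have bm: "b m = \<zero>"
    using \<open>x = \<zero>\<close> by (simp add: smult_zero)
  \<comment> \<open>The compression \<open>b m\<close> has the form of an element times its adjoint,
    so the C*-identity passes from \<open>b m = \<zero>\<close> to the uncompressed product.\<close>
  have "star A (P m \<otimes> p) \<otimes> (P m \<otimes> p) = p \<otimes> (P m \<otimes> P m) \<otimes> p"
    using p jm P P_star by (simp add: star_mult A_assoc)
  also have "\<dots> = b m" using jm P_idem by (simp add: b_def)
  finally have "(cnorm A (P m \<otimes> p))\<^sup>2 = cnorm A (b m)"
    using cstar_identity[of "P m \<otimes> p"] p jm P by simp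
  then show ?thesis
    using bm cnorm_zero P jm p cnorm_eq_0_iff[of "P m \<otimes> p"] by (simp add: p_def)
qed

end

section \<open>Fixed vectors of the fourth tensor power\<close>

context cstar_algebra
begin

lemma abelian_monoid_A: "abelian_monoid A"
  using is_ring_A ring.is_abelian_group abelian_group.axioms(1) by blast

lemma finsum_delta:
  assumes "finite K" "a \<in> K" "f a \<in> carrier A"
  shows "(\<Oplus>k\<in>K. if k = a then f k else \<zero>) = f a"
proof -
  have "(\<Oplus>k\<in>K. if k = a then f k else \<zero>) = (\<Oplus>k\<in>K. if k = a then f a else \<zero>)"
    using assms by (intro A_finsum_cong) auto
  also have "\<dots> = f a"
    using abelian_monoid.finsum_singleton[OF abelian_monoid_A, of a K "\<lambda>_. f a"] assms
    by (simp add: Pi_def eq_commute[of a])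
  finally show ?thesis .
qed

lemma finsum_zero_A: "(\<Oplus>k\<in>K. \<zero>) = \<zero>"
  by (rule abelian_monoid.finsum_zero[OF abelian_monoid_A])

lemma finsum_smult:
  assumes "finite K" "\<And>k. k \<in> K \<Longrightarrow> f k \<in> carrier A"
  shows "(\<Oplus>k\<in>K. c \<odot> f k) = c \<odot> (\<Oplus>k\<in>K. f k)"
  using finsum_smult_ldistr[of K c f] assms by (simp add: Pi_def)

lemma finsum_in: "(\<And>k. k \<in> K \<Longrightarrow> f k \<in> carrier A) \<Longrightarrow> (\<Oplus>k\<in>K. f k) \<in> carrier A"
  by (rule A_finsum_closed) auto

lemma finsum_cong_in:
  assumes "\<And>k. k \<in> K \<Longrightarrow> f k = g k" "\<And>k. k \<in> K \<Longrightarrow> g k \<in> carrier A"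
  shows "(\<Oplus>k\<in>K. f k) = (\<Oplus>k\<in>K. g k)"
  using assms by (intro A_finsum_cong) auto

lemma finsum_add:
  assumes "\<And>k. k \<in> K \<Longrightarrow> f k \<in> carrier A" "\<And>k. k \<in> K \<Longrightarrow> g k \<in> carrier A"
  shows "(\<Oplus>k\<in>K. f k \<oplus> g k) = (\<Oplus>k\<in>K. f k) \<oplus> (\<Oplus>k\<in>K. g k)"
  using assms by (intro A_finsum_addf) auto

lemma finsum_add2:
  assumes "\<And>k l. k \<in> K \<Longrightarrow> l \<in> K \<Longrightarrow> f k l \<in> carrier A" "\<And>k l. k \<in> K \<Longrightarrow> l \<in> K \<Longrightarrow> g k l \<in> carrier A"
  shows "(\<Oplus>k\<in>K. \<Oplus>l\<in>K. f k l \<oplus> g k l) = (\<Oplus>k\<in>K. \<Oplus>l\<in>K. f k l) \<oplus> (\<Oplus>k\<in>K. \<Oplus>l\<in>K. g k l)"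
proof -
  have "(\<Oplus>k\<in>K. \<Oplus>l\<in>K. f k l \<oplus> g k l) = (\<Oplus>k\<in>K. (\<Oplus>l\<in>K. f k l) \<oplus> (\<Oplus>l\<in>K. g k l))"
    using assms by (intro finsum_cong_in finsum_add A_a_closed finsum_in)
  also have "\<dots> = (\<Oplus>k\<in>K. \<Oplus>l\<in>K. f k l) \<oplus> (\<Oplus>k\<in>K. \<Oplus>l\<in>K. g k l)"
    using assms by (intro finsum_add finsum_in)
  finally show ?thesis .
qed

lemma finsum_sandwich:
  assumes "finite K" "p \<in> carrier A" "q \<in> carrier A" "\<And>k. k \<in> K \<Longrightarrow> f k \<in> carrier A"
    and "\<And>k. k \<in> K \<Longrightarrow> p \<otimes> f k \<otimes> q = g k"
  shows "p \<otimes> (\<Oplus>k\<in>K. f k) \<otimes> q = (\<Oplus>k\<in>K. g k)"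
proof -
  have "p \<otimes> (\<Oplus>k\<in>K. f k) \<otimes> q = (\<Oplus>k\<in>K. p \<otimes> f k \<otimes> q)"
    using assms by (simp add: A_finsum_rdistr A_finsum_ldistr Pi_def)
  also have "\<dots> = (\<Oplus>k\<in>K. g k)"
    using assms by (intro finsum_cong_in) (auto simp flip: assms(5))
  finally show ?thesis .
qed

text \<open>For \<open>y = qp - pqp\<close>, idempotency of \<open>pq\<close> makes all four terms
  of \<open>star y \<otimes> y\<close> equal to \<open>pqp\<close> up to sign, and they cancel.
  Hence \<open>qp = pqp\<close>, which is self-adjoint, and taking adjoints gives
  \<open>pq = qp\<close>.\<close>

lemma projections_commute_if_idempotent:
  assumes p: "p \<in> carrier A" "star A p = p" "p \<otimes> p = p"
    and q: "q \<in> carrier A" "star A q = q" "q \<otimes> q = q"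
    and pq: "p \<otimes> q \<otimes> (p \<otimes> q) = p \<otimes> q"
  shows "p \<otimes> q = q \<otimes> p"
proof -
  let ?y = "q \<otimes> p \<oplus> (-1) \<odot> (p \<otimes> q \<otimes> p)"
  let ?r = "p \<otimes> q \<otimes> p"
  have y: "?y \<in> carrier A" and r: "?r \<in> carrier A" using p q by simp_all
  have star_y: "star A ?y = p \<otimes> q \<oplus> (-1) \<odot> ?r"
    using p q by (simp add: star_add star_smult star_mult A_assoc)
  have absorb: "p \<otimes> (p \<otimes> x) = p \<otimes> x" "q \<otimes> (q \<otimes> x) = q \<otimes> x"
    "p \<otimes> (q \<otimes> (p \<otimes> (q \<otimes> x))) = p \<otimes> (q \<otimes> x)" if "x \<in> carrier A" for x
    using that p q pq by (simp_all flip: A_assoc)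
  have "p \<otimes> q \<otimes> (q \<otimes> p) = ?r" "p \<otimes> q \<otimes> ?r = ?r" "?r \<otimes> (q \<otimes> p) = ?r" "?r \<otimes> ?r = ?r"
    using p q by (simp_all add: A_assoc absorb)
  then have "star A ?y \<otimes> ?y = ?r \<oplus> (-1) \<odot> ?r \<oplus> ((-1) \<odot> ?r \<oplus> ?r)"
    unfolding star_y using p q
    by (simp add: A_l_distr A_r_distr smult_mult_left smult_mult_right smult_smult one_smult smult_add_right A_plus_ac)
  also have "\<dots> = (1 + - 1) \<odot> ?r \<oplus> (- 1 + 1) \<odot> ?r"
    unfolding smult_add_left[OF r] one_smult[OF r] ..
  also have "\<dots> = \<zero>"
    using r by (simp add: zero_smult)
  finally have "(cnorm A ?y)\<^sup>2 = 0"
    using cstar_identity[OF y] cnorm_zero by simp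
  then have "?y = \<zero>" using y cnorm_eq_0_iff by simp
  then have "q \<otimes> p = \<ominus> ((-1) \<odot> (p \<otimes> q \<otimes> p))"
    using p q by (intro A_minus_equality[symmetric]) auto
  then have qp: "q \<otimes> p = p \<otimes> q \<otimes> p"
    using p q by (simp add: minus_eq_smult smult_smult one_smult)
  have "star A (q \<otimes> p) = star A (p \<otimes> q \<otimes> p)"
    using qp by simp
  then have "p \<otimes> q = p \<otimes> q \<otimes> p"
    using p q by (simp add: star_mult A_assoc)
  with qp show ?thesis by simp
qed

end

locale magic_algebra = cstar_algebra A for A :: "('a, 'm) cstar_scheme" (structure) +
  fixes K :: "'i set" and u :: "'i \<Rightarrow> 'i \<Rightarrow> 'a"
  assumes K_finite [simp]: "finite K"
    and u_in [simp]: "i \<in> K \<Longrightarrow> j \<in> K \<Longrightarrow> u i j \<in> carrier A"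
    and u_star: "i \<in> K \<Longrightarrow> j \<in> K \<Longrightarrow> star A (u i j) = u i j"
    and u_idem: "i \<in> K \<Longrightarrow> j \<in> K \<Longrightarrow> u i j \<otimes> u i j = u i j"
    and row_sum: "i \<in> K \<Longrightarrow> (\<Oplus>k\<in>K. u i k) = \<one>"
    and col_sum: "j \<in> K \<Longrightarrow> (\<Oplus>k\<in>K. u k j) = \<one>"
begin

lemma row_orthogonal:
  "\<lbrakk>i \<in> K; j \<in> K; k \<in> K; j \<noteq> k\<rbrakk> \<Longrightarrow> u i j \<otimes> u i k = \<zero>"
  by (rule projections_sum_one_orthogonal[where K = K]) (auto simp: u_star u_idem row_sum)

lemma col_orthogonal:
  "\<lbrakk>i \<in> K; j \<in> K; k \<in> K; j \<noteq> k\<rbrakk> \<Longrightarrow> u j i \<otimes> u k i = \<zero>"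
  by (rule projections_sum_one_orthogonal[where K = K and P = "\<lambda>j. u j i"])
    (auto simp: u_star u_idem col_sum)

definition word :: "'i \<Rightarrow> 'i \<Rightarrow> 'i \<Rightarrow> 'i \<Rightarrow> 'i \<Rightarrow> 'i \<Rightarrow> 'i \<Rightarrow> 'i \<Rightarrow> 'a" where
  "word i a j b k c l d = u i a \<otimes> u j b \<otimes> u k c \<otimes> u l d"

lemma word_in [simp]:
  "\<lbrakk>i \<in> K; j \<in> K; k \<in> K; l \<in> K; a \<in> K; b \<in> K; c \<in> K; d \<in> K\<rbrakk>
   \<Longrightarrow> word i a j b k c l d \<in> carrier A"
  by (simp add: word_def)

text \<open>The values \<open>x, P, Q, R\<close> of \<open>g\<close> belong to the index patterns 1212, 1213, 1232 and 1234, so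
  \<open>x - P - Q + R\<close> is the coefficient of the crossing partition.\<close>

lemma commute_if_crossing_coefficient:
  fixes g :: "'i \<Rightarrow> 'i \<Rightarrow> 'i \<Rightarrow> 'i \<Rightarrow> complex"
  assumes fixed: "(\<Oplus>k1\<in>K. \<Oplus>k2\<in>K. \<Oplus>k3\<in>K. \<Oplus>k4\<in>K.
      g k1 k2 k3 k4 \<odot> word i k1 j k2 i k3 j k4) = x \<odot> \<one>"
    and ij: "i \<in> K" "j \<in> K" "i \<noteq> j" and ab: "a \<in> K" "b \<in> K" "a \<noteq> b"
    and gx: "g a b a b = x"
    and gQ: "\<And>c. c \<in> K - {a, b} \<Longrightarrow> g a b c b = Q"
    and gP: "\<And>c. c \<in> K - {a, b} \<Longrightarrow> g a c a b = P"
    and gO: "\<And>c d. c \<in> K - {a, b} \<Longrightarrow> d \<in> K - {a, b} \<Longrightarrow> c \<noteq> d \<Longrightarrow> g a c d b = R"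
    and nz: "x - P - Q + R \<noteq> 0"
  shows "u i a \<otimes> u j b = u j b \<otimes> u i a"
proof -
  define p q where "p = u i a" and "q = u j b"
  have p: "p \<in> carrier A" "p \<otimes> p = p" and q: "q \<in> carrier A" "q \<otimes> q = q"
    using ij ab u_idem by (simp_all add: p_def q_def)
  define c where "c = x - P - Q + R"
  define s where "s k l = p \<otimes> (u j k \<otimes> u i l) \<otimes> q" for k l
  have s_in [simp]: "s k l \<in> carrier A" if "k \<in> K" "l \<in> K" for k l
    using that p q ij by (simp add: s_def)
  \<comment> \<open>The compressing generators lie in the rows of the outer letters, so row
    orthogonality pins the first index to \<open>a\<close> and the last to \<open>b\<close>.\<close>
  have pwq: "p \<otimes> word i k1 j k2 i k3 j k4 \<otimes> q = (if k1 = a then if k4 = b then s k2 k3 else \<zero> else \<zero>)"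
    if "k1 \<in> K" "k2 \<in> K" "k3 \<in> K" "k4 \<in> K" for k1 k2 k3 k4
  proof -
    have "p \<otimes> word i k1 j k2 i k3 j k4 \<otimes> q = (p \<otimes> u i k1) \<otimes> (u j k2 \<otimes> u i k3) \<otimes> (u j k4 \<otimes> q)"
      using that p q ij by (simp add: word_def A_assoc)
    moreover have "p \<otimes> u i k1 = (if k1 = a then p else \<zero>)"
      using that ij ab row_orthogonal[of i a k1] p by (auto simp: p_def)
    moreover have "u j k4 \<otimes> q = (if k4 = b then q else \<zero>)"
      using that ij ab row_orthogonal[of j k4 b] q by (auto simp: q_def)
    ultimately show ?thesis using that p q ij by (simp add: s_def)
  qed
  have "x \<odot> (p \<otimes> q) = p \<otimes> (x \<odot> \<one>) \<otimes> q"
    using p q by (simp add: smult_mult_left smult_mult_right)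
  also have "\<dots> = (\<Oplus>k1\<in>K. \<Oplus>k2\<in>K. \<Oplus>k3\<in>K. \<Oplus>k4\<in>K. g k1 k2 k3 k4 \<odot> (p \<otimes> word i k1 j k2 i k3 j k4 \<otimes> q))"
    unfolding fixed[symmetric] using p q ij
    by (intro finsum_sandwich finsum_in) (simp_all add: smult_mult_left smult_mult_right)
  also have "\<dots> = (\<Oplus>k1\<in>K. if k1 = a then \<Oplus>k2\<in>K. \<Oplus>k3\<in>K. g k1 k2 k3 b \<odot> s k2 k3 else \<zero>)"
  proof (intro finsum_cong_in)
    fix k1 assume k1: "k1 \<in> K"
    show "(\<Oplus>k2\<in>K. \<Oplus>k3\<in>K. \<Oplus>k4\<in>K. g k1 k2 k3 k4 \<odot> (p \<otimes> word i k1 j k2 i k3 j k4 \<otimes> q)) =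
      (if k1 = a then \<Oplus>k2\<in>K. \<Oplus>k3\<in>K. g k1 k2 k3 b \<odot> s k2 k3 else \<zero>)"
    proof (cases "k1 = a")
      case True
      have "(\<Oplus>k4\<in>K. g k1 k2 k3 k4 \<odot> (p \<otimes> word i k1 j k2 i k3 j k4 \<otimes> q)) = g k1 k2 k3 b \<odot> s k2 k3"
        if "k2 \<in> K" "k3 \<in> K" for k2 k3
      proof -
        have "(\<Oplus>k4\<in>K. g k1 k2 k3 k4 \<odot> (p \<otimes> word i k1 j k2 i k3 j k4 \<otimes> q))
          = (\<Oplus>k4\<in>K. if k4 = b then g k1 k2 k3 k4 \<odot> s k2 k3 else \<zero>)"
          using that True k1 by (intro finsum_cong_in) (auto simp: pwq smult_zero)
        also have "\<dots> = g k1 k2 k3 b \<odot> s k2 k3"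
          using that ab by (intro finsum_delta) auto
        finally show ?thesis .
      qed
      then show ?thesis
        using True by (auto intro!: finsum_cong_in finsum_in)
    next
      case False
      then have "(\<Oplus>k2\<in>K. \<Oplus>k3\<in>K. \<Oplus>k4\<in>K. g k1 k2 k3 k4 \<odot> (p \<otimes> word i k1 j k2 i k3 j k4 \<otimes> q))
        = (\<Oplus>k2\<in>K. \<Oplus>k3\<in>K. \<Oplus>k4\<in>K. \<zero>)"
        using k1 by (intro finsum_cong_in finsum_in) (auto simp: pwq smult_zero)
      with False show ?thesis by (simp add: finsum_zero_A)
    qed
  qed (auto intro!: finsum_in)
  also have "\<dots> = (\<Oplus>k2\<in>K. \<Oplus>k3\<in>K. g a k2 k3 b \<odot> s k2 k3)"
    using ab by (intro finsum_delta finsum_in) auto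
  \<comment> \<open>Inclusion-exclusion over the two coincidences \<open>k2 = b\<close> and
    \<open>k3 = a\<close>, with generic value \<open>R\<close> and joint correction
    \<open>c\<close>. The index pairs on which \<open>g\<close> is not prescribed,
    \<open>k2 = a\<close>, \<open>k3 = b\<close> or \<open>k2 = k3\<close>, do no harm: column
    orthogonality makes \<open>s k2 k3\<close> vanish there.\<close>
  also have "\<dots> = (\<Oplus>k2\<in>K. \<Oplus>k3\<in>K. (R \<odot> s k2 k3 \<oplus> (if k2 = b then (Q - R) \<odot> s k2 k3 else \<zero>))
      \<oplus> ((if k3 = a then (P - R) \<odot> s k2 k3 else \<zero>)
        \<oplus> (if k3 = a then if k2 = b then c \<odot> s k2 k3 else \<zero> else \<zero>)))"
  proof (intro finsum_cong_in finsum_in)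
    fix k2 k3 assume k: "k2 \<in> K" "k3 \<in> K"
    consider "k2 = a \<or> k3 = b \<or> k2 = k3" | "k2 = b" "k3 = a" | "k2 = b" "k3 \<in> K - {a, b}"
      | "k2 \<in> K - {a, b}" "k3 = a" | "k2 \<in> K - {a, b}" "k3 \<in> K - {a, b}" "k2 \<noteq> k3"
      using k by blast
    then show "g a k2 k3 b \<odot> s k2 k3 = (R \<odot> s k2 k3 \<oplus> (if k2 = b then (Q - R) \<odot> s k2 k3 else \<zero>))
      \<oplus> ((if k3 = a then (P - R) \<odot> s k2 k3 else \<zero>)
        \<oplus> (if k3 = a then if k2 = b then c \<odot> s k2 k3 else \<zero> else \<zero>))"
    proof cases
      case 1
      then have "s k2 k3 = \<zero>"
      proof (elim disjE)
        assume "k2 = a"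
        then have "s k2 k3 = (u i a \<otimes> u j a) \<otimes> (u i k3 \<otimes> q)"
          using k ij ab q by (simp add: s_def p_def A_assoc)
        then show ?thesis using k ij ab q by (simp add: col_orthogonal)
      next
        assume "k3 = b"
        then have "s k2 k3 = (p \<otimes> u j k2) \<otimes> (u i b \<otimes> u j b)"
          using k ij ab p by (simp add: s_def q_def A_assoc)
        then show ?thesis using k ij ab p by (simp add: col_orthogonal)
      next
        assume "k2 = k3"
        then show ?thesis using k ij p q by (simp add: s_def col_orthogonal)
      qed
      then show ?thesis by (auto simp: smult_zero)
    next
      case 2
      have "x = R + (Q - R) + ((P - R) + c)" by (simp add: c_def)
      then show ?thesis using 2 k gx by (simp only: smult_add_left s_in if_True refl)
    next
      case 3
      have "Q = R + (Q - R)" by simp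
      then show ?thesis using 3 k gQ smult_add_left[of "s b k3" R "Q - R"] by simp
    next
      case 4
      have "P = R + (P - R)" by simp
      then show ?thesis using 4 k gP smult_add_left[of "s k2 a" R "P - R"] by simp
    next
      case 5
      then show ?thesis using k gO by simp
    qed
  qed auto
  \<comment> \<open>Every unrestricted index sums a row of \<open>u\<close> to one. Thus the first
    three sums give \<open>p \<otimes> q\<close>, and only the last, with both indices fixed, keeps
    the longer product \<open>s b a\<close>.\<close>
  also have "\<dots> = (R \<odot> (p \<otimes> q) \<oplus> (Q - R) \<odot> (p \<otimes> q)) \<oplus> ((P - R) \<odot> (p \<otimes> q) \<oplus> c \<odot> s b a)"
  proof -
    have row: "(\<Oplus>l\<in>K. s k l) = p \<otimes> u j k \<otimes> q" if "k \<in> K" for k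
    proof -
      have "(\<Oplus>l\<in>K. s k l) = p \<otimes> (u j k \<otimes> (\<Oplus>l\<in>K. u i l)) \<otimes> q"
        using that ij p q by (simp add: s_def A_finsum_rdistr A_finsum_ldistr Pi_def)
      then show ?thesis using that ij by (simp add: row_sum)
    qed
    have col: "(\<Oplus>k\<in>K. s k l) = p \<otimes> u i l \<otimes> q" if "l \<in> K" for l
    proof -
      have "(\<Oplus>k\<in>K. s k l) = p \<otimes> ((\<Oplus>k\<in>K. u j k) \<otimes> u i l) \<otimes> q"
        using that ij p q by (simp add: s_def A_finsum_rdistr A_finsum_ldistr Pi_def)
      then show ?thesis using that ij by (simp add: row_sum)
    qed
    have "(\<Oplus>k\<in>K. \<Oplus>l\<in>K. s k l) = (\<Oplus>k\<in>K. p \<otimes> u j k \<otimes> q)"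
      using ij p q by (intro finsum_cong_in row) auto
    also have "\<dots> = p \<otimes> (\<Oplus>k\<in>K. u j k) \<otimes> q"
      using ij p q by (simp add: A_finsum_rdistr A_finsum_ldistr Pi_def)
    finally have total: "(\<Oplus>k\<in>K. \<Oplus>l\<in>K. s k l) = p \<otimes> q"
      using ij p by (simp add: row_sum)
    have 1: "(\<Oplus>k\<in>K. \<Oplus>l\<in>K. R \<odot> s k l) = R \<odot> (p \<otimes> q)"
    proof -
      have "(\<Oplus>k\<in>K. \<Oplus>l\<in>K. R \<odot> s k l) = (\<Oplus>k\<in>K. R \<odot> (\<Oplus>l\<in>K. s k l))"
        by (intro finsum_cong_in finsum_smult smult_in finsum_in) auto
      then show ?thesis by (simp add: finsum_smult finsum_in total)
    qed
    have 2: "(\<Oplus>k\<in>K. \<Oplus>l\<in>K. if k = b then (Q - R) \<odot> s k l else \<zero>) = (Q - R) \<odot> (p \<otimes> q)"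
    proof -
      have "(\<Oplus>k\<in>K. \<Oplus>l\<in>K. if k = b then (Q - R) \<odot> s k l else \<zero>)
        = (\<Oplus>k\<in>K. if k = b then (Q - R) \<odot> (p \<otimes> u j k \<otimes> q) else \<zero>)"
        using p q ij by (intro finsum_cong_in) (auto simp: finsum_smult row finsum_zero_A)
      also have "\<dots> = (Q - R) \<odot> (p \<otimes> u j b \<otimes> q)"
        using p q ij ab by (intro finsum_delta) auto
      finally show ?thesis using p q by (simp add: A_assoc flip: q_def)
    qed
    have 3: "(\<Oplus>k\<in>K. \<Oplus>l\<in>K. if l = a then (P - R) \<odot> s k l else \<zero>) = (P - R) \<odot> (p \<otimes> q)"
    proof -
      have "(\<Oplus>k\<in>K. \<Oplus>l\<in>K. if l = a then (P - R) \<odot> s k l else \<zero>) = (\<Oplus>k\<in>K. (P - R) \<odot> s k a)"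
        using ab by (intro finsum_cong_in finsum_delta) auto
      also have "\<dots> = (P - R) \<odot> (p \<otimes> u i a \<otimes> q)"
        using ab by (simp add: finsum_smult col)
      finally show ?thesis using p by (simp flip: p_def)
    qed
    have 4: "(\<Oplus>k\<in>K. \<Oplus>l\<in>K. if l = a then if k = b then c \<odot> s k l else \<zero> else \<zero>) = c \<odot> s b a"
    proof -
      have "(\<Oplus>k\<in>K. \<Oplus>l\<in>K. if l = a then if k = b then c \<odot> s k l else \<zero> else \<zero>)
        = (\<Oplus>k\<in>K. if k = b then c \<odot> s k a else \<zero>)"
        using ab by (intro finsum_cong_in finsum_delta[of K a]) auto
      also have "\<dots> = c \<odot> s b a"
        using ab by (intro finsum_delta) auto
      finally show ?thesis .
    qed
    have split: "(\<Oplus>k\<in>K. \<Oplus>l\<in>K. (f1 k l \<oplus> f2 k l) \<oplus> (f3 k l \<oplus> f4 k l))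
      = ((\<Oplus>k\<in>K. \<Oplus>l\<in>K. f1 k l) \<oplus> (\<Oplus>k\<in>K. \<Oplus>l\<in>K. f2 k l))
        \<oplus> ((\<Oplus>k\<in>K. \<Oplus>l\<in>K. f3 k l) \<oplus> (\<Oplus>k\<in>K. \<Oplus>l\<in>K. f4 k l))"
      if "\<And>k l. k \<in> K \<Longrightarrow> l \<in> K \<Longrightarrow> f1 k l \<in> carrier A" "\<And>k l. k \<in> K \<Longrightarrow> l \<in> K \<Longrightarrow> f2 k l \<in> carrier A"
        "\<And>k l. k \<in> K \<Longrightarrow> l \<in> K \<Longrightarrow> f3 k l \<in> carrier A" "\<And>k l. k \<in> K \<Longrightarrow> l \<in> K \<Longrightarrow> f4 k l \<in> carrier A"
      for f1 f2 f3 f4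
      using that by (simp add: finsum_add2)
    show ?thesis
      unfolding 1[symmetric] 2[symmetric] 3[symmetric] 4[symmetric] by (rule split) auto
  qed
  finally have eq: "x \<odot> (p \<otimes> q) = (R \<odot> (p \<otimes> q) \<oplus> (Q - R) \<odot> (p \<otimes> q)) \<oplus> ((P - R) \<odot> (p \<otimes> q) \<oplus> c \<odot> s b a)" .
  have pq: "p \<otimes> q \<in> carrier A" and s: "s b a \<in> carrier A" using p q ab by auto
  \<comment> \<open>Moving the multiples of \<open>p \<otimes> q\<close> to one side leaves
    \<open>c\<close> times \<open>p \<otimes> q\<close> equal to \<open>c\<close> times
    \<open>s b a\<close>. As \<open>s b a\<close> is the square of \<open>p \<otimes> q\<close>,
    dividing by \<open>c\<close> makes that product idempotent.\<close>
  have "c \<odot> (p \<otimes> q) = (R - P - Q + x) \<odot> (p \<otimes> q)"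
    by (simp add: c_def algebra_simps)
  also have "\<dots> = (R - P - Q) \<odot> (p \<otimes> q) \<oplus> (((R + (Q - R)) + (P - R)) \<odot> (p \<otimes> q) \<oplus> c \<odot> s b a)"
    using pq s by (simp only: smult_add_left eq A_plus_ac(1) smult_in A_a_closed)
  also have "\<dots> = (R - P - Q + ((R + (Q - R)) + (P - R))) \<odot> (p \<otimes> q) \<oplus> c \<odot> s b a"
    using pq s by (simp only: smult_add_left[of _ "R - P - Q"] A_plus_ac(1) smult_in A_a_closed)
  also have "\<dots> = c \<odot> s b a"
    using pq s by (simp add: zero_smult)
  finally have "(1 / c) \<odot> (c \<odot> s b a) = (1 / c) \<odot> (c \<odot> (p \<otimes> q))" by simp
  then have "s b a = p \<otimes> q"
    using nz pq s by (simp add: smult_smult one_smult c_def)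
  then have "p \<otimes> q \<otimes> (p \<otimes> q) = p \<otimes> q"
    using p q by (simp add: s_def A_assoc flip: p_def q_def)
  then show ?thesis
    using p q ij ab u_star projections_commute_if_idempotent[of p q] by (simp add: p_def q_def)
qed

end

section \<open>Haar invariance and evaluation at permutations\<close>

context cstar_algebra
begin

lemma finsum_rmult:
  assumes "finite K" "y \<in> carrier A" "\<And>k. k \<in> K \<Longrightarrow> f k \<in> carrier A"
    and "\<And>k. k \<in> K \<Longrightarrow> f k \<otimes> y = g k"
  shows "(\<Oplus>k\<in>K. f k) \<otimes> y = (\<Oplus>k\<in>K. g k)"
  using finsum_sandwich[of K \<one> y f g] assms by (simp add: finsum_in)

lemma finsum_lmult:
  assumes "finite K" "x \<in> carrier A" "\<And>k. k \<in> K \<Longrightarrow> f k \<in> carrier A"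
    and "\<And>k. k \<in> K \<Longrightarrow> x \<otimes> f k = g k"
  shows "x \<otimes> (\<Oplus>k\<in>K. f k) = (\<Oplus>k\<in>K. g k)"
proof -
  have "x \<otimes> f k \<otimes> \<one> = g k" if "k \<in> K" for k
    using assms(2,3,4) that by (simp flip: assms(4))
  then show ?thesis
    using finsum_sandwich[of K x \<one> f g] assms by (simp add: finsum_in)
qed

lemma finsum_product4:
  assumes "finite K" "\<And>k. k \<in> K \<Longrightarrow> f1 k \<in> carrier A" "\<And>k. k \<in> K \<Longrightarrow> f2 k \<in> carrier A"
    "\<And>k. k \<in> K \<Longrightarrow> f3 k \<in> carrier A" "\<And>k. k \<in> K \<Longrightarrow> f4 k \<in> carrier A"
  shows "(\<Oplus>k\<in>K. f1 k) \<otimes> (\<Oplus>k\<in>K. f2 k) \<otimes> (\<Oplus>k\<in>K. f3 k) \<otimes> (\<Oplus>k\<in>K. f4 k)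
    = (\<Oplus>k1\<in>K. \<Oplus>k2\<in>K. \<Oplus>k3\<in>K. \<Oplus>k4\<in>K. f1 k1 \<otimes> f2 k2 \<otimes> f3 k3 \<otimes> f4 k4)"
proof -
  have "(\<Oplus>k\<in>K. f1 k) \<otimes> (\<Oplus>k\<in>K. f2 k) = (\<Oplus>k1\<in>K. \<Oplus>k2\<in>K. f1 k1 \<otimes> f2 k2)"
    using assms by (intro finsum_rmult finsum_lmult) (simp_all add: finsum_in)
  then have "(\<Oplus>k\<in>K. f1 k) \<otimes> (\<Oplus>k\<in>K. f2 k) \<otimes> (\<Oplus>k\<in>K. f3 k)
      = (\<Oplus>k1\<in>K. \<Oplus>k2\<in>K. \<Oplus>k3\<in>K. f1 k1 \<otimes> f2 k2 \<otimes> f3 k3)"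
    using assms by simp (intro finsum_rmult finsum_lmult; simp add: finsum_in)
  then show ?thesis
    using assms by simp (intro finsum_rmult finsum_lmult; simp add: finsum_in)
qed

lemma linear_functional_finsum:
  assumes \<chi>: "linear_functional A \<chi>" and "finite K" "\<And>k. k \<in> K \<Longrightarrow> f k \<in> carrier A"
  shows "\<chi> (\<Oplus>k\<in>K. f k) = (\<Sum>k\<in>K. \<chi> (f k))"
  using assms(2,3)
proof (induction K)
  case empty
  have "\<chi> (0 \<odot> \<zero>) = 0 * \<chi> \<zero>"
    using \<chi> unfolding linear_functional_def by blast
  then show ?case by (simp add: smult_zero abelian_monoid.finsum_empty[OF abelian_monoid_A])
next
  case (insert k K)
  then show ?case
    using \<chi> finsum_in[of K f] by (simp add: A_finsum_insert linear_functional_def Pi_def)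
qed

end

lemma bounded_linear_map_finsum:
  assumes T: "cstar_algebra T" and A: "cstar_algebra A" and S: "bounded_linear_map T A S"
    and "finite K" "\<And>k. k \<in> K \<Longrightarrow> f k \<in> carrier T"
  shows "S (\<Oplus>\<^bsub>T\<^esub>k\<in>K. f k) = (\<Oplus>\<^bsub>A\<^esub>k\<in>K. S (f k))"
proof -
  interpret T: cstar_algebra T by (rule T)
  interpret A: cstar_algebra A by (rule A)
  have S_in: "S x \<in> carrier A" if "x \<in> carrier T" for x
    using S that by (auto simp: bounded_linear_map_def)
  show ?thesis
    using assms(4,5)
  proof (induction K)
    case empty
    have z: "\<zero>\<^bsub>T\<^esub> \<in> carrier T" by simp
    have "S (0 \<odot>\<^bsub>T\<^esub> \<zero>\<^bsub>T\<^esub>) = 0 \<odot>\<^bsub>A\<^esub> S \<zero>\<^bsub>T\<^esub>"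
      using S z unfolding bounded_linear_map_def by blast
    then show ?case
      using S_in z by (simp add: T.smult_zero A.zero_smult abelian_monoid.finsum_empty[OF T.abelian_monoid_A]
        abelian_monoid.finsum_empty[OF A.abelian_monoid_A])
  next
    case (insert k K)
    then show ?case
      using S T.finsum_in[of K f] S_in
      by (simp add: T.A_finsum_insert A.A_finsum_insert bounded_linear_map_def Pi_def)
  qed
qed

context magic_algebra
begin

text \<open>By multiplicativity, the comultiplication sends a word with rows \<open>i\<close> and
  columns \<open>j\<close> to the sum over \<open>k\<close> of the tensors of the word from
  \<open>i\<close> to \<open>k\<close> with the word from \<open>k\<close> to \<open>j\<close>. With
  the arguments of \<open>\<tau>\<close> swapped, \<open>S\<close> applies \<open>h\<close> to the
  second leg.\<close>

lemma haar_fixed_vector: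
  fixes h :: "'a \<Rightarrow> complex"
  assumes T: "min_tensor_product A A T \<tau>" and \<Delta>: "\<Delta> \<in> star_hom A T"
    and \<Delta>_u: "\<And>i j. i \<in> K \<Longrightarrow> j \<in> K \<Longrightarrow> \<Delta> (u i j) = (\<Oplus>\<^bsub>T\<^esub>k\<in>K. \<tau> (u i k) (u k j))"
    and S: "is_slice_map A T (\<lambda>a b. \<tau> b a) h S"
    and inv: "\<And>f. f \<in> carrier A \<Longrightarrow> S (\<Delta> f) = h f \<odot> \<one>"
    and i: "i1 \<in> K" "i2 \<in> K" "i3 \<in> K" "i4 \<in> K" and j: "j1 \<in> K" "j2 \<in> K" "j3 \<in> K" "j4 \<in> K"
  shows "(\<Oplus>k1\<in>K. \<Oplus>k2\<in>K. \<Oplus>k3\<in>K. \<Oplus>k4\<in>K.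
      h (word k1 j1 k2 j2 k3 j3 k4 j4) \<odot> word i1 k1 i2 k2 i3 k3 i4 k4) = h (word i1 j1 i2 j2 i3 j3 i4 j4) \<odot> \<one>"
proof -
  interpret T: min_tensor_product A A T \<tau> by (rule T)
  interpret T: cstar_algebra T by (rule T.cstar_T)
  have \<tau>_in [simp]: "\<tau> (u i k) (u k j) \<in> carrier T" if "i \<in> K" "j \<in> K" "k \<in> K" for i j k
    using that by (simp add: T.tensor_closed)
  have hom: "\<Delta> (x \<otimes> y) = \<Delta> x \<otimes>\<^bsub>T\<^esub> \<Delta> y" if "x \<in> carrier A" "y \<in> carrier A" for x y
    using \<Delta> that by (simp add: star_hom_def ring_hom_def)
  have S_lin: "bounded_linear_map T A S" and S_\<tau>: "\<And>a b. a \<in> carrier A \<Longrightarrow> b \<in> carrier A \<Longrightarrow> S (\<tau> b a) = h a \<odot> b"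
    using S by (auto simp: is_slice_map_def)
  have "\<Delta> (word i1 j1 i2 j2 i3 j3 i4 j4) = \<Delta> (u i1 j1) \<otimes>\<^bsub>T\<^esub> \<Delta> (u i2 j2) \<otimes>\<^bsub>T\<^esub> \<Delta> (u i3 j3) \<otimes>\<^bsub>T\<^esub> \<Delta> (u i4 j4)"
    using i j by (simp add: word_def hom)
  also have "\<dots> = (\<Oplus>\<^bsub>T\<^esub>k1\<in>K. \<Oplus>\<^bsub>T\<^esub>k2\<in>K. \<Oplus>\<^bsub>T\<^esub>k3\<in>K. \<Oplus>\<^bsub>T\<^esub>k4\<in>K.
      \<tau> (u i1 k1) (u k1 j1) \<otimes>\<^bsub>T\<^esub> \<tau> (u i2 k2) (u k2 j2) \<otimes>\<^bsub>T\<^esub> \<tau> (u i3 k3) (u k3 j3) \<otimes>\<^bsub>T\<^esub> \<tau> (u i4 k4) (u k4 j4))"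
    using i j by (simp add: \<Delta>_u T.finsum_product4)
  also have "\<dots> = (\<Oplus>\<^bsub>T\<^esub>k1\<in>K. \<Oplus>\<^bsub>T\<^esub>k2\<in>K. \<Oplus>\<^bsub>T\<^esub>k3\<in>K. \<Oplus>\<^bsub>T\<^esub>k4\<in>K.
      \<tau> (word i1 k1 i2 k2 i3 k3 i4 k4) (word k1 j1 k2 j2 k3 j3 k4 j4))"
    using i j by (intro T.finsum_cong_in T.finsum_in) (simp_all add: T.tensor_mult T.tensor_closed word_def)
  finally have *: "\<Delta> (word i1 j1 i2 j2 i3 j3 i4 j4) = \<dots>" .
  have step: "S (\<Oplus>\<^bsub>T\<^esub>k\<in>K. f k) = (\<Oplus>k\<in>K. g k)"
    if "\<And>k. k \<in> K \<Longrightarrow> f k \<in> carrier T" "\<And>k. k \<in> K \<Longrightarrow> S (f k) = g k" for f g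
  proof -
    have "S (\<Oplus>\<^bsub>T\<^esub>k\<in>K. f k) = (\<Oplus>k\<in>K. S (f k))"
      using that S_lin by (intro bounded_linear_map_finsum T.cstar_T T.cstar_A) auto
    also have "\<dots> = (\<Oplus>k\<in>K. g k)"
      using that S_lin by (intro finsum_cong_in) (auto simp: bounded_linear_map_def simp flip: that(2))
    finally show ?thesis .
  qed
  have "S (\<Delta> (word i1 j1 i2 j2 i3 j3 i4 j4)) = (\<Oplus>k1\<in>K. \<Oplus>k2\<in>K. \<Oplus>k3\<in>K. \<Oplus>k4\<in>K.
      h (word k1 j1 k2 j2 k3 j3 k4 j4) \<odot> word i1 k1 i2 k2 i3 k3 i4 k4)"
    unfolding * using i j by (intro step T.finsum_in) (simp_all add: T.tensor_closed S_\<tau>)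
  then show ?thesis using i j inv by simp
qed

text \<open>The functional \<open>\<chi>\<close> is evaluation at \<open>\<pi>\<close>; applied to
  the fixed-vector identity with rows moved by \<open>\<pi>\<close>, it keeps only the summand
  \<open>k = i\<close>. It is prescribed on words rather than as a character because for S_N^+ it
  arises as a matrix entry of a homomorphism.\<close>

lemma invariant_under_permutation:
  fixes h \<chi> :: "'a \<Rightarrow> complex"
  assumes fixed: "(\<Oplus>k1\<in>K. \<Oplus>k2\<in>K. \<Oplus>k3\<in>K. \<Oplus>k4\<in>K.
      h (word k1 j1 k2 j2 k3 j3 k4 j4) \<odot> word (\<pi> i1) k1 (\<pi> i2) k2 (\<pi> i3) k3 (\<pi> i4) k4)
      = h (word (\<pi> i1) j1 (\<pi> i2) j2 (\<pi> i3) j3 (\<pi> i4) j4) \<odot> \<one>"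
    and \<chi>: "linear_functional A \<chi>" "\<chi> \<one> = 1"
    and \<chi>_word: "\<And>i1 i2 i3 i4 k1 k2 k3 k4.
      \<lbrakk>i1 \<in> K; i2 \<in> K; i3 \<in> K; i4 \<in> K; k1 \<in> K; k2 \<in> K; k3 \<in> K; k4 \<in> K\<rbrakk> \<Longrightarrow>
      \<chi> (word i1 k1 i2 k2 i3 k3 i4 k4) = of_bool (i1 = \<pi> k1 \<and> i2 = \<pi> k2 \<and> i3 = \<pi> k3 \<and> i4 = \<pi> k4)"
    and \<pi>: "\<pi> permutes K"
    and i: "i1 \<in> K" "i2 \<in> K" "i3 \<in> K" "i4 \<in> K" and j: "j1 \<in> K" "j2 \<in> K" "j3 \<in> K" "j4 \<in> K"
  shows "h (word (\<pi> i1) j1 (\<pi> i2) j2 (\<pi> i3) j3 (\<pi> i4) j4) = h (word i1 j1 i2 j2 i3 j3 i4 j4)"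
proof -
  have \<pi>_in [simp]: "\<pi> k \<in> K" if "k \<in> K" for k using that \<pi> by (simp add: permutes_in_image)
  have \<pi>_eq: "\<pi> a = \<pi> b \<longleftrightarrow> a = b" for a b using permutes_inj[OF \<pi>] by (auto dest: injD)
  have \<chi>_smult: "\<chi> (c \<odot> x) = c * \<chi> x" if "x \<in> carrier A" for c x
    using \<chi> that by (simp add: linear_functional_def)
  have step: "\<chi> (\<Oplus>k\<in>K. f k) = (\<Sum>k\<in>K. g k)"
    if "\<And>k. k \<in> K \<Longrightarrow> f k \<in> carrier A" "\<And>k. k \<in> K \<Longrightarrow> \<chi> (f k) = g k" for f g
    using that by (simp add: linear_functional_finsum[OF \<chi>(1)])
  have "h (word (\<pi> i1) j1 (\<pi> i2) j2 (\<pi> i3) j3 (\<pi> i4) j4) = \<chi> (h (word (\<pi> i1) j1 (\<pi> i2) j2 (\<pi> i3) j3 (\<pi> i4) j4) \<odot> \<one>)"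
    using \<chi> by (simp add: \<chi>_smult)
  also have "\<dots> = (\<Sum>k1\<in>K. \<Sum>k2\<in>K. \<Sum>k3\<in>K. \<Sum>k4\<in>K. h (word k1 j1 k2 j2 k3 j3 k4 j4)
      * of_bool (\<pi> i1 = \<pi> k1 \<and> \<pi> i2 = \<pi> k2 \<and> \<pi> i3 = \<pi> k3 \<and> \<pi> i4 = \<pi> k4))"
    unfolding fixed[symmetric] using i j
    by (intro step finsum_in) (simp_all add: \<chi>_smult \<chi>_word)
  also have "\<dots> = (\<Sum>k1\<in>K. if k1 = i1 then \<Sum>k2\<in>K. if k2 = i2 then \<Sum>k3\<in>K. if k3 = i3 then
      \<Sum>k4\<in>K. if k4 = i4 then h (word k1 j1 k2 j2 k3 j3 k4 j4) else 0 else 0 else 0 else 0)"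
  proof -
    have const: "(\<Sum>k\<in>K. if P then f k else 0) = (if P then sum f K else 0)" for P and f :: "'i \<Rightarrow> complex"
      by simp
    have "(\<Sum>k1\<in>K. \<Sum>k2\<in>K. \<Sum>k3\<in>K. \<Sum>k4\<in>K. h (word k1 j1 k2 j2 k3 j3 k4 j4)
        * of_bool (\<pi> i1 = \<pi> k1 \<and> \<pi> i2 = \<pi> k2 \<and> \<pi> i3 = \<pi> k3 \<and> \<pi> i4 = \<pi> k4))
      = (\<Sum>k1\<in>K. \<Sum>k2\<in>K. \<Sum>k3\<in>K. \<Sum>k4\<in>K. if k1 = i1 then if k2 = i2 then if k3 = i3 then
          if k4 = i4 then h (word k1 j1 k2 j2 k3 j3 k4 j4) else 0 else 0 else 0 else 0)"
      by (intro sum.cong refl) (auto simp: \<pi>_eq)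
    then show ?thesis by (simp only: const)
  qed
  also have "\<dots> = h (word i1 j1 i2 j2 i3 j3 i4 j4)"
    using i by (simp only: sum.delta[OF K_finite] if_True)
  finally show ?thesis .
qed

end

section \<open>Moments of length four\<close>

text \<open>The complements of two equally large subsets of a finite set are equinumerous, so the
  partial bijection extends. Invariance under permutations thereby becomes dependence on the
  equality pattern of the row indices alone.\<close>

lemma ex_permutation_map:
  assumes "finite K" "distinct xs" "distinct ys" "length xs = length ys" "set xs \<subseteq> K" "set ys \<subseteq> K"
  shows "\<exists>\<pi>. \<pi> permutes K \<and> map \<pi> xs = ys"
proof -
  have "card (K - set xs) = card (K - set ys)"
    using assms by (simp add: card_Diff_subset distinct_card)
  then obtain f where f: "bij_betw f (K - set xs) (K - set ys)"
    using assms(1) by (meson finite_Diff finite_same_card_bij)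
  define g where "g x = the (map_of (zip xs ys) x)" for x
  have map_g: "map g xs = ys"
    using assms(2,4) by (auto simp: g_def map_of_zip_nth intro: nth_equalityI)
  have g: "bij_betw g (set xs) (set ys)"
  proof -
    have "g ` set xs = set ys" using map_g by (metis list.set_map)
    moreover have "inj_on g (set xs)"
      using map_g assms(3) distinct_map by metis
    ultimately show ?thesis by (simp add: bij_betw_def)
  qed
  define \<pi> where "\<pi> x = (if x \<in> set xs then g x else if x \<in> K then f x else x)" for x
  have "bij_betw \<pi> (set xs) (set ys)"
    using g by (rule bij_betw_cong[THEN iffD1, rotated]) (simp add: \<pi>_def)
  moreover have "bij_betw \<pi> (K - set xs) (K - set ys)"
    using f by (rule bij_betw_cong[THEN iffD1, rotated]) (simp add: \<pi>_def)
  ultimately have "bij_betw \<pi> (set xs \<union> (K - set xs)) (set ys \<union> (K - set ys))"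
    by (rule bij_betw_combine) blast
  then have "bij_betw \<pi> K K"
    using assms by (simp add: Un_absorb1)
  then have "\<pi> permutes K"
    by (rule bij_imp_permutes) (use assms(5) in \<open>auto simp: \<pi>_def\<close>)
  moreover have "map \<pi> xs = ys"
    using map_g by (simp add: \<pi>_def cong: map_cong)
  ultimately show ?thesis by blast
qed

text \<open>Meant for sums over a row index in which all rows outside a small exceptional set
  \<open>E\<close> contribute the same moment. The count is a difference of complex numbers, to
  avoid truncated subtraction.\<close>

lemma sum_eq_off:
  fixes f :: "'i \<Rightarrow> complex"
  assumes "finite K" "E \<subseteq> K" "\<And>k. k \<in> K - E \<Longrightarrow> f k = c"
  shows "sum f K = sum f E + (of_nat (card K) - of_nat (card E)) * c"
proof -
  have "sum f K = sum f E + sum f (K - E)"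
    using assms by (metis add.commute sum.subset_diff)
  also have "sum f (K - E) = of_nat (card (K - E)) * c"
    using assms(3) by simp
  also have "card (K - E) = card K - card E"
    using assms by (simp add: card_Diff_subset finite_subset)
  finally show ?thesis
    using assms card_mono[of K E] by (simp add: of_nat_diff)
qed

text \<open>Rows are permuted while columns stay fixed, so moments are still allowed to depend on
  the columns in any way. The bound on \<open>card K\<close> provides four distinct rows and keeps
  \<open>n - 2\<close> and \<open>n - 3\<close> away from zero.\<close>

locale permutation_invariant_functional = magic_algebra A K u
  for A :: "('a, 'm) cstar_scheme" (structure) and K :: "'i set" and u :: "'i \<Rightarrow> 'i \<Rightarrow> 'a" +
  fixes h :: "'a \<Rightarrow> complex" and n :: complex
  assumes linear: "linear_functional A h" and h_one: "h \<one> = 1"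
    and n_def: "n = of_nat (card K)" and card_ge: "card K \<ge> 4"
    and perm_inv: "\<lbrakk>\<pi> permutes K; i1 \<in> K; i2 \<in> K; i3 \<in> K; i4 \<in> K; j1 \<in> K; j2 \<in> K; j3 \<in> K; j4 \<in> K\<rbrakk>
      \<Longrightarrow> h (word (\<pi> i1) j1 (\<pi> i2) j2 (\<pi> i3) j3 (\<pi> i4) j4) = h (word i1 j1 i2 j2 i3 j3 i4 j4)"
begin

lemma n_ne: "n \<noteq> 0" "n - 1 \<noteq> 0" "n - 2 \<noteq> 0" "n - 3 \<noteq> 0" "n\<^sup>2 - 3 * n + 1 \<noteq> 0"
proof -
  have n: "n = complex_of_real (real (card K))" by (simp add: n_def)
  have r: "real (card K) \<ge> 4" using card_ge by simp
  have "n \<noteq> of_nat m" if "m < 4" for m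
    using card_ge that by (simp add: n_def)
  from this[of 0] this[of 1] this[of 2] this[of 3]
  show "n \<noteq> 0" "n - 1 \<noteq> 0" "n - 2 \<noteq> 0" "n - 3 \<noteq> 0" by auto
  have "(real (card K))\<^sup>2 - 3 * real (card K) + 1 = real (card K) * (real (card K) - 3) + 1"
    by (simp add: power2_eq_square algebra_simps)
  also have "\<dots> > 0" using r by (intro add_nonneg_pos mult_nonneg_nonneg) auto
  finally have "complex_of_real ((real (card K))\<^sup>2 - 3 * real (card K) + 1) \<noteq> 0"
    by (simp only: of_real_eq_0_iff)
  then show "n\<^sup>2 - 3 * n + 1 \<noteq> 0" by (simp add: n)
qed

lemma h_zero: "h \<zero> = 0"
  using linear_functional_finsum[OF linear, of "{}" "\<lambda>_. \<zero>"]
  by (simp add: abelian_monoid.finsum_empty[OF abelian_monoid_A])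

text \<open>Each column sums to one, so summing over a row index deletes that letter. This ties
  moments of one length to those of the next shorter length.\<close>

lemma h_sum:
  assumes "x \<in> carrier A" "y \<in> carrier A" "a \<in> K"
  shows "(\<Sum>k\<in>K. h (x \<otimes> u k a \<otimes> y)) = h (x \<otimes> y)"
proof -
  have "(\<Sum>k\<in>K. h (x \<otimes> u k a \<otimes> y)) = h (\<Oplus>k\<in>K. x \<otimes> u k a \<otimes> y)"
    using assms by (intro linear_functional_finsum[OF linear, symmetric]) auto
  also have "(\<Oplus>k\<in>K. x \<otimes> u k a \<otimes> y) = x \<otimes> (\<Oplus>k\<in>K. u k a) \<otimes> y"
    using assms by (intro finsum_sandwich[symmetric]) auto
  finally show ?thesis using assms by (simp add: col_sum)
qed

lemma sum_word_1:
  assumes "i2 \<in> K" "i3 \<in> K" "i4 \<in> K" "j1 \<in> K" "j2 \<in> K" "j3 \<in> K" "j4 \<in> K"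
  shows "(\<Sum>k\<in>K. h (word k j1 i2 j2 i3 j3 i4 j4)) = h (u i2 j2 \<otimes> u i3 j3 \<otimes> u i4 j4)"
  using h_sum[of \<one> "u i2 j2 \<otimes> u i3 j3 \<otimes> u i4 j4" j1] assms
  by (simp add: word_def A_assoc)

lemma sum_word_2:
  assumes "i1 \<in> K" "i3 \<in> K" "i4 \<in> K" "j1 \<in> K" "j2 \<in> K" "j3 \<in> K" "j4 \<in> K"
  shows "(\<Sum>k\<in>K. h (word i1 j1 k j2 i3 j3 i4 j4)) = h (u i1 j1 \<otimes> u i3 j3 \<otimes> u i4 j4)"
  using h_sum[of "u i1 j1" "u i3 j3 \<otimes> u i4 j4" j2] assms
  by (simp add: word_def A_assoc)

lemma sum_word_4:
  assumes "i1 \<in> K" "i2 \<in> K" "i3 \<in> K" "j1 \<in> K" "j2 \<in> K" "j3 \<in> K" "j4 \<in> K"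
  shows "(\<Sum>k\<in>K. h (word i1 j1 i2 j2 i3 j3 k j4)) = h (u i1 j1 \<otimes> u i2 j2 \<otimes> u i3 j3)"
  using h_sum[of "u i1 j1 \<otimes> u i2 j2 \<otimes> u i3 j3" \<one> j4] assms
  by (simp add: word_def A_assoc)

text \<open>Doubling the first letter, which is idempotent, turns a word of length three into one of
  length four. In the same way it covers shorter words.\<close>

lemma perm_inv3:
  assumes "\<pi> permutes K" "i \<in> K" "j \<in> K" "k \<in> K" "a \<in> K" "b \<in> K" "c \<in> K"
  shows "h (u (\<pi> i) a \<otimes> u (\<pi> j) b \<otimes> u (\<pi> k) c) = h (u i a \<otimes> u j b \<otimes> u k c)"
  using perm_inv[of \<pi> i i j k a a b c] assms
  by (simp add: word_def u_idem permutes_in_image)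

lemma inv_word_3:
  assumes "distinct [i, j, k]" "distinct [i', j', k']" "set [i, j, k] \<subseteq> K" "set [i', j', k'] \<subseteq> K"
    "a \<in> K" "b \<in> K" "c \<in> K" "d \<in> K"
  shows "h (word i a j b i c k d) = h (word i' a j' b i' c k' d)"
    "h (word i a j b k c j d) = h (word i' a j' b k' c j' d)"
    "h (u i a \<otimes> u j b \<otimes> u k c) = h (u i' a \<otimes> u j' b \<otimes> u k' c)"
proof -
  obtain \<pi> where "\<pi> permutes K" "map \<pi> [i, j, k] = [i', j', k']"
    using ex_permutation_map[of K "[i, j, k]" "[i', j', k']"] assms by auto
  then show "h (word i a j b i c k d) = h (word i' a j' b i' c k' d)"
    "h (word i a j b k c j d) = h (word i' a j' b k' c j' d)"
    "h (u i a \<otimes> u j b \<otimes> u k c) = h (u i' a \<otimes> u j' b \<otimes> u k' c)"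
    using perm_inv[of \<pi> i j i k a b c d] perm_inv[of \<pi> i j k j a b c d] perm_inv3[of \<pi> i j k a b c] assms
    by auto
qed

lemma inv_word_4:
  assumes "distinct [i, j, k, l]" "distinct [i', j', k', l']" "set [i, j, k, l] \<subseteq> K" "set [i', j', k', l'] \<subseteq> K"
    "a \<in> K" "b \<in> K" "c \<in> K" "d \<in> K"
  shows "h (word i a j b k c l d) = h (word i' a j' b k' c l' d)"
proof -
  obtain \<pi> where "\<pi> permutes K" "map \<pi> [i, j, k, l] = [i', j', k', l']"
    using ex_permutation_map[of K "[i, j, k, l]" "[i', j', k', l']"] assms by auto
  then show ?thesis
    using perm_inv[of \<pi> i j k l a b c d] assms by auto
qed

lemma inv_word_2:
  assumes "i \<noteq> j" "i' \<noteq> j'" "i \<in> K" "j \<in> K" "i' \<in> K" "j' \<in> K"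
    "a \<in> K" "b \<in> K" "c \<in> K" "d \<in> K"
  shows "h (u i a \<otimes> u j b \<otimes> u i c) = h (u i' a \<otimes> u j' b \<otimes> u i' c)"
    "h (u i a \<otimes> u j b) = h (u i' a \<otimes> u j' b)"
    "h (word i a j b i c j d) = h (word i' a j' b i' c j' d)"
proof -
  obtain \<pi> where "\<pi> permutes K" "map \<pi> [i, j] = [i', j']"
    using ex_permutation_map[of K "[i, j]" "[i', j']"] assms by auto
  then show "h (u i a \<otimes> u j b \<otimes> u i c) = h (u i' a \<otimes> u j' b \<otimes> u i' c)"
    "h (u i a \<otimes> u j b) = h (u i' a \<otimes> u j' b)"
    "h (word i a j b i c j d) = h (word i' a j' b i' c j' d)"
    using perm_inv3[of \<pi> i j i a b c] perm_inv3[of \<pi> i i j a a b] perm_inv[of \<pi> i j i j a b c d] assms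
    by (auto simp: u_idem)
qed

section \<open>Moments of length at most three\<close>

lemma h_word_1:
  assumes "i \<in> K" "a \<in> K"
  shows "h (u i a) = 1 / n"
proof -
  have "h (u k a) = h (u i a)" if "k \<in> K" for k
  proof -
    obtain \<pi> where "\<pi> permutes K" "\<pi> i = k"
      using ex_permutation_map[of K "[i]" "[k]"] assms \<open>k \<in> K\<close> by auto
    then show ?thesis
      using perm_inv3[of \<pi> i i i a a a] assms that by (auto simp: u_idem)
  qed
  then have "(\<Sum>k\<in>K. h (u k a)) = n * h (u i a)"
    by (simp add: n_def)
  moreover have "(\<Sum>k\<in>K. h (u k a)) = 1"
    using h_sum[of \<one> \<one> a] assms by (simp add: h_one cong: sum.cong)
  ultimately have "n * h (u i a) = 1" by simp
  then show ?thesis using n_ne by (simp add: eq_divide_eq mult.commute)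
qed

lemma h_word_2:
  assumes "i \<in> K" "j \<in> K" "a \<in> K" "b \<in> K" "i \<noteq> j" "a \<noteq> b"
  shows "h (u i a \<otimes> u j b) = 1 / (n * (n - 1))"
proof -
  have "(\<Sum>k\<in>K. h (u i a \<otimes> u k b)) = h (u i a)"
    using h_sum[of "u i a" \<one> b] assms by (simp cong: sum.cong)
  moreover have "(\<Sum>k\<in>K. h (u i a \<otimes> u k b)) = h (u i a \<otimes> u i b) + (n - 1) * h (u i a \<otimes> u j b)"
    using assms by (subst sum_eq_off[of K "{i}" "\<lambda>k. h (u i a \<otimes> u k b)" "h (u i a \<otimes> u j b)"]) (auto simp: n_def intro: inv_word_2(2))
  ultimately have "(n - 1) * h (u i a \<otimes> u j b) = 1 / n"
    using assms by (simp add: row_orthogonal h_zero h_word_1)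
  then show ?thesis
    using divide_eq_eq[of "1 / n" "n - 1" "h (u i a \<otimes> u j b)"] n_ne by (simp add: mult.commute)
qed

text \<open>Deleting the middle letter leaves two letters in row \<open>i\<close>, orthogonal unless
  \<open>a = c\<close>. In the sum over the middle row, row \<open>i\<close> itself contributes
  nothing because \<open>a \<noteq> b\<close>, and the other \<open>n - 1\<close> rows contribute
  equally.\<close>

lemma h_word_121:
  assumes "i \<in> K" "j \<in> K" "a \<in> K" "b \<in> K" "c \<in> K" "i \<noteq> j" "a \<noteq> b"
  shows "h (u i a \<otimes> u j b \<otimes> u i c) = (if a = c then 1 / (n * (n - 1)) else 0)"
proof -
  have "(\<Sum>k\<in>K. h (u i a \<otimes> u k b \<otimes> u i c)) = h (u i a \<otimes> u i c)"
    using h_sum[of "u i a" "u i c" b] assms by simp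
  moreover have "(\<Sum>k\<in>K. h (u i a \<otimes> u k b \<otimes> u i c))
      = h (u i a \<otimes> u i b \<otimes> u i c) + (n - 1) * h (u i a \<otimes> u j b \<otimes> u i c)"
    using assms by (subst sum_eq_off[of K "{i}" "\<lambda>k. h (u i a \<otimes> u k b \<otimes> u i c)" "h (u i a \<otimes> u j b \<otimes> u i c)"]) (auto simp: n_def intro: inv_word_2(1))
  moreover have "h (u i a \<otimes> u i c) = (if a = c then 1 / n else 0)"
    using assms by (simp add: u_idem row_orthogonal h_zero h_word_1)
  ultimately have "(n - 1) * h (u i a \<otimes> u j b \<otimes> u i c) = (if a = c then 1 / n else 0)"
    using assms by (simp add: row_orthogonal h_zero)
  then show ?thesis
    using divide_eq_eq[of "1 / n" "n - 1" "h (u i a \<otimes> u j b \<otimes> u i c)"] n_ne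
    by (simp add: mult.commute split: if_splits)
qed

text \<open>Deleting the last letter leaves a total of \<open>1 / (n * (n - 1))\<close>. Row
  \<open>j\<close> adds nothing because \<open>b \<noteq> c\<close>. If \<open>a = c\<close>, row
  \<open>i\<close> already exhausts the total and the remaining \<open>n - 2\<close> equal terms
  vanish; otherwise row \<open>i\<close> adds nothing and they share it.\<close>

lemma h_word_123:
  assumes "i \<in> K" "j \<in> K" "k \<in> K" "a \<in> K" "b \<in> K" "c \<in> K" "distinct [i, j, k]" "a \<noteq> b" "b \<noteq> c"
  shows "h (u i a \<otimes> u j b \<otimes> u k c) = (if a = c then 0 else 1 / (n * (n - 1) * (n - 2)))"
proof -
  have "(\<Sum>k\<in>K. h (u i a \<otimes> u j b \<otimes> u k c)) = h (u i a \<otimes> u j b)"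
    using h_sum[of "u i a \<otimes> u j b" \<one> c] assms by (simp cong: sum.cong)
  moreover have "(\<Sum>k\<in>K. h (u i a \<otimes> u j b \<otimes> u k c))
      = h (u i a \<otimes> u j b \<otimes> u i c) + h (u i a \<otimes> u j b \<otimes> u j c) + (n - 2) * h (u i a \<otimes> u j b \<otimes> u k c)"
    using assms by (subst sum_eq_off[of K "{i, j}" "\<lambda>k. h (u i a \<otimes> u j b \<otimes> u k c)" "h (u i a \<otimes> u j b \<otimes> u k c)"]) (auto simp: n_def intro: inv_word_3(3))
  moreover have "h (u i a \<otimes> u j b \<otimes> u j c) = 0"
    using assms by (simp add: A_assoc row_orthogonal h_zero)
  ultimately have "(n - 2) * h (u i a \<otimes> u j b \<otimes> u k c) = (if a = c then 0 else 1 / (n * (n - 1)))"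
    using assms by (simp add: h_word_2 h_word_121 split: if_splits)
  then show ?thesis
    using divide_eq_eq[of "1 / (n * (n - 1))" "n - 2" "h (u i a \<otimes> u j b \<otimes> u k c)"] n_ne
    by (simp add: mult_ac split: if_splits)
qed

text \<open>The row patterns 1212, 1213, 1232 and 1234 are the values entering the crossing
  coefficient. The equations sum out the last, the first and the second row index respectively;
  since neighbouring columns differ, a summand with two neighbouring letters in one row
  vanishes.\<close>

lemma word_equations:
  assumes i: "i \<in> K" "j \<in> K" "k \<in> K" "l \<in> K" "distinct [i, j, k, l]"
    and a: "a \<in> K" "b \<in> K" "c \<in> K" "d \<in> K" "a \<noteq> b" "b \<noteq> c" "c \<noteq> d"
  defines "x \<equiv> h (word i a j b i c j d)" and "p \<equiv> h (word i a j b i c k d)"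
    and "q \<equiv> h (word i a j b k c j d)" and "r \<equiv> h (word i a j b k c l d)"
  shows "x + (n - 2) * p = (if a = c then 1 / (n * (n - 1)) else 0)"
    and "x + (n - 2) * q = (if b = d then 1 / (n * (n - 1)) else 0)"
    and "q + (n - 3) * r = (if a = c then 0 else if a = d then 0 else 1 / (n * (n - 1) * (n - 2)))"
proof -
  have "(\<Sum>m\<in>K. h (word i a j b i c m d)) = h (word i a j b i c i d) + x + (n - 2) * p"
    unfolding x_def p_def using i a by (subst sum_eq_off[of K "{i, j}" "\<lambda>m. h (word i a j b i c m d)" "h (word i a j b i c k d)"]) (auto simp: n_def intro: inv_word_3(1))
  moreover have "h (word i a j b i c i d) = 0"
    using i a by (simp add: word_def A_assoc row_orthogonal h_zero)
  ultimately show "x + (n - 2) * p = (if a = c then 1 / (n * (n - 1)) else 0)"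
    using i a by (simp add: sum_word_4 h_word_121)
  have "(\<Sum>m\<in>K. h (word m a j b i c j d)) = h (word j a j b i c j d) + x + (n - 2) * q"
    unfolding x_def q_def using i a by (subst sum_eq_off[of K "{j, i}" "\<lambda>m. h (word m a j b i c j d)" "h (word i a j b k c j d)"]) (auto simp: n_def intro: inv_word_3(2))
  moreover have "h (word j a j b i c j d) = 0"
    using i a by (simp add: word_def row_orthogonal h_zero)
  ultimately show "x + (n - 2) * q = (if b = d then 1 / (n * (n - 1)) else 0)"
    using i a h_word_121[of j i b c d] by (auto simp: sum_word_1)
  \<comment> \<open>The last two rows are written in the order \<open>k\<close>, \<open>j\<close> so
    that \<open>m = j\<close> produces the pattern 1232; the free row meets a neighbour at
    \<open>m = i\<close> and at \<open>m = k\<close>.\<close>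
  have "(\<Sum>m\<in>K. h (word i a m b k c j d))
      = h (word i a i b k c j d) + h (word i a k b k c j d) + q + (n - 3) * r"
    unfolding q_def r_def using i a by (subst sum_eq_off[of K "{i, k, j}" "\<lambda>m. h (word i a m b k c j d)" "h (word i a j b k c l d)"]) (auto simp: n_def intro: inv_word_4)
  moreover have "h (word i a i b k c j d) = 0" "h (word i a k b k c j d) = 0"
    using i a by (simp_all add: word_def row_orthogonal h_zero) (simp add: A_assoc row_orthogonal h_zero)
  moreover have "a = c \<Longrightarrow> h (u i a \<otimes> u k c \<otimes> u j d) = 0"
    using i a by (simp add: col_orthogonal h_zero)
  moreover have "a \<noteq> c \<Longrightarrow> h (u i a \<otimes> u k c \<otimes> u j d) = (if a = d then 0 else 1 / (n * (n - 1) * (n - 2)))"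
    using i a by (intro h_word_123) auto
  moreover have "(\<Sum>m\<in>K. h (word i a m b k c j d)) = h (u i a \<otimes> u k c \<otimes> u j d)"
    using i a by (intro sum_word_2) auto
  ultimately show "q + (n - 3) * r = (if a = c then 0 else if a = d then 0 else 1 / (n * (n - 1) * (n - 2)))"
    by (cases "a = c") simp_all
qed

text \<open>For fixed columns, \<open>h\<close> of a word is a fixed vector in its row indices. A
  nonzero crossing coefficient would make the given noncommuting pair commute, whatever the columns
  \<open>a\<close>, \<open>b\<close>, \<open>c\<close>, \<open>d\<close> are.\<close>

lemma crossing_coefficient_zero:
  assumes i: "i \<in> K" "j \<in> K" "k \<in> K" "l \<in> K" "distinct [i, j, k, l]"
    and a: "a \<in> K" "b \<in> K" "c \<in> K" "d \<in> K"
    and fixed: "\<And>i j. \<lbrakk>i \<in> K; j \<in> K\<rbrakk> \<Longrightarrow> (\<Oplus>k1\<in>K. \<Oplus>k2\<in>K. \<Oplus>k3\<in>K. \<Oplus>k4\<in>K.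
      h (word k1 a k2 b k3 c k4 d) \<odot> word i k1 j k2 i k3 j k4) = h (word i a j b i c j d) \<odot> \<one>"
    and noncommuting: "i' \<in> K" "j' \<in> K" "k' \<in> K" "l' \<in> K" "u i' k' \<otimes> u j' l' \<noteq> u j' l' \<otimes> u i' k'"
  shows "h (word i a j b i c j d) - h (word i a j b i c k d) - h (word i a j b k c j d)
    + h (word i a j b k c l d) = 0"
proof (rule ccontr)
  assume nz: "\<not> ?thesis"
  \<comment> \<open>Two generators sharing a row or a column are equal or have zero products, hence
    commute.\<close>
  have ne: "i' \<noteq> j'" "k' \<noteq> l'"
    using noncommuting row_orthogonal[of i' k' l'] row_orthogonal[of i' l' k']
      col_orthogonal[of k' i' j'] col_orthogonal[of k' j' i'] by metis+
  have 2: "h (word i1 a j1 b i1 c j1 d) = h (word i a j b i c j d)" if "i1 \<in> K" "j1 \<in> K" "i1 \<noteq> j1" for i1 j1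
    using that i a inv_word_2(3)[of i1 j1 i j a b c d] by auto
  have "u i' k' \<otimes> u j' l' = u j' l' \<otimes> u i' k'"
  proof (rule commute_if_crossing_coefficient[OF _ _ _ ne(1) _ _ ne(2) _ _ _ _ nz])
    show "(\<Oplus>k1\<in>K. \<Oplus>k2\<in>K. \<Oplus>k3\<in>K. \<Oplus>k4\<in>K. h (word k1 a k2 b k3 c k4 d) \<odot> word i' k1 j' k2 i' k3 j' k4)
      = h (word i a j b i c j d) \<odot> \<one>"
      using fixed[of i' j'] 2[of i' j'] noncommuting ne by simp
    show "h (word k' a l' b k' c l' d) = h (word i a j b i c j d)"
      using 2 noncommuting ne by simp
    show "h (word k' a l' b m c l' d) = h (word i a j b k c j d)" if "m \<in> K - {k', l'}" for m
      using that noncommuting ne i a by (intro inv_word_3(2)) auto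
    show "h (word k' a m b k' c l' d) = h (word i a j b i c k d)" if "m \<in> K - {k', l'}" for m
      using that noncommuting ne i a by (intro inv_word_3(1)) auto
    show "h (word k' a m b m' c l' d) = h (word i a j b k c l d)"
      if "m \<in> K - {k', l'}" "m' \<in> K - {k', l'}" "m \<noteq> m'" for m m'
      using that noncommuting ne i a by (intro inv_word_4) auto
  qed (use noncommuting in auto)
  with noncommuting show False by simp
qed

end

lemma solve_word_equations:
  fixes n x p q r D D' E :: complex
  assumes "n - 2 \<noteq> 0" "n - 3 \<noteq> 0" "n\<^sup>2 - 3 * n + 1 \<noteq> 0"
    and 1: "x + (n - 2) * p = D" and 2: "x + (n - 2) * q = D'" and 3: "q + (n - 3) * r = E"
    and 4: "x - p - q + r = 0"
  shows "x = ((n - 3) * D + (n - 2) * D' - (n - 2) * E) / (n\<^sup>2 - 3 * n + 1)"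
    and "p = (D - x) / (n - 2)" and "q = (D' - x) / (n - 2)" and "r = p + q - x"
proof -
  show p: "p = (D - x) / (n - 2)" and q: "q = (D' - x) / (n - 2)" and r: "r = p + q - x"
    using 1 2 4 assms(1) by (auto simp: eq_divide_eq algebra_simps)
  have "(n - 2) * E = (n - 2) * q + (n - 3) * ((n - 2) * p + (n - 2) * q - (n - 2) * x)"
    unfolding 3[symmetric] r by (simp only: algebra_simps)
  also have "\<dots> = (D' - x) + (n - 3) * ((D - x) + (D' - x) - (n - 2) * x)"
  proof -
    have "(n - 2) * p = D - x" "(n - 2) * q = D' - x"
      using 1 2 by (simp_all add: algebra_simps)
    then show ?thesis by (simp only:)
  qed
  finally have "(n\<^sup>2 - 3 * n + 1) * x = (n - 3) * D + (n - 2) * D' - (n - 2) * E"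
    by (simp add: algebra_simps power2_eq_square)
  then show "x = ((n - 3) * D + (n - 2) * D' - (n - 2) * E) / (n\<^sup>2 - 3 * n + 1)"
    using assms(3) by (simp add: eq_divide_eq mult.commute)
qed

section \<open>Commuting generators\<close>

context cstar_algebra
begin

lemma neg_add_cancel: "x \<in> carrier A \<Longrightarrow> y \<in> carrier A \<Longrightarrow> (-1) \<odot> x \<oplus> (x \<oplus> y) = y"
  using ring.ring_simprules(18)[OF is_ring_A, of x y] by (simp add: minus_eq_smult)

lemma add_diff_cancel: "x \<in> carrier A \<Longrightarrow> y \<in> carrier A \<Longrightarrow> x \<oplus> (y \<ominus> x) = y"
  using neg_add_cancel[of x y] A_plus_ac(3)[of x "(-1) \<odot> x" y] A_plus_ac(2)[of y "(-1) \<odot> x"]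
  by (simp add: diff_eq_smult)

lemma cnorm_diff_triangle:
  assumes "x \<in> carrier A" "y \<in> carrier A" "z \<in> carrier A"
  shows "cnorm A (x \<ominus> z) \<le> cnorm A (x \<ominus> y) + cnorm A (y \<ominus> z)"
proof -
  have "(x \<ominus> y) \<oplus> (y \<ominus> z) = x \<ominus> z"
    using assms by (simp add: diff_eq_smult A_plus_ac(1) neg_add_cancel)
  then show ?thesis
    using cnorm_triangle[of "x \<ominus> y" "y \<ominus> z"] assms by (simp add: diff_eq_smult)
qed

lemma cnorm_diff_commute:
  assumes "x \<in> carrier A" "y \<in> carrier A"
  shows "cnorm A (x \<ominus> y) = cnorm A (y \<ominus> x)"
proof -
  have "x \<ominus> y = (-1) \<odot> (y \<ominus> x)"
    using assms by (simp add: diff_eq_smult smult_add_right smult_smult one_smult A_plus_ac)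
  then show ?thesis using assms by (simp add: cnorm_smult diff_eq_smult)
qed

lemma smult_diff: "x \<in> carrier A \<Longrightarrow> a \<odot> x \<ominus> b \<odot> x = (a - b) \<odot> x"
  using smult_add_left[of x a "- b"] by (simp add: diff_eq_smult smult_smult)

text \<open>The line spanned by \<open>P\<close> is norm closed. Concretely, the eigenvalues of
  approximants to \<open>x\<close> form a Cauchy sequence, because multiples of \<open>P\<close>
  differ in norm by \<open>cnorm A P\<close> times the difference of the scalars; the case
  \<open>P = \<zero>\<close>, where scalars are not determined, is split off.\<close>

lemma eigenvalue_of_dense_limit:
  assumes P: "P \<in> carrier A" and D: "norm_dense A D"
    and eig: "\<And>y. y \<in> D \<Longrightarrow> \<exists>c. y \<otimes> P = c \<odot> P" and x: "x \<in> carrier A"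
  shows "\<exists>c. x \<otimes> P = c \<odot> P"
proof (cases "P = \<zero>")
  case True
  then show ?thesis using x by (simp add: smult_zero)
next
  case False
  define b where "b = cnorm A P"
  have b: "b > 0"
    using False P cnorm_nonneg[of P] cnorm_eq_0_iff[of P] by (simp add: b_def less_le)
  have "\<exists>c. cnorm A (x \<otimes> P \<ominus> c \<odot> P) \<le> e * b" if e: "e > 0" for e
  proof -
    obtain y where y: "y \<in> D" "y \<in> carrier A" "cnorm A (x \<ominus> y) < e"
      using D x e unfolding norm_dense_def by blast
    obtain c where c: "y \<otimes> P = c \<odot> P" using eig y by blast
    have "x \<otimes> P \<ominus> c \<odot> P = (x \<ominus> y) \<otimes> P"
      unfolding c[symmetric] using x y P by (simp add: diff_eq_smult A_l_distr smult_mult_left)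
    then have "cnorm A (x \<otimes> P \<ominus> c \<odot> P) \<le> cnorm A (x \<ominus> y) * b"
      using cnorm_mult[of "x \<ominus> y" P] x y P by (simp add: b_def diff_eq_smult)
    also have "\<dots> \<le> e * b" using y b by (intro mult_right_mono) auto
    finally show ?thesis by blast
  qed
  then have "\<exists>c. cnorm A (x \<otimes> P \<ominus> c \<odot> P) \<le> inverse (real (Suc m)) * b" for m by simp
  then obtain c where c: "\<And>m. cnorm A (x \<otimes> P \<ominus> c m \<odot> P) \<le> inverse (real (Suc m)) * b"
    by metis
  have close: "cmod (c' - c m) * b \<le> cnorm A (x \<otimes> P \<ominus> c' \<odot> P) + inverse (real (Suc m)) * b" for c' m
  proof -
    have "cmod (c' - c m) * b = cnorm A (c' \<odot> P \<ominus> c m \<odot> P)"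
      using P by (simp add: smult_diff cnorm_smult b_def)
    also have "\<dots> \<le> cnorm A (c' \<odot> P \<ominus> x \<otimes> P) + cnorm A (x \<otimes> P \<ominus> c m \<odot> P)"
      using P x by (intro cnorm_diff_triangle) auto
    finally show ?thesis
      using c[of m] P x cnorm_diff_commute[of "c' \<odot> P" "x \<otimes> P"] by simp
  qed
  have "Cauchy c"
  proof (rule metric_CauchyI)
    fix e :: real assume "e > 0"
    then obtain M where M: "inverse (real (Suc M)) < e / 2"
      using reals_Archimedean[of "e / 2"] by auto
    have "dist (c m) (c k) < e" if "m \<ge> M" "k \<ge> M" for m k
    proof -
      have "inverse (real (Suc m)) \<le> inverse (real (Suc M))" "inverse (real (Suc k)) \<le> inverse (real (Suc M))"
        using that by (auto intro!: le_imp_inverse_le)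
      moreover have "cmod (c m - c k) * b \<le> (inverse (real (Suc m)) + inverse (real (Suc k))) * b"
        using close[of "c m" k] c[of m] by (simp add: distrib_right)
      then have "cmod (c m - c k) \<le> inverse (real (Suc m)) + inverse (real (Suc k))"
        using b by (simp only: mult_le_cancel_right_pos)
      ultimately show ?thesis
        using M unfolding dist_norm by linarith
    qed
    then show "\<exists>M. \<forall>m\<ge>M. \<forall>k\<ge>M. dist (c m) (c k) < e" by blast
  qed
  then obtain l where l: "c \<longlonglongrightarrow> l" using Cauchy_convergent_iff convergent_def by blast
  have "cnorm A (x \<otimes> P \<ominus> l \<odot> P) \<le> inverse (real (Suc m)) * b + cmod (c m - l) * b" for m
  proof -
    have "cnorm A (x \<otimes> P \<ominus> l \<odot> P) \<le> cnorm A (x \<otimes> P \<ominus> c m \<odot> P) + cnorm A (c m \<odot> P \<ominus> l \<odot> P)"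
      using P x by (intro cnorm_diff_triangle) auto
    then show ?thesis using c[of m] P by (simp add: smult_diff cnorm_smult b_def)
  qed
  moreover have "(\<lambda>m. inverse (real (Suc m)) * b + cmod (c m - l) * b) \<longlonglongrightarrow> 0 * b + cmod (l - l) * b"
    by (intro tendsto_intros LIMSEQ_inverse_real_of_nat l)
  ultimately have "cnorm A (x \<otimes> P \<ominus> l \<odot> P) \<le> 0"
    by (intro LIMSEQ_le_const) auto
  then have "x \<otimes> P \<ominus> l \<odot> P = \<zero>"
    using x P cnorm_nonneg[of "x \<otimes> P \<ominus> l \<odot> P"] cnorm_eq_0_iff[of "x \<otimes> P \<ominus> l \<odot> P"] by (simp add: diff_eq_smult)
  then have "x \<otimes> P = l \<odot> P"
    using x P add_diff_cancel[of "l \<odot> P" "x \<otimes> P"] by simp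
  then show ?thesis by blast
qed

end

section \<open>Joint eigenvectors and characters of the commuting generators\<close>

lemma (in cstar_algebra) star_subalgebra_gen_closed:
  "x \<in> star_subalgebra_gen A D \<Longrightarrow> D \<subseteq> carrier A \<Longrightarrow> x \<in> carrier A"
  by (induction rule: star_subalgebra_gen.induct) (auto simp: star_closed)

definition character :: "('a, 'm) cstar_scheme \<Rightarrow> ('a \<Rightarrow> complex) \<Rightarrow> bool" where
  "character A \<chi> \<longleftrightarrow> linear_functional A \<chi> \<and> \<chi> \<one>\<^bsub>A\<^esub> = 1 \<and>
     (\<forall>x\<in>carrier A. \<forall>y\<in>carrier A. \<chi> (x \<otimes>\<^bsub>A\<^esub> y) = \<chi> x * \<chi> y)"

context magic_algebra
begin

text \<open>When \<open>js\<close> enumerates \<open>K\<close>, the element of C(S_N) given by this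
  product is the indicator of the permutation \<open>f\<close>, or zero if \<open>f\<close> is not
  injective.\<close>

primrec diagonal_word :: "('i \<Rightarrow> 'i) \<Rightarrow> 'i list \<Rightarrow> 'a" where
  "diagonal_word f [] = \<one>"
| "diagonal_word f (j # js) = u (f j) j \<otimes> diagonal_word f js"

lemma diagonal_word_in: "f \<in> K \<rightarrow> K \<Longrightarrow> set js \<subseteq> K \<Longrightarrow> diagonal_word f js \<in> carrier A"
  by (induction js) (auto simp: Pi_def)

lemma diagonal_word_cong: "(\<And>j. j \<in> set js \<Longrightarrow> f j = g j) \<Longrightarrow> diagonal_word f js = diagonal_word g js"
  by (induction js) auto

text \<open>Multiplying out the column sums, one column at a time, writes the unit as the sum of all
  diagonal words. No commutation enters, as the factors stay in the order of
  \<open>js\<close>.\<close>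

lemma zero_if_annihilates_diagonal_words:
  assumes "x \<in> carrier A" "distinct js" "set js \<subseteq> K" "\<And>f. f \<in> K \<rightarrow> K \<Longrightarrow> x \<otimes> diagonal_word f js = \<zero>"
  shows "x = \<zero>"
  using assms
proof (induction js arbitrary: x)
  case Nil
  then show ?case using Nil.prems(4)[of "\<lambda>x. x"] by simp
next
  case (Cons j js)
  have "x \<otimes> u i j = \<zero>" if i: "i \<in> K" for i
  proof (rule Cons.IH)
    fix f assume f: "f \<in> K \<rightarrow> K"
    then have "f(j := i) \<in> K \<rightarrow> K" using i by auto
    from Cons.prems(4)[OF this] have "x \<otimes> (u i j \<otimes> diagonal_word (f(j := i)) js) = \<zero>"
      by (simp only: diagonal_word.simps fun_upd_same)
    moreover have "diagonal_word (f(j := i)) js = diagonal_word f js"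
      using Cons.prems(2) by (intro diagonal_word_cong) auto
    ultimately show "x \<otimes> u i j \<otimes> diagonal_word f js = \<zero>"
      using Cons.prems i f diagonal_word_in[of f js] by (simp add: A_assoc)
  qed (use Cons.prems i in auto)
  then have "(\<Oplus>i\<in>K. x \<otimes> u i j) = (\<Oplus>i\<in>K. \<zero>)"
    by (intro finsum_cong_in) auto
  moreover have "x \<otimes> (\<Oplus>i\<in>K. u i j) = (\<Oplus>i\<in>K. x \<otimes> u i j)"
    using Cons.prems by (intro finsum_lmult) auto
  ultimately show ?case
    using Cons.prems by (simp add: col_sum finsum_zero_A)
qed

context
  assumes commute: "\<And>i j k l. \<lbrakk>i \<in> K; j \<in> K; k \<in> K; l \<in> K\<rbrakk> \<Longrightarrow> u i j \<otimes> u k l = u k l \<otimes> u i j"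
begin

text \<open>The generator is moved to the factor from its own column, where it is absorbed by
  idempotency or killed by column orthogonality.\<close>

lemma generator_diagonal_word:
  assumes "f \<in> K \<rightarrow> K" "set js \<subseteq> K" "i \<in> K" "j \<in> set js"
  shows "u i j \<otimes> diagonal_word f js = (if i = f j then diagonal_word f js else \<zero>)"
  using assms(2,4)
proof (induction js)
  case (Cons k js)
  have in_K: "f k \<in> K" "k \<in> K" "j \<in> K" using Cons.prems assms by auto
  have P: "diagonal_word f js \<in> carrier A"
    using Cons.prems assms by (intro diagonal_word_in) auto
  show ?case
  proof (cases "j = k")
    case True
    have "u i j \<otimes> diagonal_word f (k # js) = u i j \<otimes> u (f j) j \<otimes> diagonal_word f js"
      using True in_K P assms by (simp add: A_assoc)
    then show ?thesis
      using True in_K P assms by (auto simp: u_idem col_orthogonal)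
  next
    case False
    have "u i j \<otimes> diagonal_word f (k # js) = u i j \<otimes> u (f k) k \<otimes> diagonal_word f js"
      using in_K P assms by (simp add: A_assoc)
    also have "\<dots> = u (f k) k \<otimes> (u i j \<otimes> diagonal_word f js)"
      using in_K P assms commute[of i j "f k" k] by (simp add: A_assoc)
    finally show ?thesis
      using Cons False in_K P by auto
  qed
qed simp

text \<open>If two columns share a row, the word absorbs both of these generators, whose product is
  zero by row orthogonality.\<close>

lemma diagonal_word_not_inj:
  assumes "f \<in> K \<rightarrow> K" "set js \<subseteq> K" "\<not> inj_on f (set js)"
  shows "diagonal_word f js = \<zero>"
proof -
  let ?P = "diagonal_word f js"
  obtain j k where jk: "j \<in> set js" "k \<in> set js" "j \<noteq> k" "f j = f k"
    using assms(3) by (auto simp: inj_on_def)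
  then have in_K: "j \<in> K" "k \<in> K" "f j \<in> K" using assms by auto
  have P: "?P \<in> carrier A" using assms by (intro diagonal_word_in)
  have 1: "?P = u (f j) j \<otimes> ?P"
    using generator_diagonal_word[OF assms(1,2), of "f j" j] jk in_K by simp
  have 2: "?P = u (f j) k \<otimes> ?P"
    using generator_diagonal_word[OF assms(1,2), of "f j" k] jk in_K by simp
  have "?P = u (f j) j \<otimes> (u (f j) k \<otimes> ?P)"
    by (subst 2[symmetric]) (rule 1)
  also have "u (f j) j \<otimes> (u (f j) k \<otimes> ?P) = u (f j) j \<otimes> u (f j) k \<otimes> ?P"
    using in_K P by (simp add: A_assoc)
  also have "\<dots> = \<zero>"
    using in_K P jk by (simp add: row_orthogonal)
  finally show ?thesis .
qed

text \<open>The adjoint is carried along because the star rule of the generated subalgebra exchanges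
  the two claims.\<close>

lemma diagonal_word_eigenvector:
  assumes f: "f \<in> K \<rightarrow> K" and js: "set js = K"
    and x: "x \<in> star_subalgebra_gen A {u i j | i j. i \<in> K \<and> j \<in> K}"
  shows "\<exists>c d. x \<otimes> diagonal_word f js = c \<odot> diagonal_word f js \<and> star A x \<otimes> diagonal_word f js = d \<odot> diagonal_word f js"
proof -
  let ?P = "diagonal_word f js"
  have P: "?P \<in> carrier A" using f js by (intro diagonal_word_in) auto
  have in_A: "x \<in> carrier A" if "x \<in> star_subalgebra_gen A {u i j | i j. i \<in> K \<and> j \<in> K}" for x
    using that by (rule star_subalgebra_gen_closed) auto
  show ?thesis
    using x
  proof (induction rule: star_subalgebra_gen.induct)
    case (gen x)
    then obtain i j where ij: "x = u i j" "i \<in> K" "j \<in> K" by auto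
    then have "x \<otimes> ?P = (if i = f j then 1 else 0) \<odot> ?P"
      using generator_diagonal_word[OF f, of js i j] js P by (simp add: one_smult zero_smult)
    then show ?case using ij u_star by auto
  next
    case zero
    then show ?case using P by (auto simp: star_zero intro!: exI[of _ 0] simp: zero_smult)
  next
    case one
    then show ?case using P by (auto simp: star_one intro!: exI[of _ 1] simp: one_smult)
  next
    case (add x y)
    then obtain a b c d where "x \<otimes> ?P = a \<odot> ?P" "star A x \<otimes> ?P = b \<odot> ?P"
      "y \<otimes> ?P = c \<odot> ?P" "star A y \<otimes> ?P = d \<odot> ?P" by blast
    then have "(x \<oplus> y) \<otimes> ?P = (a + c) \<odot> ?P" "star A (x \<oplus> y) \<otimes> ?P = (b + d) \<odot> ?P"
      using add.hyps in_A P by (simp_all add: A_l_distr star_add smult_add_left star_closed)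
    then show ?case by blast
  next
    case (mult x y)
    then obtain a b c d where *: "x \<otimes> ?P = a \<odot> ?P" "star A x \<otimes> ?P = b \<odot> ?P"
      "y \<otimes> ?P = c \<odot> ?P" "star A y \<otimes> ?P = d \<odot> ?P" by blast
    have "(x \<otimes> y) \<otimes> ?P = (c * a) \<odot> ?P" "star A (x \<otimes> y) \<otimes> ?P = (b * d) \<odot> ?P"
      using mult.hyps in_A P *
      by (simp_all add: A_assoc star_mult star_closed smult_mult_right smult_smult)
    then show ?case by blast
  next
    case (smult x c)
    then obtain a b where "x \<otimes> ?P = a \<odot> ?P" "star A x \<otimes> ?P = b \<odot> ?P" by blast
    then have "(c \<odot> x) \<otimes> ?P = (c * a) \<odot> ?P" "star A (c \<odot> x) \<otimes> ?P = (cnj c * b) \<odot> ?P"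
      using smult.hyps in_A P by (simp_all add: star_smult smult_mult_left smult_smult star_closed)
    then show ?case by blast
  next
    case (star x)
    then show ?case using in_A by (auto simp: star_star)
  qed
qed

text \<open>By density every \<open>x\<close> acts on each diagonal word as a scalar. For injective
  \<open>f\<close> that scalar is the value at \<open>x\<close> of the character belonging to
  \<open>f\<close>, so \<open>x\<close> annihilates all diagonal words and hence the unit.\<close>

lemma zero_if_characters_vanish:
  assumes dense: "norm_dense A (star_subalgebra_gen A {u i j | i j. i \<in> K \<and> j \<in> K})"
    and x: "x \<in> carrier A"
    and char: "\<And>\<pi>. \<pi> permutes K \<Longrightarrow> \<exists>\<chi>. character A \<chi> \<and> \<chi> x = 0 \<and>
      (\<forall>i\<in>K. \<forall>j\<in>K. \<chi> (u i j) = of_bool (i = \<pi> j))"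
  shows "x = \<zero>"
proof -
  obtain js where js: "set js = K" "distinct js" using finite_distinct_list[OF K_finite] by blast
  have "x \<otimes> diagonal_word f js = \<zero>" if f: "f \<in> K \<rightarrow> K" for f
  proof (cases "inj_on f K")
    case False
    then show ?thesis using diagonal_word_not_inj[OF f, of js] js x by simp
  next
    case True
    let ?P = "diagonal_word f js"
    have P: "?P \<in> carrier A" using f js by (intro diagonal_word_in) auto
    \<comment> \<open>A permutation of \<open>K\<close> has to fix everything outside, where
      \<open>f\<close> is arbitrary.\<close>
    define \<pi> where "\<pi> k = (if k \<in> K then f k else k)" for k
    have "bij_betw f K K"
      using True f by (simp add: bij_betw_def endo_inj_surj funcset_image)
    then have "bij_betw \<pi> K K"
      by (rule bij_betw_cong[THEN iffD1, rotated]) (simp add: \<pi>_def)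
    then have "\<pi> permutes K"
      by (rule bij_imp_permutes) (simp add: \<pi>_def)
    then obtain \<chi> where \<chi>: "character A \<chi>" "\<chi> x = 0" "\<forall>i\<in>K. \<forall>j\<in>K. \<chi> (u i j) = of_bool (i = \<pi> j)"
      using char by blast
    have "set ks \<subseteq> K \<Longrightarrow> \<chi> (diagonal_word f ks) = 1" for ks
    proof (induction ks)
      case Nil
      then show ?case using \<chi> by (simp add: character_def)
    next
      case (Cons k ks)
      then have "\<chi> (diagonal_word f (k # ks)) = \<chi> (u (f k) k) * \<chi> (diagonal_word f ks)"
        using \<chi>(1) diagonal_word_in[OF f, of ks] funcset_mem[OF f, of k] by (simp add: character_def)
      moreover have "\<chi> (u (f k) k) = 1"
        using Cons.prems \<chi>(3) funcset_mem[OF f, of k] by (simp add: \<pi>_def)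
      ultimately show ?case using Cons by simp
    qed
    then have 1: "\<chi> ?P = 1" using js by simp
    obtain c where c: "x \<otimes> ?P = c \<odot> ?P"
      using eigenvalue_of_dense_limit[OF P dense _ x] diagonal_word_eigenvector[OF f js(1)] by blast
    \<comment> \<open>The character takes the value 1 at the diagonal word, so applying it to the
      eigenvalue equation reads off \<open>c\<close>.\<close>
    have "\<chi> (x \<otimes> ?P) = 0"
      using \<chi> x P by (simp add: character_def)
    moreover have "\<chi> (c \<odot> ?P) = c * 1"
      using \<chi>(1) P 1 by (simp add: character_def linear_functional_def)
    ultimately have "c = 0" using c by simp
    then show ?thesis using c P by (simp add: zero_smult)
  qed
  then show ?thesis
    using zero_if_annihilates_diagonal_words[OF x, of js] js by auto
qed

end

end

section \<open>Magic unitaries in the two by two matrices\<close>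

definition mat2_op :: "(nat \<Rightarrow> nat \<Rightarrow> complex) \<Rightarrow> complex \<times> complex \<Rightarrow> complex \<times> complex" where
  "mat2_op f v = (f 0 0 * fst v + f 0 1 * snd v, f 1 0 * fst v + f 1 1 * snd v)"

text \<open>The two by two matrices sit in the upper left corner of the infinite ones, the type over
  which the universal property of C(S_N^+) quantifies. The norm is the operator norm on
  two-dimensional Hilbert space.\<close>

definition mat2 :: separable_cstar where
  "mat2 = \<lparr>carrier = {f. \<forall>i j. i \<ge> 2 \<or> j \<ge> 2 \<longrightarrow> f i j = 0},
     monoid.mult = (\<lambda>f g i j. f i 0 * g 0 j + f i 1 * g 1 j),
     one = (\<lambda>i j. of_bool (i = j \<and> i < 2)),
     ring.zero = (\<lambda>i j. 0),
     add = (\<lambda>f g i j. f i j + g i j),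
     module.smult = (\<lambda>c f i j. c * f i j),
     star = (\<lambda>f i j. cnj (f j i)),
     cnorm = (\<lambda>f. onorm (mat2_op f))\<rparr>"

lemma mat2_eqI:
  assumes "f \<in> carrier mat2" "g \<in> carrier mat2"
    "f 0 0 = g 0 0" "f 0 1 = g 0 1" "f 1 0 = g 1 0" "f 1 1 = g 1 1"
  shows "f = g"
proof (intro ext)
  fix i j :: nat
  consider "i \<ge> 2 \<or> j \<ge> 2" | "i = 0" "j = 0" | "i = 0" "j = 1" | "i = 1" "j = 0" | "i = 1" "j = 1"
    by linarith
  then show "f i j = g i j"
    using assms by cases (auto simp: mat2_def)
qed

lemma mat2_op_bounded_linear: "bounded_linear (mat2_op f)"
  unfolding mat2_op_def by (intro bounded_linear_Pair bounded_linear_add bounded_linear_const_mult bounded_linear_fst bounded_linear_snd)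

lemma mat2_ring: "ring mat2"
proof (rule ringI)
  show "abelian_group mat2"
  proof (rule abelian_groupI)
    fix x assume x: "x \<in> carrier mat2"
    then show "\<exists>y\<in>carrier mat2. y \<oplus>\<^bsub>mat2\<^esub> x = \<zero>\<^bsub>mat2\<^esub>"
      by (intro bexI[of _ "\<lambda>i j. - x i j"]) (auto simp: mat2_def)
  qed (auto simp: mat2_def algebra_simps)
  show "monoid mat2"
    by (rule monoidI) (auto simp: mat2_def algebra_simps fun_eq_iff less_2_cases_iff)
qed (auto simp: mat2_def algebra_simps)

lemma mat2_minus: "f \<in> carrier mat2 \<Longrightarrow> g \<in> carrier mat2 \<Longrightarrow> f \<ominus>\<^bsub>mat2\<^esub> g = (\<lambda>i j. f i j - g i j)"
proof -
  assume *: "f \<in> carrier mat2" "g \<in> carrier mat2"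
  interpret ring mat2 by (rule mat2_ring)
  have "\<ominus>\<^bsub>mat2\<^esub> g = (\<lambda>i j. - g i j)"
    using * by (intro minus_equality) (auto simp: mat2_def)
  then show ?thesis using * by (simp add: minus_eq) (simp add: mat2_def)
qed

lemma mat2_norm_entry:
  assumes "i < 2" "j < 2"
  shows "cmod (f i j) \<le> onorm (mat2_op f)"
proof -
  define v :: "complex \<times> complex" where "v = (if j = 0 then (1, 0) else (0, 1))"
  have v: "norm v = 1" by (simp add: v_def norm_Pair)
  have "f i j = (if i = 0 then fst else snd) (mat2_op f v)"
    using assms by (auto simp: v_def mat2_op_def less_2_cases_iff)
  then have "cmod (f i j) \<le> norm (mat2_op f v)"
    using norm_fst_le[of "fst (mat2_op f v)" "snd (mat2_op f v)"] norm_snd_le[of "snd (mat2_op f v)" "fst (mat2_op f v)"] by auto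
  also have "\<dots> \<le> onorm (mat2_op f) * norm v"
    by (rule onorm[OF mat2_op_bounded_linear])
  finally show ?thesis using v by simp
qed

lemma mat2_norm_le_entries:
  "onorm (mat2_op f) \<le> cmod (f 0 0) + cmod (f 0 1) + (cmod (f 1 0) + cmod (f 1 1))"
proof (rule onorm_bound)
  fix v :: "complex \<times> complex"
  have "norm (mat2_op f v) \<le> cmod (f 0 0 * fst v + f 0 1 * snd v) + cmod (f 1 0 * fst v + f 1 1 * snd v)"
    unfolding mat2_op_def by (rule norm_Pair_le)
  also have "\<dots> \<le> cmod (f 0 0) * norm v + cmod (f 0 1) * norm v + (cmod (f 1 0) * norm v + cmod (f 1 1) * norm v)"
    using norm_fst_le[of "fst v" "snd v"] norm_snd_le[of "snd v" "fst v"]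
    by (intro add_mono order.trans[OF norm_triangle_ineq]) (auto simp: norm_mult intro: mult_left_mono)
  finally show "norm (mat2_op f v) \<le> (cmod (f 0 0) + cmod (f 0 1) + (cmod (f 1 0) + cmod (f 1 1))) * norm v"
    by (simp add: algebra_simps)
qed simp

text \<open>The inner product is the real one, that is the real part of the Hermitian product. It
  induces the same norm, which is all that the C*-identity asks for.\<close>

lemma mat2_adjoint:
  "inner (mat2_op f v) w = inner v (mat2_op (\<lambda>i j. cnj (f j i)) w)"
  by (cases v; cases w) (simp add: mat2_op_def inner_complex_def algebra_simps)

lemma mat2_op_mult: "mat2_op (f \<otimes>\<^bsub>mat2\<^esub> g) = mat2_op f \<circ> mat2_op g"
  by (auto simp: mat2_op_def mat2_def fun_eq_iff algebra_simps)

lemma mat2_norm_le_star: "(onorm (mat2_op f))\<^sup>2 \<le> onorm (mat2_op (star mat2 f \<otimes>\<^bsub>mat2\<^esub> f))"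
proof -
  let ?C = "onorm (mat2_op (star mat2 f \<otimes>\<^bsub>mat2\<^esub> f))"
  have C: "?C \<ge> 0" by (rule onorm_pos_le[OF mat2_op_bounded_linear])
  have "norm (mat2_op f v) \<le> sqrt ?C * norm v" for v
  proof -
    have "(norm (mat2_op f v))\<^sup>2 = inner (mat2_op f v) (mat2_op f v)"
      by (rule power2_norm_eq_inner)
    also have "\<dots> = inner v (mat2_op (star mat2 f \<otimes>\<^bsub>mat2\<^esub> f) v)"
      by (subst mat2_adjoint) (simp add: mat2_op_mult, simp add: mat2_def)
    also have "\<dots> \<le> norm v * norm (mat2_op (star mat2 f \<otimes>\<^bsub>mat2\<^esub> f) v)"
      by (rule norm_cauchy_schwarz)
    also have "\<dots> \<le> norm v * (?C * norm v)"
      by (intro mult_left_mono onorm[OF mat2_op_bounded_linear]) auto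
    also have "\<dots> = (sqrt ?C * norm v)\<^sup>2"
      using C by (simp add: power2_eq_square)
    finally show ?thesis by (rule power2_le_imp_le) (use C in simp)
  qed
  then have "onorm (mat2_op f) \<le> sqrt ?C" using C by (intro onorm_bound) auto
  then have "(onorm (mat2_op f))\<^sup>2 \<le> (sqrt ?C)\<^sup>2"
    by (rule power_mono) (rule onorm_pos_le[OF mat2_op_bounded_linear])
  then show ?thesis using C by simp
qed

lemma mat2_norm_mult: "onorm (mat2_op (f \<otimes>\<^bsub>mat2\<^esub> g)) \<le> onorm (mat2_op f) * onorm (mat2_op g)"
  unfolding mat2_op_mult by (intro onorm_compose mat2_op_bounded_linear)

text \<open>From \<open>mat2_norm_le_star\<close> and submultiplicativity, the norm of
  \<open>f\<close> is at most that of its adjoint, hence equal to it by symmetry.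
  Submultiplicativity then gives the missing inequality.\<close>

lemma mat2_cstar_identity: "onorm (mat2_op (star mat2 f \<otimes>\<^bsub>mat2\<^esub> f)) = (onorm (mat2_op f))\<^sup>2"
proof -
  have le: "onorm (mat2_op f) \<le> onorm (mat2_op (star mat2 f))" for f
  proof (cases "onorm (mat2_op f) = 0")
    case True
    then show ?thesis by (simp add: onorm_pos_le[OF mat2_op_bounded_linear])
  next
    case False
    then have "onorm (mat2_op f) > 0"
      using onorm_pos_le[OF mat2_op_bounded_linear, of f] by simp
    moreover have "onorm (mat2_op f) * onorm (mat2_op f) \<le> onorm (mat2_op (star mat2 f)) * onorm (mat2_op f)"
      using order.trans[OF mat2_norm_le_star mat2_norm_mult] by (simp add: power2_eq_square)
    ultimately show ?thesis by simp
  qed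
  have "star mat2 (star mat2 f) = f" by (simp add: mat2_def)
  then have "onorm (mat2_op (star mat2 f)) = onorm (mat2_op f)"
    using le[of f] le[of "star mat2 f"] by simp
  then show ?thesis
    using mat2_norm_le_star[of f] mat2_norm_mult[of "star mat2 f" f] by (simp add: power2_eq_square)
qed

lemma mat2_norm_smult: "onorm (mat2_op (\<lambda>i j. c * f i j)) = cmod c * onorm (mat2_op f)"
proof -
  have op: "norm (mat2_op (\<lambda>i j. c * f i j) v) = cmod c * norm (mat2_op f v)" for c f v
  proof -
    have "mat2_op (\<lambda>i j. c * f i j) v = (c * fst (mat2_op f v), c * snd (mat2_op f v))"
      by (simp add: mat2_op_def algebra_simps)
    then show ?thesis
      by (simp add: norm_Pair norm_mult power_mult_distrib real_sqrt_mult norm_prod_def flip: distrib_left)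
  qed
  have le: "onorm (mat2_op (\<lambda>i j. c * f i j)) \<le> cmod c * onorm (mat2_op f)" for c f
    by (intro onorm_bound)
      (auto simp: op mult.assoc intro!: mult_left_mono onorm[OF mat2_op_bounded_linear] mult_nonneg_nonneg
        onorm_pos_le[OF mat2_op_bounded_linear])
  show ?thesis
  proof (cases "c = 0")
    case True
    then show ?thesis
      using le[of 0 f] onorm_pos_le[OF mat2_op_bounded_linear, of "\<lambda>i j. 0 * f i j"] by simp
  next
    case False
    have "(\<lambda>i j. inverse c * (c * f i j)) = f" using False by (simp flip: mult.assoc)
    then have "onorm (mat2_op f) \<le> cmod (inverse c) * onorm (mat2_op (\<lambda>i j. c * f i j))"
      using le[of "inverse c" "\<lambda>i j. c * f i j"] by simp
    then have "cmod c * onorm (mat2_op f) \<le> onorm (mat2_op (\<lambda>i j. c * f i j))"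
      using False by (simp add: norm_divide field_simps)
    then show ?thesis using le[of c f] by simp
  qed
qed

text \<open>Completeness reduces to that of the complex numbers: the norm dominates each entry and
  is dominated by the sum of the moduli of all four.\<close>

lemma mat2_cstar_algebra: "cstar_algebra mat2"
proof -
  interpret ring mat2 by (rule mat2_ring)
  have mod: "module (ring_of_type_algebra :: complex ring) mat2"
  proof (rule moduleI)
    show "cring (ring_of_type_algebra :: complex ring)" by (rule cring_from_type_algebra)
    show "abelian_group mat2" by (rule is_abelian_group)
  qed (auto simp: mat2_def algebra_simps)
  show ?thesis
  proof (rule cstar_algebra.intro[OF mat2_ring mod], unfold_locales)
    fix f :: "nat \<Rightarrow> nat \<Rightarrow> nat \<Rightarrow> complex"
    assume f: "\<And>n. f n \<in> carrier mat2"
      and cauchy: "\<forall>e>0. \<exists>M. \<forall>m\<ge>M. \<forall>n\<ge>M. cnorm mat2 (f m \<ominus>\<^bsub>mat2\<^esub> f n) < e"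
    have norm_diff: "cnorm mat2 (f m \<ominus>\<^bsub>mat2\<^esub> g) = onorm (mat2_op (\<lambda>i j. f m i j - g i j))"
      if "g \<in> carrier mat2" for m g
      using f that by (simp add: mat2_minus) (simp add: mat2_def)
    have "\<exists>l. (\<lambda>n. f n i j) \<longlonglongrightarrow> l" if ij: "i < 2" "j < 2" for i j
    proof -
      have "Cauchy (\<lambda>n. f n i j)"
      proof (rule metric_CauchyI)
        fix e :: real assume "e > 0"
        then obtain M where M: "\<forall>m\<ge>M. \<forall>n\<ge>M. cnorm mat2 (f m \<ominus>\<^bsub>mat2\<^esub> f n) < e" using cauchy by blast
        have "dist (f m i j) (f n i j) < e" if "m \<ge> M" "n \<ge> M" for m n
          using M that mat2_norm_entry[OF ij, of "\<lambda>i j. f m i j - f n i j"] norm_diff[OF f, of m n]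
          unfolding dist_norm by fastforce
        then show "\<exists>M. \<forall>m\<ge>M. \<forall>n\<ge>M. dist (f m i j) (f n i j) < e" by blast
      qed
      then show ?thesis using Cauchy_convergent_iff convergent_def by blast
    qed
    then obtain L where L: "\<And>i j. i < 2 \<Longrightarrow> j < 2 \<Longrightarrow> (\<lambda>n. f n i j) \<longlonglongrightarrow> L i j" by metis
    define l where "l i j = (if i < 2 \<and> j < 2 then L i j else 0)" for i j
    have l: "l \<in> carrier mat2" by (simp add: mat2_def l_def)
    have conv: "(\<lambda>n. cmod (f n i j - l i j)) \<longlonglongrightarrow> 0" if "i < 2" "j < 2" for i j
      using L[OF that] that by (simp add: l_def tendsto_norm_zero LIM_zero)
    have "(\<lambda>n. onorm (mat2_op (\<lambda>i j. f n i j - l i j))) \<longlonglongrightarrow> 0"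
    proof (rule tendsto_sandwich[OF _ _ tendsto_const])
      show "\<forall>\<^sub>F n in sequentially. 0 \<le> onorm (mat2_op (\<lambda>i j. f n i j - l i j))"
        by (simp add: onorm_pos_le[OF mat2_op_bounded_linear])
      show "\<forall>\<^sub>F n in sequentially. onorm (mat2_op (\<lambda>i j. f n i j - l i j)) \<le> cmod (f n 0 0 - l 0 0)
          + cmod (f n 0 1 - l 0 1) + (cmod (f n 1 0 - l 1 0) + cmod (f n 1 1 - l 1 1))"
        by (intro always_eventually allI mat2_norm_le_entries)
      have "(\<lambda>n. cmod (f n 0 0 - l 0 0) + cmod (f n 0 1 - l 0 1)
          + (cmod (f n 1 0 - l 1 0) + cmod (f n 1 1 - l 1 1))) \<longlonglongrightarrow> 0 + 0 + (0 + 0)"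
        by (intro tendsto_add conv) auto
      then show "(\<lambda>n. cmod (f n 0 0 - l 0 0) + cmod (f n 0 1 - l 0 1)
          + (cmod (f n 1 0 - l 1 0) + cmod (f n 1 1 - l 1 1))) \<longlonglongrightarrow> 0"
        by simp
    qed
    then show "\<exists>l\<in>carrier mat2. (\<lambda>n. cnorm mat2 (f n \<ominus>\<^bsub>mat2\<^esub> l)) \<longlonglongrightarrow> 0"
      using l by (intro bexI[of _ l]) (simp_all add: norm_diff[OF l])
  next
    fix x assume x: "x \<in> carrier mat2"
    show "cnorm mat2 x = 0 \<longleftrightarrow> x = \<zero>\<^bsub>mat2\<^esub>"
    proof
      assume "cnorm mat2 x = 0"
      then have "onorm (mat2_op x) = 0" by (simp add: mat2_def)
      then have "x i j = 0" if "i < 2" "j < 2" for i j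
        using mat2_norm_entry[OF that, of x] by simp
      then show "x = \<zero>\<^bsub>mat2\<^esub>"
        using x by (intro mat2_eqI) (auto simp: mat2_def)
    next
      assume "x = \<zero>\<^bsub>mat2\<^esub>"
      then show "cnorm mat2 x = 0"
        using mat2_norm_smult[of 0 x] by (simp add: mat2_def)
    qed
    show "cnorm mat2 (star mat2 x \<otimes>\<^bsub>mat2\<^esub> x) = (cnorm mat2 x)\<^sup>2"
      using mat2_cstar_identity[of x] by (simp add: mat2_def)
    show "0 \<le> cnorm mat2 x"
      by (simp add: mat2_def onorm_pos_le[OF mat2_op_bounded_linear])
  next
    fix x y assume "x \<in> carrier mat2" "y \<in> carrier mat2"
    have "mat2_op (x \<oplus>\<^bsub>mat2\<^esub> y) = (\<lambda>v. mat2_op x v + mat2_op y v)"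
      by (auto simp: mat2_op_def mat2_def algebra_simps)
    then show "cnorm mat2 (x \<oplus>\<^bsub>mat2\<^esub> y) \<le> cnorm mat2 x + cnorm mat2 y"
      using onorm_triangle[OF mat2_op_bounded_linear mat2_op_bounded_linear, of x y] by (simp add: mat2_def)
    show "cnorm mat2 (x \<otimes>\<^bsub>mat2\<^esub> y) \<le> cnorm mat2 x * cnorm mat2 y"
      using mat2_norm_mult[of x y] by (simp add: mat2_def)
  next
    fix x and c :: complex assume "x \<in> carrier mat2"
    show "cnorm mat2 (c \<odot>\<^bsub>mat2\<^esub> x) = cmod c * cnorm mat2 x"
      using mat2_norm_smult[of c x] by (simp add: mat2_def)
  qed (auto simp: mat2_def algebra_simps)
qed

lemma mat2_finsum:
  assumes "finite K" "\<And>k. k \<in> K \<Longrightarrow> f k \<in> carrier mat2"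
  shows "(\<Oplus>\<^bsub>mat2\<^esub>k\<in>K. f k) = (\<lambda>i j. \<Sum>k\<in>K. f k i j)"
  using assms
proof (induction K)
  case empty
  interpret ring mat2 by (rule mat2_ring)
  show ?case by (simp add: finsum_empty) (simp add: mat2_def)
next
  case (insert k K)
  interpret ring mat2 by (rule mat2_ring)
  show ?case using insert by (simp add: finsum_insert Pi_def) (simp add: mat2_def)
qed

text \<open>The permutation matrix of \<open>\<pi>\<close> with entries 0 and 1 read as scalar
  matrices; the induced homomorphism on C(S_N^+) is evaluation at \<open>\<pi>\<close>.\<close>

lemma magic_unitary_mat2_scalar:
  assumes "\<pi> permutes {1..N}"
  shows "magic_unitary N mat2 (\<lambda>i j a b. of_bool (i = \<pi> j \<and> a = b \<and> a < 2))"
proof -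
  have [simp]: "(\<lambda>a b. of_bool (P \<and> a = b \<and> a < 2)) \<in> carrier mat2" for P
    by (simp add: mat2_def)
  have col: "(\<Sum>k\<in>{1..N}. of_bool (k = \<pi> j \<and> Q)) = (of_bool Q :: complex)" if "j \<in> {1..N}" for j Q
    using permutes_in_image[OF assms, of j] that by (cases Q) (auto simp: of_bool_def)
  have eq: "i = \<pi> k \<longleftrightarrow> k = inv_into UNIV \<pi> i" for i k
    using permutes_inverses[OF assms] by metis
  have row: "(\<Sum>k\<in>{1..N}. of_bool (i = \<pi> k \<and> Q)) = (of_bool Q :: complex)" if "i \<in> {1..N}" for i Q
    using permutes_in_image[OF permutes_inv[OF assms], of i] that unfolding eq
    by (cases Q) (auto simp: of_bool_def)
  show ?thesis
    unfolding magic_unitary_def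
  proof (intro conjI ballI)
    fix i assume "i \<in> {1..N}"
    then show "(\<Oplus>\<^bsub>mat2\<^esub>k\<in>{1..N}. (\<lambda>a b. of_bool (i = \<pi> k \<and> a = b \<and> a < 2))) = \<one>\<^bsub>mat2\<^esub>"
      by (subst mat2_finsum) (simp_all only: row, simp_all add: mat2_def)
  next
    fix j assume "j \<in> {1..N}"
    then show "(\<Oplus>\<^bsub>mat2\<^esub>k\<in>{1..N}. (\<lambda>a b. of_bool (k = \<pi> j \<and> a = b \<and> a < 2))) = \<one>\<^bsub>mat2\<^esub>"
      by (subst mat2_finsum) (simp_all only: col, simp_all add: mat2_def)
  qed (auto simp: mat2_def fun_eq_iff less_2_cases_iff)
qed

section \<open>A magic unitary with noncommuting entries\<close>

definition mat2_of :: "complex \<Rightarrow> complex \<Rightarrow> complex \<Rightarrow> complex \<Rightarrow> nat \<Rightarrow> nat \<Rightarrow> complex" where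
  "mat2_of p q r s i j = (if i = 0 then if j = 0 then p else if j = 1 then q else 0
     else if i = 1 then if j = 0 then r else if j = 1 then s else 0 else 0)"

text \<open>The standard witness that S_N^+ is not classical for N at least 4: two diagonal blocks
  with rows \<open>(p, 1 - p)\<close> and \<open>(1 - p, p)\<close>, one for the projection onto the
  first basis vector and one for the projection onto the diagonal line, followed by an identity
  block.\<close>

definition noncommuting_magic :: "nat \<Rightarrow> nat \<Rightarrow> nat \<Rightarrow> nat \<Rightarrow> complex" where
  "noncommuting_magic i j =
    (if i \<in> {1, 2} \<and> j \<in> {1, 2} then if i = j then mat2_of 1 0 0 0 else mat2_of 0 0 0 1
     else if i \<in> {3, 4} \<and> j \<in> {3, 4} then if i = j then mat2_of (1/2) (1/2) (1/2) (1/2) else mat2_of (1/2) (-1/2) (-1/2) (1/2)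
     else if i = j then mat2_of 1 0 0 1 else mat2_of 0 0 0 0)"

lemma mat2_of_in: "mat2_of p q r s \<in> carrier mat2"
  by (auto simp: mat2_def mat2_of_def)

lemma magic_unitary_noncommuting:
  assumes "N \<ge> 4"
  shows "magic_unitary N mat2 noncommuting_magic"
proof -
  have in_A: "noncommuting_magic i j \<in> carrier mat2" for i j
    by (simp add: noncommuting_magic_def mat2_of_in)
  have sym: "noncommuting_magic i j = noncommuting_magic j i" for i j
    by (auto simp: noncommuting_magic_def)
  have row: "(\<Oplus>\<^bsub>mat2\<^esub>k\<in>{1..N}. noncommuting_magic i k) = \<one>\<^bsub>mat2\<^esub>" if i: "i \<in> {1..N}" for i
  proof -
    define E where "E = (if i \<in> {1, 2} then {1, 2} else if i \<in> {3, 4} then {3, 4} else {i})"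
    have E: "E \<subseteq> {1..N}" "\<And>k. k \<notin> E \<Longrightarrow> noncommuting_magic i k = mat2_of 0 0 0 0"
      using i assms by (auto simp: E_def noncommuting_magic_def)
    have "(\<Sum>k\<in>{1..N}. noncommuting_magic i k a b) = (\<Sum>k\<in>E. noncommuting_magic i k a b)" for a b
      using E by (intro sum.mono_neutral_right) (auto simp: mat2_of_def)
    also have "(\<Sum>k\<in>E. noncommuting_magic i k a b) = mat2_of 1 0 0 1 a b" for a b
      by (auto simp: E_def noncommuting_magic_def mat2_of_def)
    finally show ?thesis
      using in_A by (subst mat2_finsum) (auto simp: mat2_def mat2_of_def fun_eq_iff less_2_cases_iff)
  qed
  have "star mat2 (noncommuting_magic i j) = noncommuting_magic i j" for i j
    by (auto simp: mat2_def noncommuting_magic_def mat2_of_def fun_eq_iff)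
  moreover have "noncommuting_magic i j \<otimes>\<^bsub>mat2\<^esub> noncommuting_magic i j = noncommuting_magic i j" for i j
    by (auto simp: mat2_def noncommuting_magic_def mat2_of_def fun_eq_iff)
  moreover have "(\<Oplus>\<^bsub>mat2\<^esub>k\<in>{1..N}. noncommuting_magic k i) = \<one>\<^bsub>mat2\<^esub>" if "i \<in> {1..N}" for i
    using row[OF that] by (subst sym)
  ultimately show ?thesis
    using in_A row by (simp add: magic_unitary_def)
qed

lemma noncommuting_magic_noncommuting:
  "noncommuting_magic 1 1 \<otimes>\<^bsub>mat2\<^esub> noncommuting_magic 3 3 \<noteq> noncommuting_magic 3 3 \<otimes>\<^bsub>mat2\<^esub> noncommuting_magic 1 1"
proof
  assume "noncommuting_magic 1 1 \<otimes>\<^bsub>mat2\<^esub> noncommuting_magic 3 3 = noncommuting_magic 3 3 \<otimes>\<^bsub>mat2\<^esub> noncommuting_magic 1 1"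
  \<comment> \<open>These entries are 1/2 on the left and 0 on the right.\<close>
  then have "(noncommuting_magic 1 1 \<otimes>\<^bsub>mat2\<^esub> noncommuting_magic 3 3) 0 1 = (noncommuting_magic 3 3 \<otimes>\<^bsub>mat2\<^esub> noncommuting_magic 1 1) 0 1"
    by simp
  then show False by (simp add: mat2_def noncommuting_magic_def mat2_of_def)
qed

section \<open>The moments of the Haar state\<close>

lemma magic_algebraI:
  assumes "cstar_algebra A" "magic_unitary N A u"
  shows "magic_algebra A {1..N} u"
proof -
  interpret cstar_algebra A by (rule assms(1))
  show ?thesis
    by unfold_locales (use assms(2) in \<open>auto simp: magic_unitary_def\<close>)
qed

lemma star_homD:
  assumes "\<phi> \<in> star_hom A B"
  shows "x \<in> carrier A \<Longrightarrow> \<phi> x \<in> carrier B"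
    and "x \<in> carrier A \<Longrightarrow> y \<in> carrier A \<Longrightarrow> \<phi> (x \<otimes>\<^bsub>A\<^esub> y) = \<phi> x \<otimes>\<^bsub>B\<^esub> \<phi> y"
    and "x \<in> carrier A \<Longrightarrow> y \<in> carrier A \<Longrightarrow> \<phi> (x \<oplus>\<^bsub>A\<^esub> y) = \<phi> x \<oplus>\<^bsub>B\<^esub> \<phi> y"
    and "\<phi> \<one>\<^bsub>A\<^esub> = \<one>\<^bsub>B\<^esub>"
    and "x \<in> carrier A \<Longrightarrow> \<phi> (c \<odot>\<^bsub>A\<^esub> x) = c \<odot>\<^bsub>B\<^esub> \<phi> x"
  using assms by (auto simp: star_hom_def ring_hom_def)

lemma classical_evaluation_character:
  assumes \<phi>: "\<phi> \<in> star_hom A (classical_algebra N)" and \<pi>: "\<pi> permutes {1..N}"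
  shows "character A (\<lambda>x. \<phi> x \<pi>)"
  using star_homD[OF \<phi>] \<pi>
  by (simp add: character_def linear_functional_def) (simp add: classical_algebra_def)

text \<open>If all generators commuted, the evaluations at permutations would separate the points of
  \<open>A\<close>. The surjection onto C(S_N) would then be injective, against strictness.\<close>

lemma exotic_noncommuting:
  assumes gen: "generated_by_magic_unitary N A u"
    and strict: "strict_qsubgroup N (classical_algebra N) (classical_fund N) A u"
  obtains i j k l where "i \<in> {1..N}" "j \<in> {1..N}" "k \<in> {1..N}" "l \<in> {1..N}"
    "u i j \<otimes>\<^bsub>A\<^esub> u k l \<noteq> u k l \<otimes>\<^bsub>A\<^esub> u i j"
proof (rule ccontr)
  assume neg: "\<not> thesis"
  note witness = that
  have comm: "u i j \<otimes>\<^bsub>A\<^esub> u k l = u k l \<otimes>\<^bsub>A\<^esub> u i j"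
    if "i \<in> {1..N}" "j \<in> {1..N}" "k \<in> {1..N}" "l \<in> {1..N}" for i j k l
    using witness[OF that] neg by blast
  interpret magic_algebra A "{1..N}" u
    using gen by (intro magic_algebraI) (auto simp: generated_by_magic_unitary_def)
  obtain \<phi> where \<phi>: "\<phi> \<in> star_hom A (classical_algebra N)" "\<phi> ` carrier A = carrier (classical_algebra N)"
    "\<And>i j. i \<in> {1..N} \<Longrightarrow> j \<in> {1..N} \<Longrightarrow> \<phi> (u i j) = classical_fund N i j"
    "\<not> bij_betw \<phi> (carrier A) (carrier (classical_algebra N))"
    using strict by (auto simp: strict_qsubgroup_def generator_homs_def)
  have "inj_on \<phi> (carrier A)"
  proof (rule inj_onI)
    fix x y assume x: "x \<in> carrier A" and y: "y \<in> carrier A" and eq: "\<phi> x = \<phi> y"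
    have "x \<ominus>\<^bsub>A\<^esub> y = \<zero>\<^bsub>A\<^esub>"
    proof (rule zero_if_characters_vanish[OF comm])
      show "norm_dense A (star_subalgebra_gen A {u i j |i j. i \<in> {1..N} \<and> j \<in> {1..N}})"
        using gen by (simp add: generated_by_magic_unitary_def coeff_algebra_def)
      show "x \<ominus>\<^bsub>A\<^esub> y \<in> carrier A" using x y by (simp add: diff_eq_smult)
      fix \<pi> assume \<pi>: "\<pi> permutes {1..N}"
      have char: "character A (\<lambda>x. \<phi> x \<pi>)" using \<phi>(1) \<pi> by (rule classical_evaluation_character)
      then have "\<phi> (x \<ominus>\<^bsub>A\<^esub> y) \<pi> = \<phi> x \<pi> + (-1) * \<phi> y \<pi>"
        using x y unfolding diff_eq_smult[OF x y] character_def linear_functional_def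
        by (metis smult_in)
      then show "\<exists>\<chi>. character A \<chi> \<and> \<chi> (x \<ominus>\<^bsub>A\<^esub> y) = 0 \<and> (\<forall>i\<in>{1..N}. \<forall>j\<in>{1..N}. \<chi> (u i j) = of_bool (i = \<pi> j))"
        using char eq \<phi>(3) \<pi> by (intro exI[of _ "\<lambda>x. \<phi> x \<pi>"]) (simp add: classical_fund_def of_bool_def)
    qed
    then show "x = y"
      using add_diff_cancel[OF y x] y by simp
  qed
  with \<phi> show False by (simp add: bij_betw_def)
qed

lemma (in magic_algebra) character_word:
  assumes \<chi>: "character A \<chi>" "\<forall>i\<in>K. \<forall>j\<in>K. \<chi> (u i j) = of_bool (i = \<pi> j)"
    and "i1 \<in> K" "i2 \<in> K" "i3 \<in> K" "i4 \<in> K" "k1 \<in> K" "k2 \<in> K" "k3 \<in> K" "k4 \<in> K"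
  shows "\<chi> (word i1 k1 i2 k2 i3 k3 i4 k4) = of_bool (i1 = \<pi> k1 \<and> i2 = \<pi> k2 \<and> i3 = \<pi> k3 \<and> i4 = \<pi> k4)"
  using assms by (simp add: character_def word_def)

text \<open>A commutation relation in \<open>A\<close> pulls back along the isomorphism to C(S_N^+),
  and from there it would map to the noncommuting witness in the two by two matrices.\<close>

lemma universal_noncommuting:
  assumes S: "quantum_symmetric_group N S w" and N: "N \<ge> 4"
    and eq: "equal_qgroup N A u S w"
  shows "u 1 1 \<otimes>\<^bsub>A\<^esub> u 3 3 \<noteq> u 3 3 \<otimes>\<^bsub>A\<^esub> u 1 1"
proof
  assume comm: "u 1 1 \<otimes>\<^bsub>A\<^esub> u 3 3 = u 3 3 \<otimes>\<^bsub>A\<^esub> u 1 1"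
  have ind: "1 \<in> {1..N}" "3 \<in> {1..N}" using N by auto
  interpret S: magic_algebra S "{1..N}" w
    using S by (intro magic_algebraI) (auto simp: quantum_symmetric_group_def generated_by_magic_unitary_def)
  obtain \<phi> where \<phi>: "\<phi> \<in> star_hom S A" "bij_betw \<phi> (carrier S) (carrier A)"
    "\<And>i j. i \<in> {1..N} \<Longrightarrow> j \<in> {1..N} \<Longrightarrow> \<phi> (w i j) = u i j"
    using eq by (auto simp: equal_qgroup_def generator_homs_def)
  obtain \<psi> where \<psi>: "\<psi> \<in> star_hom S mat2" "\<forall>i\<in>{1..N}. \<forall>j\<in>{1..N}. \<psi> (w i j) = noncommuting_magic i j"
    using S magic_unitary_noncommuting[OF N] mat2_cstar_algebra
    unfolding quantum_symmetric_group_def by blast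
  have "\<phi> (w 1 1 \<otimes>\<^bsub>S\<^esub> w 3 3) = \<phi> (w 3 3 \<otimes>\<^bsub>S\<^esub> w 1 1)"
    using comm ind by (simp only: star_homD(2)[OF \<phi>(1)] \<phi>(3) S.u_in)
  moreover have "w 1 1 \<otimes>\<^bsub>S\<^esub> w 3 3 \<in> carrier S" "w 3 3 \<otimes>\<^bsub>S\<^esub> w 1 1 \<in> carrier S"
    using ind by (simp_all only: S.A_m_closed S.u_in)
  ultimately have "w 1 1 \<otimes>\<^bsub>S\<^esub> w 3 3 = w 3 3 \<otimes>\<^bsub>S\<^esub> w 1 1"
    using \<phi>(2) by (auto simp: bij_betw_def dest: inj_onD)
  then have "\<psi> (w 1 1 \<otimes>\<^bsub>S\<^esub> w 3 3) = \<psi> (w 3 3 \<otimes>\<^bsub>S\<^esub> w 1 1)"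
    by simp
  then have "noncommuting_magic 1 1 \<otimes>\<^bsub>mat2\<^esub> noncommuting_magic 3 3 = noncommuting_magic 3 3 \<otimes>\<^bsub>mat2\<^esub> noncommuting_magic 1 1"
    using ind \<psi>(2) by (simp only: star_homD(2)[OF \<psi>(1)] S.u_in)
  then show False using noncommuting_magic_noncommuting by simp
qed

text \<open>\<open>C(S\<^sub>N\<^sup>+)\<close> has evaluation functionals too; targets being restricted to one type, they are read off
  the scalar magic unitaries in the \<open>2 \<times> 2\<close> matrices.\<close>

lemma universal_evaluation:
  assumes S: "quantum_symmetric_group N S w" and A: "cstar_algebra A" "magic_unitary N A u"
    and eq: "equal_qgroup N A u S w" and \<pi>: "\<pi> permutes {1..N}"
  obtains \<chi> where "linear_functional A \<chi>" "\<chi> \<one>\<^bsub>A\<^esub> = 1"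
    "\<And>i1 i2 i3 i4 k1 k2 k3 k4. \<lbrakk>i1 \<in> {1..N}; i2 \<in> {1..N}; i3 \<in> {1..N}; i4 \<in> {1..N};
        k1 \<in> {1..N}; k2 \<in> {1..N}; k3 \<in> {1..N}; k4 \<in> {1..N}\<rbrakk> \<Longrightarrow>
      \<chi> (u i1 k1 \<otimes>\<^bsub>A\<^esub> u i2 k2 \<otimes>\<^bsub>A\<^esub> u i3 k3 \<otimes>\<^bsub>A\<^esub> u i4 k4)
        = of_bool (i1 = \<pi> k1 \<and> i2 = \<pi> k2 \<and> i3 = \<pi> k3 \<and> i4 = \<pi> k4)"
proof -
  interpret S: magic_algebra S "{1..N}" w
    using S by (intro magic_algebraI) (auto simp: quantum_symmetric_group_def generated_by_magic_unitary_def)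
  interpret A: magic_algebra A "{1..N}" u
    using A by (rule magic_algebraI)
  obtain \<phi> where \<phi>: "\<phi> \<in> star_hom S A" "bij_betw \<phi> (carrier S) (carrier A)"
    "\<And>i j. i \<in> {1..N} \<Longrightarrow> j \<in> {1..N} \<Longrightarrow> \<phi> (w i j) = u i j"
    using eq by (auto simp: equal_qgroup_def generator_homs_def)
  obtain \<psi> where \<psi>: "\<psi> \<in> star_hom S mat2"
    "\<forall>i\<in>{1..N}. \<forall>j\<in>{1..N}. \<psi> (w i j) = (\<lambda>a b. of_bool (i = \<pi> j \<and> a = b \<and> a < 2))"
    using S magic_unitary_mat2_scalar[OF \<pi>] mat2_cstar_algebra
    unfolding quantum_symmetric_group_def by blast
  note \<phi>_hom = star_homD[OF \<phi>(1)] and \<psi>_hom = star_homD[OF \<psi>(1)]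
  \<comment> \<open>The homomorphism \<open>\<psi>\<close> starts at C(S_N^+) while the functional
    is wanted on \<open>A\<close>, so the isomorphism has to be inverted.\<close>
  define \<phi>' where "\<phi>' = inv_into (carrier S) \<phi>"
  have \<phi>': "\<phi>' (\<phi> x) = x" if "x \<in> carrier S" for x
    using that \<phi>(2) by (simp add: \<phi>'_def bij_betw_def)
  have surj: "\<exists>y\<in>carrier S. x = \<phi> y" if "x \<in> carrier A" for x
    using that \<phi>(2) by (auto simp: bij_betw_def)
  define \<chi> where "\<chi> x = \<psi> (\<phi>' x) 0 0" for x
  have \<chi>: "\<chi> (\<phi> x) = \<psi> x 0 0" if "x \<in> carrier S" for x
    using that by (simp add: \<chi>_def \<phi>')
  show ?thesis
  proof (rule that)
    show "linear_functional A \<chi>"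
      unfolding linear_functional_def
    proof (intro conjI ballI allI)
      fix x y assume "x \<in> carrier A" "y \<in> carrier A"
      then obtain x' y' where *: "x = \<phi> x'" "y = \<phi> y'" "x' \<in> carrier S" "y' \<in> carrier S"
        using surj by blast
      then have "\<chi> (x \<oplus>\<^bsub>A\<^esub> y) = \<psi> (x' \<oplus>\<^bsub>S\<^esub> y') 0 0"
        using \<chi>[of "x' \<oplus>\<^bsub>S\<^esub> y'"] by (simp add: \<phi>_hom S.A_a_closed)
      then show "\<chi> (x \<oplus>\<^bsub>A\<^esub> y) = \<chi> x + \<chi> y"
        using * \<chi> by (simp add: \<psi>_hom) (simp add: mat2_def)
    next
      fix x c assume "x \<in> carrier A"
      then obtain x' where *: "x = \<phi> x'" "x' \<in> carrier S"
        using surj by blast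
      then have "\<chi> (c \<odot>\<^bsub>A\<^esub> x) = \<psi> (c \<odot>\<^bsub>S\<^esub> x') 0 0"
        using \<chi>[of "c \<odot>\<^bsub>S\<^esub> x'"] by (simp add: \<phi>_hom)
      then show "\<chi> (c \<odot>\<^bsub>A\<^esub> x) = c * \<chi> x"
        using * \<chi> by (simp add: \<psi>_hom) (simp add: mat2_def)
    qed
    show "\<chi> \<one>\<^bsub>A\<^esub> = 1"
      using \<chi>[of "\<one>\<^bsub>S\<^esub>"] by (simp add: \<phi>_hom \<psi>_hom) (simp add: mat2_def)
    fix i1 i2 i3 i4 k1 k2 k3 k4
    assume i: "i1 \<in> {1..N}" "i2 \<in> {1..N}" "i3 \<in> {1..N}" "i4 \<in> {1..N}"
      and k: "k1 \<in> {1..N}" "k2 \<in> {1..N}" "k3 \<in> {1..N}" "k4 \<in> {1..N}"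
    let ?w = "w i1 k1 \<otimes>\<^bsub>S\<^esub> w i2 k2 \<otimes>\<^bsub>S\<^esub> w i3 k3 \<otimes>\<^bsub>S\<^esub> w i4 k4"
    have "u i1 k1 \<otimes>\<^bsub>A\<^esub> u i2 k2 \<otimes>\<^bsub>A\<^esub> u i3 k3 \<otimes>\<^bsub>A\<^esub> u i4 k4 = \<phi> ?w"
      using i k by (simp only: \<phi>_hom \<phi>(3) S.u_in S.A_m_closed)
    then have "\<chi> (u i1 k1 \<otimes>\<^bsub>A\<^esub> u i2 k2 \<otimes>\<^bsub>A\<^esub> u i3 k3 \<otimes>\<^bsub>A\<^esub> u i4 k4) = \<psi> ?w 0 0"
      using i k \<chi>[of ?w] by (simp only: S.u_in S.A_m_closed)
    \<comment> \<open>The images of the generators are scalar matrices, and on these the entry at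
      (0,0) is multiplicative.\<close>
    also have "\<dots> = (\<psi> (w i1 k1) \<otimes>\<^bsub>mat2\<^esub> \<psi> (w i2 k2) \<otimes>\<^bsub>mat2\<^esub> \<psi> (w i3 k3) \<otimes>\<^bsub>mat2\<^esub> \<psi> (w i4 k4)) 0 0"
      using i k by (simp only: \<psi>_hom S.u_in S.A_m_closed)
    also have "\<dots> = of_bool (i1 = \<pi> k1 \<and> i2 = \<pi> k2 \<and> i3 = \<pi> k3 \<and> i4 = \<pi> k4)"
      using i k \<psi>(2) by (simp add: mat2_def)
    finally show "\<chi> (u i1 k1 \<otimes>\<^bsub>A\<^esub> u i2 k2 \<otimes>\<^bsub>A\<^esub> u i3 k3 \<otimes>\<^bsub>A\<^esub> u i4 k4)
        = of_bool (i1 = \<pi> k1 \<and> i2 = \<pi> k2 \<and> i3 = \<pi> k3 \<and> i4 = \<pi> k4)" .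
  qed
qed

theorem theorem4p3:
  fixes N :: nat
    and A :: "'a cstar" (structure) and u :: "nat \<Rightarrow> nat \<Rightarrow> 'a"
    and T :: "'t cstar" and \<tau> :: "'a \<Rightarrow> 'a \<Rightarrow> 't" and \<Delta> :: "'a \<Rightarrow> 't"
    and S :: "'s cstar" and w :: "nat \<Rightarrow> nat \<Rightarrow> 's"
    and h :: "'a \<Rightarrow> complex"
  assumes "N \<ge> 4"
    and "quantum_permutation_group N A u T \<tau> \<Delta>"
    and "quantum_symmetric_group N S w"
    and "equal_qgroup N A u S w \<or> exotic N S w A u"
    and "haar_state A T \<tau> \<Delta> h"
  shows
    "h (u 1 1 \<otimes> u 2 2 \<otimes> u 1 1 \<otimes> u 2 2) = (2 * of_nat N - 5) / q_poly N \<and>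
     h (u 1 1 \<otimes> u 2 2 \<otimes> u 1 1 \<otimes> u 2 3) = (of_nat N - 3) / q_poly N \<and>
     h (u 1 1 \<otimes> u 2 2 \<otimes> u 1 1 \<otimes> u 3 3) = (of_nat N - 2) / q_poly N \<and>
     h (u 1 1 \<otimes> u 2 2 \<otimes> u 1 3 \<otimes> u 2 4) = - 1 / q_poly N \<and>
     h (u 1 1 \<otimes> u 2 2 \<otimes> u 1 3 \<otimes> u 3 2) = - (of_nat N - 3) / ((of_nat N - 2) * q_poly N) \<and>
     h (u 1 1 \<otimes> u 2 2 \<otimes> u 1 3 \<otimes> u 3 4) = 1 / ((of_nat N - 2) * q_poly N) \<and>
     h (u 1 1 \<otimes> u 2 2 \<otimes> u 3 3 \<otimes> u 4 4) = of_nat N / ((of_nat N - 2) * q_poly N)"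
proof -
  have gen: "generated_by_magic_unitary N A u" and min: "min_tensor_product A A T \<tau>" and \<Delta>: "\<Delta> \<in> star_hom A T"
    and \<Delta>_u: "\<And>i j. i \<in> {1..N} \<Longrightarrow> j \<in> {1..N} \<Longrightarrow> \<Delta> (u i j) = (\<Oplus>\<^bsub>T\<^esub>k\<in>{1..N}. \<tau> (u i k) (u k j))"
    using assms(2) by (auto simp: quantum_permutation_group_def)
  have A: "cstar_algebra A" and magic: "magic_unitary N A u"
    using gen by (auto simp: generated_by_magic_unitary_def)
  interpret magic_algebra A "{1..N}" u
    using A magic by (rule magic_algebraI)
  obtain H where H: "is_slice_map A T (\<lambda>a b. \<tau> b a) h H" "\<And>f. f \<in> carrier A \<Longrightarrow> H (\<Delta> f) = h f \<odot> \<one>"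
    and lin: "linear_functional A h" and h1: "h \<one> = 1"
    using assms(5) by (auto simp: haar_state_def state_def)
  have fixed: "(\<Oplus>k1\<in>{1..N}. \<Oplus>k2\<in>{1..N}. \<Oplus>k3\<in>{1..N}. \<Oplus>k4\<in>{1..N}.
      h (word k1 j1 k2 j2 k3 j3 k4 j4) \<odot> word i1 k1 i2 k2 i3 k3 i4 k4) = h (word i1 j1 i2 j2 i3 j3 i4 j4) \<odot> \<one>"
    if "i1 \<in> {1..N}" "i2 \<in> {1..N}" "i3 \<in> {1..N}" "i4 \<in> {1..N}"
      "j1 \<in> {1..N}" "j2 \<in> {1..N}" "j3 \<in> {1..N}" "j4 \<in> {1..N}" for i1 i2 i3 i4 j1 j2 j3 j4
    using min \<Delta> \<Delta>_u H that by (rule haar_fixed_vector)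
  \<comment> \<open>Evaluation at \<open>\<pi>\<close> comes from the universal property for S_N^+,
    and from the given map onto C(S_N) in the exotic case.\<close>
  have eval: "\<exists>\<chi>. linear_functional A \<chi> \<and> \<chi> \<one> = 1 \<and>
      (\<forall>i1\<in>{1..N}. \<forall>i2\<in>{1..N}. \<forall>i3\<in>{1..N}. \<forall>i4\<in>{1..N}. \<forall>k1\<in>{1..N}. \<forall>k2\<in>{1..N}. \<forall>k3\<in>{1..N}. \<forall>k4\<in>{1..N}.
        \<chi> (word i1 k1 i2 k2 i3 k3 i4 k4) = of_bool (i1 = \<pi> k1 \<and> i2 = \<pi> k2 \<and> i3 = \<pi> k3 \<and> i4 = \<pi> k4))"
    if \<pi>: "\<pi> permutes {1..N}" for \<pi>
    using assms(4)
  proof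
    assume "equal_qgroup N A u S w"
    from universal_evaluation[OF assms(3) A magic this \<pi>] show ?thesis
      unfolding word_def by metis
  next
    assume "exotic N S w A u"
    then obtain \<phi> where \<phi>: "\<phi> \<in> star_hom A (classical_algebra N)"
      "\<And>i j. i \<in> {1..N} \<Longrightarrow> j \<in> {1..N} \<Longrightarrow> \<phi> (u i j) = classical_fund N i j"
      by (auto simp: exotic_def strict_qsubgroup_def generator_homs_def)
    have char: "character A (\<lambda>x. \<phi> x \<pi>)" using \<phi>(1) \<pi> by (rule classical_evaluation_character)
    have "\<forall>i\<in>{1..N}. \<forall>j\<in>{1..N}. \<phi> (u i j) \<pi> = of_bool (i = \<pi> j)"
      using \<phi>(2) \<pi> by (simp add: classical_fund_def of_bool_def)
    with char show ?thesis
      by (intro exI[of _ "\<lambda>x. \<phi> x \<pi>"] conjI ballI character_word) (simp_all add: character_def)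
  qed
  interpret permutation_invariant_functional A "{1..N}" u h "of_nat N"
  proof unfold_locales
    fix \<pi> i1 i2 i3 i4 j1 j2 j3 j4
    assume \<pi>: "\<pi> permutes {1..N}"
      and i: "i1 \<in> {1..N}" "i2 \<in> {1..N}" "i3 \<in> {1..N}" "i4 \<in> {1..N}"
      and j: "j1 \<in> {1..N}" "j2 \<in> {1..N}" "j3 \<in> {1..N}" "j4 \<in> {1..N}"
    obtain \<chi> where \<chi>: "linear_functional A \<chi>" "\<chi> \<one> = 1"
      "\<And>i1 i2 i3 i4 k1 k2 k3 k4. \<lbrakk>i1 \<in> {1..N}; i2 \<in> {1..N}; i3 \<in> {1..N}; i4 \<in> {1..N};
        k1 \<in> {1..N}; k2 \<in> {1..N}; k3 \<in> {1..N}; k4 \<in> {1..N}\<rbrakk> \<Longrightarrow>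
        \<chi> (word i1 k1 i2 k2 i3 k3 i4 k4) = of_bool (i1 = \<pi> k1 \<and> i2 = \<pi> k2 \<and> i3 = \<pi> k3 \<and> i4 = \<pi> k4)"
      using eval[OF \<pi>] by metis
    have \<pi>_in: "\<pi> k \<in> {1..N}" if "k \<in> {1..N}" for k using that \<pi> by (simp only: permutes_in_image)
    show "h (word (\<pi> i1) j1 (\<pi> i2) j2 (\<pi> i3) j3 (\<pi> i4) j4) = h (word i1 j1 i2 j2 i3 j3 i4 j4)"
      by (rule invariant_under_permutation[OF fixed \<chi> \<pi> i j]) (rule i[THEN \<pi>_in] j)+
  qed (use lin h1 assms(1) in simp_all)
  obtain i' j' k' l' where noncomm: "i' \<in> {1..N}" "j' \<in> {1..N}" "k' \<in> {1..N}" "l' \<in> {1..N}"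
    "u i' k' \<otimes> u j' l' \<noteq> u j' l' \<otimes> u i' k'"
    using assms(4)
  proof
    assume "equal_qgroup N A u S w"
    from universal_noncommuting[OF assms(3,1) this] show ?thesis
      using that[of 1 3 1 3] assms(1) by simp
  next
    assume "exotic N S w A u"
    then show ?thesis
      using exotic_noncommuting[OF gen] that unfolding exotic_def by metis
  qed
  \<comment> \<open>\<open>D\<close> is the moment of two generators in different rows and columns;
    every right-hand side of the linear system is 0, \<open>D\<close> or
    \<open>D / (n - 2)\<close>.\<close>
  define n D where "n = complex_of_nat N" and "D = 1 / (n * (n - 1))"
  define m where "m = n\<^sup>2 - 3 * n + 1"
  have ne: "n \<noteq> 0" "n - 1 \<noteq> 0" "n - 2 \<noteq> 0" "n - 3 \<noteq> 0" "m \<noteq> 0"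
    using n_ne unfolding n_def m_def by auto
  have q: "1 / q_poly N = D / m"
    by (simp add: q_poly_def D_def n_def m_def)
  have E: "1 / (n * (n - 1) * (n - 2)) = D / (n - 2)"
    by (simp add: D_def)
  have ind: "1 \<in> {1..N}" "2 \<in> {1..N}" "3 \<in> {1..N}" "4 \<in> {1..N}" "distinct [1, 2, 3, 4 :: nat]"
    using assms(1) by auto
  let ?x = "\<lambda>a b c d. h (word 1 a 2 b 1 c 2 d)" and ?p = "\<lambda>a b c d. h (word 1 a 2 b 1 c 3 d)"
    and ?r = "\<lambda>a b c d. h (word 1 a 2 b 3 c 4 d)"
  \<comment> \<open>Solved once for all columns with distinct neighbours. The seven moments have row
    patterns 1212, 1213 and 1234, and column patterns 1212, 1213, 1234 and 1232.\<close>
  have sol: "?x a b c d = ((n - 3) * (if a = c then D else 0) + (n - 2) * (if b = d then D else 0)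
      - (n - 2) * (if a = c then 0 else if a = d then 0 else D / (n - 2))) / m"
    "?p a b c d = ((if a = c then D else 0) - ?x a b c d) / (n - 2)"
    "?r a b c d = ((if a = c then D else 0) - ?x a b c d) / (n - 2)
      + ((if b = d then D else 0) - ?x a b c d) / (n - 2) - ?x a b c d"
    if a: "a \<in> {1..N}" "b \<in> {1..N}" "c \<in> {1..N}" "d \<in> {1..N}" "a \<noteq> b" "b \<noteq> c" "c \<noteq> d"
    for a b c d
  proof -
    note eqs = word_equations[OF ind a, folded n_def, folded D_def, unfolded E]
    have "?x a b c d - ?p a b c d - h (word 1 a 2 b 3 c 2 d) + ?r a b c d = 0"
      using a(1-4) by (intro crossing_coefficient_zero[OF ind a(1-4) _ noncomm] fixed)
    note sol = solve_word_equations[OF ne(3,4) ne(5)[unfolded m_def] eqs this, folded m_def]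
    show "?x a b c d = ((n - 3) * (if a = c then D else 0) + (n - 2) * (if b = d then D else 0)
        - (n - 2) * (if a = c then 0 else if a = d then 0 else D / (n - 2))) / m"
      by (rule sol(1))
    show "?p a b c d = ((if a = c then D else 0) - ?x a b c d) / (n - 2)"
      by (rule sol(2))
    show "?r a b c d = ((if a = c then D else 0) - ?x a b c d) / (n - 2)
        + ((if b = d then D else 0) - ?x a b c d) / (n - 2) - ?x a b c d"
      using sol(2,3,4) by simp
  qed
  \<comment> \<open>This is \<open>1 / q_poly N\<close>; in terms of it all values become
    polynomials in \<open>n\<close> times \<open>e\<close>, divided at most by
    \<open>n - 2\<close>.\<close>
  define e where "e = D / m"
  have D_eq: "D = m * e" using ne by (simp add: e_def)
  have x1: "?x 1 2 1 2 = (2 * n - 5) * e"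
  proof -
    have "?x 1 2 1 2 = ((n - 3) * D + (n - 2) * D - (n - 2) * 0) / m"
      using ind by (subst sol(1)) simp_all
    also have "(n - 3) * D + (n - 2) * D - (n - 2) * 0 = (2 * n - 5) * D"
      by (simp add: algebra_simps)
    also have "\<dots> / m = (2 * n - 5) * e" by (simp add: e_def)
    finally show ?thesis .
  qed
  have x2: "?x 1 2 1 3 = (n - 3) * e"
  proof -
    have "?x 1 2 1 3 = ((n - 3) * D + (n - 2) * 0 - (n - 2) * 0) / m"
      using ind by (subst sol(1)) simp_all
    then show ?thesis by (simp add: e_def)
  qed
  have p2: "?p 1 2 1 3 = (n - 2) * e"
  proof -
    have "?p 1 2 1 3 = (D - ?x 1 2 1 3) / (n - 2)"
      using ind by (subst sol(2)) simp_all
    \<comment> \<open>With \<open>D = m * e\<close>, the identity behind this is n^2 - 3n + 1 - (n -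
      3) = (n - 2)^2.\<close>
    also have "D - ?x 1 2 1 3 = (n - 2) * e * (n - 2)"
      unfolding x2 D_eq m_def by (simp add: algebra_simps power2_eq_square)
    finally show ?thesis using ne by simp
  qed
  have x3: "?x 1 2 3 4 = - e"
  proof -
    have "?x 1 2 3 4 = ((n - 3) * 0 + (n - 2) * 0 - (n - 2) * (D / (n - 2))) / m"
      using ind by (subst sol(1)) simp_all
    then show ?thesis using ne by (simp add: e_def)
  qed
  have p3: "?p 1 2 3 4 = e / (n - 2)"
  proof -
    have "?p 1 2 3 4 = (0 - ?x 1 2 3 4) / (n - 2)"
      using ind by (subst sol(2)) simp_all
    then show ?thesis using x3 by simp
  qed
  have r3: "?r 1 2 3 4 = n * e / (n - 2)"
  proof -
    have "?r 1 2 3 4 = (0 - ?x 1 2 3 4) / (n - 2) + (0 - ?x 1 2 3 4) / (n - 2) - ?x 1 2 3 4"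
      using ind by (subst sol(3)) simp_all
    also have "\<dots> = e / (n - 2) + e / (n - 2) + (n - 2) * e / (n - 2)"
      using ne x3 by simp
    also have "\<dots> = n * e / (n - 2)"
      unfolding add_divide_distrib[symmetric] by (simp add: algebra_simps)
    finally show ?thesis .
  qed
  have p4: "?p 1 2 3 2 = - (n - 3) * e / (n - 2)"
  proof -
    have "?x 1 2 3 2 = ((n - 3) * 0 + (n - 2) * D - (n - 2) * (D / (n - 2))) / m"
      using ind by (subst sol(1)) simp_all
    also have "(n - 3) * 0 + (n - 2) * D - (n - 2) * (D / (n - 2)) = (n - 2) * D - D"
      using ne by simp
    also have "\<dots> = (n - 3) * D" by (simp add: algebra_simps)
    also have "\<dots> / m = (n - 3) * e" by (simp add: e_def)
    finally have "?x 1 2 3 2 = (n - 3) * e" .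
    moreover have "?p 1 2 3 2 = (0 - ?x 1 2 3 2) / (n - 2)"
      using ind by (subst sol(2)) simp_all
    ultimately show ?thesis by (simp only: diff_0 mult_minus_left)
  qed
  have frac: "a / q_poly N = a * e" "a / ((n - 2) * q_poly N) = a * e / (n - 2)" for a
    unfolding e_def q[symmetric] by (simp_all add: mult.commute)
  show ?thesis
    using x1 x2 p2 x3 p3 r3 p4 unfolding n_def[symmetric] frac word_def by simp
qed

end
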